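(* Let $r\geq 4$ and $\rho_r=(r-1)!\sqrt[r]{4}$. If $H$ is a connected $r$-uniform hypergraph with $\rho(H)=\rho_r$, then $H$ is isomorphic to one of the following: (1) $C^{(r)}_n$ ($n\geq3$), $\tilde D^{(r)}_n$ ($n\geq5$), $\tilde B^{(r)}_n$ ($n\geq 8$), $\widetilde{BD}^{(r)}_n$ ($n\geq 6$), $C^{(r)}_2$, $S^{(r)}_4$, $\tilde E^{(r)}_6$, $\tilde E^{(r)}_7$, $\tilde E^{(r)}_8$, $F^{(r)}_{2,3,4}$, $F^{(r)}_{2,2,7}$, $F^{(r)}_{1,5,6}$, $F^{(r)}_{1,4,8}$, $F^{(r)}_{1,3,14}$, $G^{(r)}_{1,1:0:1,4}$, $G^{(r)}_{1,1:6:1,3}$; (2) $H^{(r)}_{1,1,2,2}$.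
   Context: An $r$-uniform hypergraph $H=(V,E)$ has a finite vertex set $V$ and edge set $E\subseteq\binom{V}{r}$; connectedness is via walks $v_0e_1v_1\cdots e_lv_l$ with $v_{i-1},v_i\in e_i$. The spectral radius is $\rho(H)=\max_{x\in\mathbb{R}^{V}_{\geq 0},x\neq 0} \frac{r!\sum_{e\in E}\prod_{v\in e}x_v}{\sum_{v\in V}x_v^r}$. Extension: $H$ extends $H'$ if $H$ is obtained from $H'$ by adding to each edge one new vertex (distinct new vertices for distinct edges). $3$-uniform families. A path of length $k\geq1$ is a sequence of edges $e_1,\dots,e_k$ with $|e_i\cap e_{i+1}|=1$ and $e_i\cap e_j=\emptyset$ for $|i-j|\geq2$. Attaching a pendant path of length $k\geq1$ at a vertex $v$ means adding such a path with $v\in e_1$, $v\notin e_j$ for $j\geq2$, all other vertices new; a pendant edge is a pendant path of length 1. - $C^{(3)}_n$ ($n\geq3$): distinct vertices $v_1,\dots,v_n,w_1,\dots,w_n$ with edges $\{v_i,v_{i+1},w_i\}$ (indices mod $n$). $C^{(3)}_2$: two edges sharing exactly two vertices. $S^{(3)}_4$: four edges pairwise meeting exactly in one common vertex. - $E^{(3)}_{i,j,k}$: vertex $v$ with pendant paths of lengths $i,j,k$ at $v$; $\tilde E^{(3)}_6=E^{(3)}_{2,2,2}$, $\tilde E^{(3)}_7=E^{(3)}_{1,3,3}$, $\tilde E^{(3)}_8=E^{(3)}_{1,2,5}$. - $F^{(3)}_{i,j,k}$: edge $\{a,b,c\}$ with pendant paths of lengths $i,j,k$ at $a,b,c$. -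 $G^{(3)}_{i,j:k:l,m}$: path $e_0,\dots,e_{k+1}$ ($k\ge 0$); $u_1,u_2$ the vertices of $e_0$ not in $e_1$, $u_3,u_4$ those of $e_{k+1}$ not in $e_k$; attach pendant paths of lengths $i,j,l,m$ at $u_1,u_2,u_3,u_4$. $\tilde B^{(3)}_n=G^{(3)}_{1,2:(n-8):1,2}$. - $\tilde D^{(3)}_n$: path $e_1,\dots,e_{n-2}$ with pendant edges at the vertices of $e_1\cap e_2$ and $e_{n-3}\cap e_{n-2}$. - $\widetilde{BD}^{(3)}_n$: path $e_1,\dots,e_{n-2}$ with a pendant edge at the vertex of $e_1\cap e_2$ and a pendant edge at the unique vertex of $e_{n-4}$ in no other edge of the path. For each such $X^{(3)}$, $X^{(r)}$ is obtained from $X^{(3)}$ by extending $r-3$ times. $H^{(4)}_{i,j,k,l}$: a $4$-element edge $\{a,b,c,d\}$ with $4$-uniform pendant paths of lengths $i,j,k,l$ at $a,b,c,d$; $H^{(r)}_{i,j,k,l}$ is obtained from it by extending $r-4$ times. *)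

theory Defs
  imports Complex_Main
begin

section \<open>Uniform hypergraphs\<close>

datatype 'a hypergraph = Hypergraph (verts: "'a set") (edges: "'a set set")

definition uniform_hypergraph :: "nat \<Rightarrow> 'a hypergraph \<Rightarrow> bool" where
  "uniform_hypergraph r H \<longleftrightarrow>
     finite (verts H) \<and> (\<forall>e\<in>edges H. e \<subseteq> verts H \<and> card e = r)"

text \<open>The walk \<open>v\<^sub>0 e\<^sub>1 v\<^sub>1 \<dots> e\<^sub>l v\<^sub>l\<close> is given by the lists \<open>vs = [v\<^sub>0, \<dots>, v\<^sub>l]\<close> and
  \<open>es = [e\<^sub>1, \<dots>, e\<^sub>l]\<close>; the case \<open>l = 0\<close> is allowed.\<close>

definition hyper_walk :: "'a hypergraph \<Rightarrow> 'a list \<Rightarrow> 'a set list \<Rightarrow> bool" where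
  "hyper_walk H vs es \<longleftrightarrow>
     set vs \<subseteq> verts H \<and> set es \<subseteq> edges H \<and> length vs = Suc (length es) \<and>
     (\<forall>i < length es. vs ! i \<in> es ! i \<and> vs ! Suc i \<in> es ! i)"

text \<open>The empty hypergraph is not connected; it has no nonzero vector, hence no spectral radius.\<close>

definition connected_hypergraph :: "'a hypergraph \<Rightarrow> bool" where
  "connected_hypergraph H \<longleftrightarrow>
     verts H \<noteq> {} \<and>
     (\<forall>u\<in>verts H. \<forall>v\<in>verts H. \<exists>vs es. hyper_walk H vs es \<and> hd vs = u \<and> last vs = v)"

text \<open>The maximum below exists whenever \<open>H\<close> is \<open>r\<close>-uniform with nonempty vertex set. Vectors
  indexed by the vertices are functions, of which only the values on \<open>verts H\<close> matter.\<close>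

definition spectral_radius :: "nat \<Rightarrow> 'a hypergraph \<Rightarrow> real" where
  "spectral_radius r H =
     (GREATEST t. \<exists>x :: 'a \<Rightarrow> real. (\<forall>v\<in>verts H. x v \<ge> 0) \<and> (\<exists>v\<in>verts H. x v \<noteq> 0) \<and>
        t = fact r * (\<Sum>e\<in>edges H. \<Prod>v\<in>e. x v) / (\<Sum>v\<in>verts H. x v ^ r))"

definition hypergraph_iso :: "'a hypergraph \<Rightarrow> 'b hypergraph \<Rightarrow> bool" where
  "hypergraph_iso H K \<longleftrightarrow>
     (\<exists>f. bij_betw f (verts H) (verts K) \<and> (\<lambda>e. f ` e) ` edges H = edges K)"


section \<open>Extensions\<close>

definition extends :: "'a hypergraph \<Rightarrow> 'a hypergraph \<Rightarrow> bool" where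
  "extends H H' \<longleftrightarrow>
     (\<exists>g. inj_on g (edges H') \<and> g ` edges H' \<inter> verts H' = {} \<and>
        verts H = verts H' \<union> g ` edges H' \<and>
        edges H = (\<lambda>e. insert (g e) e) ` edges H')"

text \<open>A hypergraph that is defined up to isomorphism is represented by the predicate of being
  a copy of it. If \<open>X\<close> is such a predicate for an \<open>s\<close>-uniform hypergraph, \<open>extended s r X\<close> is
  the predicate for its \<open>r\<close>-uniform version.\<close>

definition extended :: "nat \<Rightarrow> nat \<Rightarrow> ('a hypergraph \<Rightarrow> bool) \<Rightarrow> 'a hypergraph \<Rightarrow> bool" where
  "extended s r X H \<longleftrightarrow> (\<exists>H'. X H' \<and> (extends ^^ (r - s)) H H')"

definition isomorphic_to :: "'a hypergraph \<Rightarrow> ('a hypergraph \<Rightarrow> bool) \<Rightarrow> bool" where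
  "isomorphic_to H X \<longleftrightarrow> (\<exists>K. X K \<and> hypergraph_iso H K)"


section \<open>Paths and pendant paths\<close>

definition hyper_path :: "nat \<Rightarrow> 'a set list \<Rightarrow> bool" where
  "hyper_path r es \<longleftrightarrow>
     es \<noteq> [] \<and> (\<forall>e\<in>set es. finite e \<and> card e = r) \<and>
     (\<forall>i. Suc i < length es \<longrightarrow> card (es ! i \<inter> es ! Suc i) = 1) \<and>
     (\<forall>i j. i + 2 \<le> j \<and> j < length es \<longrightarrow> es ! i \<inter> es ! j = {})"

definition path_hypergraph :: "'a set list \<Rightarrow> 'a hypergraph" where
  "path_hypergraph es = Hypergraph (\<Union> (set es)) (set es)"

text \<open>\<open>attach r k v H H'\<close>: the hypergraph \<open>H'\<close> arises from \<open>H\<close> by attaching an \<open>r\<close>-uniform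
  pendant path of length \<open>k\<close> at \<open>v\<close>.\<close>

definition attach :: "nat \<Rightarrow> nat \<Rightarrow> 'a \<Rightarrow> 'a hypergraph \<Rightarrow> 'a hypergraph \<Rightarrow> bool" where
  "attach r k v H H' \<longleftrightarrow>
     (\<exists>es. hyper_path r es \<and> length es = k \<and> v \<in> verts H \<and>
        v \<in> es ! 0 \<and> (\<forall>j. 1 \<le> j \<and> j < k \<longrightarrow> v \<notin> es ! j) \<and>
        (\<Union> (set es) - {v}) \<inter> verts H = {} \<and>
        H' = Hypergraph (verts H \<union> \<Union> (set es)) (edges H \<union> set es))"


section \<open>The 3-uniform families\<close>

definition C3 :: "nat \<Rightarrow> 'a hypergraph \<Rightarrow> bool" where
  "C3 n H \<longleftrightarrow>
     (\<exists>v w. inj_on v {..<n} \<and> inj_on w {..<n} \<and> v ` {..<n} \<inter> w ` {..<n} = {} \<and>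
        H = Hypergraph (v ` {..<n} \<union> w ` {..<n})
              ((\<lambda>i. {v i, v (Suc i mod n), w i}) ` {..<n}))"

definition C3_2 :: "'a hypergraph \<Rightarrow> bool" where
  "C3_2 H \<longleftrightarrow>
     (\<exists>e f. card e = 3 \<and> card f = 3 \<and> card (e \<inter> f) = 2 \<and> H = Hypergraph (e \<union> f) {e, f})"

definition S3_4 :: "'a hypergraph \<Rightarrow> bool" where
  "S3_4 H \<longleftrightarrow>
     card (edges H) = 4 \<and> (\<forall>e\<in>edges H. card e = 3) \<and> verts H = \<Union> (edges H) \<and>
     (\<exists>v. \<forall>e\<in>edges H. \<forall>f\<in>edges H. e \<noteq> f \<longrightarrow> e \<inter> f = {v})"

definition E3 :: "nat \<Rightarrow> nat \<Rightarrow> nat \<Rightarrow> 'a hypergraph \<Rightarrow> bool" where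
  "E3 i j k H \<longleftrightarrow>
     (\<exists>v H1 H2. attach 3 i v (Hypergraph {v} {}) H1 \<and> attach 3 j v H1 H2 \<and> attach 3 k v H2 H)"

definition E3_tilde_6 :: "'a hypergraph \<Rightarrow> bool" where
  "E3_tilde_6 = E3 2 2 2"

definition E3_tilde_7 :: "'a hypergraph \<Rightarrow> bool" where
  "E3_tilde_7 = E3 1 3 3"

definition E3_tilde_8 :: "'a hypergraph \<Rightarrow> bool" where
  "E3_tilde_8 = E3 1 2 5"

definition F3 :: "nat \<Rightarrow> nat \<Rightarrow> nat \<Rightarrow> 'a hypergraph \<Rightarrow> bool" where
  "F3 i j k H \<longleftrightarrow>
     (\<exists>a b c H1 H2. distinct [a, b, c] \<and>
        attach 3 i a (Hypergraph {a, b, c} {{a, b, c}}) H1 \<and>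
        attach 3 j b H1 H2 \<and> attach 3 k c H2 H)"

definition G3 :: "nat \<Rightarrow> nat \<Rightarrow> nat \<Rightarrow> nat \<Rightarrow> nat \<Rightarrow> 'a hypergraph \<Rightarrow> bool" where
  "G3 i j k l m H \<longleftrightarrow>
     (\<exists>es u1 u2 u3 u4 H1 H2 H3.
        hyper_path 3 es \<and> length es = k + 2 \<and>
        u1 \<noteq> u2 \<and> {u1, u2} = es ! 0 - es ! 1 \<and>
        u3 \<noteq> u4 \<and> {u3, u4} = es ! (k + 1) - es ! k \<and>
        attach 3 i u1 (path_hypergraph es) H1 \<and> attach 3 j u2 H1 H2 \<and>
        attach 3 l u3 H2 H3 \<and> attach 3 m u4 H3 H)"

definition B3_tilde :: "nat \<Rightarrow> 'a hypergraph \<Rightarrow> bool" where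
  "B3_tilde n = G3 1 2 (n - 8) 1 2"

text \<open>In the next two definitions the path \<open>e\<^sub>1, \<dots>, e\<^sub>n\<^sub>-\<^sub>2\<close> is a list indexed from 0, so that
  \<open>e\<^sub>i\<close> is \<open>es ! (i - 1)\<close>.\<close>

definition D3_tilde :: "nat \<Rightarrow> 'a hypergraph \<Rightarrow> bool" where
  "D3_tilde n H \<longleftrightarrow>
     (\<exists>es u v H1. hyper_path 3 es \<and> length es = n - 2 \<and>
        u \<in> es ! 0 \<inter> es ! 1 \<and> v \<in> es ! (n - 4) \<inter> es ! (n - 3) \<and>
        attach 3 1 u (path_hypergraph es) H1 \<and> attach 3 1 v H1 H)"

definition BD3_tilde :: "nat \<Rightarrow> 'a hypergraph \<Rightarrow> bool" where
  "BD3_tilde n H \<longleftrightarrow>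
     (\<exists>es u v H1. hyper_path 3 es \<and> length es = n - 2 \<and>
        u \<in> es ! 0 \<inter> es ! 1 \<and>
        v \<in> es ! (n - 5) \<and> (\<forall>j < n - 2. j \<noteq> n - 5 \<longrightarrow> v \<notin> es ! j) \<and>
        attach 3 1 u (path_hypergraph es) H1 \<and> attach 3 1 v H1 H)"


section \<open>The 4-uniform family\<close>

definition H4 :: "nat \<Rightarrow> nat \<Rightarrow> nat \<Rightarrow> nat \<Rightarrow> 'a hypergraph \<Rightarrow> bool" where
  "H4 i j k l H \<longleftrightarrow>
     (\<exists>a b c d H1 H2 H3. distinct [a, b, c, d] \<and>
        attach 4 i a (Hypergraph {a, b, c, d} {{a, b, c, d}}) H1 \<and>
        attach 4 j b H1 H2 \<and> attach 4 k c H2 H3 \<and> attach 4 l d H3 H)"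

end

theory Submission
  imports Defs "HOL-Analysis.Analysis"
begin

text \<open>A Perron vector \<open>x\<close> of \<open>H\<close> is positive and stationary, so
  \<open>B(v, e) = (\<Prod>u\<in>e. x u) / (4\<^bsup>1/r\<^esup> (x v)\<^bsup>r\<^esup>)\<close> labels the incidences of \<open>H\<close> such that the labels at
  each vertex add up to 1 and the labels in each edge multiply to \<open>1/4\<close>. These two local conditions
  already determine \<open>H\<close>. A vertex lying in a single edge has label 1 and may be deleted, which
  reverses extension and reduces everything to uniformity 3, or to 4 if some edge has four other
  vertices.

  Along a non-backtracking walk the labels do not increase, so on a closed walk they are all \<open>1/2\<close> and
  \<open>H\<close> is a cycle. Without cycles, the label of a branch is determined by the branch: it is
  \<open>k / (2 (k + 1)) < 1/2\<close> for a pendant path of length \<open>k\<close>, at least \<open>4/9\<close> for every other branch,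
  and one more plain edge maps \<open>p\<close> to \<open>1 / (4 (1 - p))\<close>. In the coordinate \<open>t\<close> with
  \<open>p = (1 - 1/t) / 2\<close> this is \<open>t \<mapsto> t + 1\<close>. The conditions at the branching vertices and edges then
  become Diophantine equations such as \<open>\<Sum>1/(k\<^sub>i + 1) = 1\<close> and \<open>\<Prod>(1 + 1/(k\<^sub>i + 1)) = 2\<close>.\<close>

section \<open>Normal labellings\<close>

text \<open>The edge product 1/4 is the maximum of \<open>p * (1 - p)\<close>, so 1/2 is a double
  fixed point of the transfer map along plain edges. A label 1/2 survives any number of them, which
  gives the four infinite families; a label off 1/2 drifts by one unit of \<open>t\<close> per edge,
  which leaves finitely many exceptions. The obstacle is that pendant labels accumulate at 1/2, so
  positivity alone bounds no length. The bounds come from gaps: a label is at least 1/4, hence a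
  nonleaf label is at most 3/4, and the next possible value below 3/4 is 2/3. From this, an edge has
  at most four nonleaf vertices because (3/4)^5 < 1/4, and 4/9 = (1/4) / (3/4)^2 is the least label
  at an edge with two further nonleaf vertices. In the coordinate \<open>t\<close>, pendant branches
  are positive, 1/2 lies at infinity and labels above 1/2 are negative; the value
  \<open>t = -9\<close> (label 5/9) behind an edge carrying two pendant edges is the source of the 8
  and 9 in the equation for the G family. A hypertree has no root here: acyclicity is
  well-foundedness of a relation on flags, and induction over that relation replaces induction on
  the size of a branch.\<close>

text \<open>Connectedness is stated for sets of edges closed under intersection rather than by
  walks. A proof that some subfamily is all of \<open>E\<close> is then a local check at each
  vertex, and the property passes easily to the hypergraph with leaf vertices deleted.\<close>

locale normal_labelling =
  fixes r :: nat and V :: "'a set" and E :: "'a set set" and B :: "'a \<Rightarrow> 'a set \<Rightarrow> real"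
  assumes r_ge: "3 \<le> r"
    and finite_V: "finite V"
    and edge_sub: "e \<in> E \<Longrightarrow> e \<subseteq> V"
    and card_edge: "e \<in> E \<Longrightarrow> card e = r"
    and E_ne: "E \<noteq> {}"
    and conn: "\<lbrakk>S \<subseteq> E; S \<noteq> {}; \<And>e f. e \<in> S \<Longrightarrow> f \<in> E \<Longrightarrow> e \<inter> f \<noteq> {} \<Longrightarrow> f \<in> S\<rbrakk> \<Longrightarrow> S = E"
    and B_pos: "e \<in> E \<Longrightarrow> v \<in> e \<Longrightarrow> 0 < B v e"
    and B_sum: "v \<in> V \<Longrightarrow> (\<Sum>e\<in>{e \<in> E. v \<in> e}. B v e) = 1"
    and B_prod: "e \<in> E \<Longrightarrow> (\<Prod>v\<in>e. B v e) = 1/4"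

section \<open>The labelling defined by a Perron vector\<close>

text \<open>\<open>spectral_radius\<close> is a \<open>GREATEST\<close>, so it is meaningful only
  once a maximum is known to exist. The quotient is homogeneous of degree 0, hence its supremum is
  attained on the compact set of nonnegative vectors whose r-th powers sum to 1.\<close>

lemma spectral_radius_attained:
  fixes H :: "'a hypergraph"
  assumes fin: "finite (verts H)" and ne: "verts H \<noteq> {}"
    and unif: "\<And>e. e \<in> edges H \<Longrightarrow> e \<subseteq> verts H \<and> card e = r" and r: "r > 0"
  obtains x :: "'a \<Rightarrow> real" where "\<And>v. v \<in> verts H \<Longrightarrow> x v \<ge> 0" "\<exists>v\<in>verts H. x v \<noteq> 0"
    "fact r * (\<Sum>e\<in>edges H. \<Prod>v\<in>e. x v) = spectral_radius r H * (\<Sum>v\<in>verts H. x v ^ r)"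
    "\<And>y. (\<And>v. v \<in> verts H \<Longrightarrow> y v \<ge> 0) \<Longrightarrow>
       fact r * (\<Sum>e\<in>edges H. \<Prod>v\<in>e. y v) \<le> spectral_radius r H * (\<Sum>v\<in>verts H. y v ^ r)"
proof -
  let ?V = "verts H" and ?E = "edges H"
  define F where "F x = fact r * (\<Sum>e\<in>?E. \<Prod>v\<in>e. x v)" for x :: "'a \<Rightarrow> real"
  define N where "N x = (\<Sum>v\<in>?V. x v ^ r)" for x :: "'a \<Rightarrow> real"
  \<comment> \<open>Vectors are functions on the whole type; pinning the coordinates outside
    \<open>verts H\<close> to 0 makes the cube a product of compact sets.\<close>
  define K where "K = PiE UNIV (\<lambda>v. if v \<in> ?V then {0..1::real} else {0}) \<inter> {x. N x = 1}"
  have contN: "continuous_on UNIV N" and contF: "continuous_on UNIV F"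
    unfolding N_def F_def by (intro continuous_intros continuous_on_product_coordinates)+
  have "compact (PiE UNIV (\<lambda>v. if v \<in> ?V then {0..1::real} else {0}))"
    using compactin_PiE[of "\<lambda>_. euclidean" UNIV "\<lambda>v. if v \<in> ?V then {0..1::real} else {0}"]
    by (simp add: euclidean_product_topology)
  moreover have "closed {x. N x = 1}"
    using contN by (simp add: closed_Collect_eq)
  ultimately have cK: "compact K" unfolding K_def by (rule compact_Int_closed)
  have NF: "F y \<le> t * N y" if y: "\<And>v. v \<in> ?V \<Longrightarrow> y v \<ge> 0" and t: "\<And>x. x \<in> K \<Longrightarrow> F x \<le> t" for y t
  proof (cases "\<exists>v\<in>?V. y v \<noteq> 0")
    case False
    have "(\<Prod>v\<in>e. y v) = 0" if e: "e \<in> ?E" for e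
    proof -
      obtain v where "v \<in> e" using unif[OF e] r by (metis card.empty ex_in_conv less_irrefl)
      then show ?thesis using False unif[OF e] finite_subset[OF _ fin] by (intro prod_zero) auto
    qed
    then show ?thesis using False r by (simp add: F_def N_def zero_power)
  next
    case True
    then obtain w where w: "w \<in> ?V" "y w > 0" using y by (metis less_eq_real_def)
    have Npos: "N y > 0" unfolding N_def
      by (rule sum_pos2[OF fin w(1)]) (simp_all add: w y)
    define s where "s = root r (N y)"
    have s: "s > 0" "s ^ r = N y" using Npos r by (auto simp: s_def)
    define x where "x v = (if v \<in> ?V then y v / s else 0)" for v
    have xr: "x v ^ r = y v ^ r / N y" if "v \<in> ?V" for v
      using that s by (simp add: x_def power_divide)
    have "N x = (\<Sum>v\<in>?V. y v ^ r / N y)" unfolding N_def[of x] using xr by (rule sum.cong[OF refl])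
    also have "\<dots> = N y / N y" unfolding N_def[of y] by (rule sum_divide_distrib[symmetric])
    finally have "N x = N y / N y" .
    then have N1: "N x = 1" using Npos by simp
    have "x v \<le> 1" if "v \<in> ?V" for v
    proof -
      have "x v ^ r \<le> N x" unfolding N_def
        by (rule member_le_sum[OF that]) (use fin y s in \<open>simp_all add: x_def\<close>)
      then have "x v ^ r \<le> 1 ^ r" using N1 by simp
      then show ?thesis using r by (meson not_less power_strict_mono zero_le_one)
    qed
    then have "x \<in> K" using y s N1 unfolding K_def by (auto simp: x_def)
    then have "F x \<le> t" using t by blast
    moreover have "F x = F y / N y"
    proof -
      have "(\<Prod>v\<in>e. x v) = (\<Prod>v\<in>e. y v) / N y" if "e \<in> ?E" for e
      proof -
        have "(\<Prod>v\<in>e. x v) = (\<Prod>v\<in>e. y v / s)" using unif[OF that] by (intro prod.cong) (auto simp: x_def)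
        also have "\<dots> = (\<Prod>v\<in>e. y v) / s ^ r" using unif[OF that] by (simp add: prod_dividef)
        finally show ?thesis using s by simp
      qed
      then show ?thesis unfolding F_def by (simp add: sum_divide_distrib[symmetric])
    qed
    ultimately show ?thesis using Npos by (simp add: field_simps)
  qed
  obtain w where w: "w \<in> ?V" using ne by auto
  have "(\<lambda>v. if v = w then 1 else 0) \<in> K"
  proof -
    have "N (\<lambda>v. if v = w then 1 else 0) = (\<Sum>v\<in>?V. if v = w then 1 else 0)"
      unfolding N_def using r by (intro sum.cong) (auto simp: zero_power)
    also have "\<dots> = 1" using w fin by simp
    finally show ?thesis using w by (auto simp: K_def)
  qed
  then have "K \<noteq> {}" by auto
  from continuous_attains_sup[OF cK this continuous_on_subset[OF contF]]
  obtain x where x: "x \<in> K" "\<And>y. y \<in> K \<Longrightarrow> F y \<le> F x" by auto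
  have x0: "\<And>v. v \<in> ?V \<Longrightarrow> x v \<ge> 0" and xN: "N x = 1" using x(1) by (auto simp: K_def PiE_iff split: if_splits)
  have xne: "\<exists>v\<in>?V. x v \<noteq> 0"
  proof (rule ccontr)
    assume "\<not> ?thesis"
    then have "N x = 0" using r by (simp add: N_def)
    with xN show False by simp
  qed
  have bound: "F y \<le> F x * N y" if "\<And>v. v \<in> ?V \<Longrightarrow> y v \<ge> 0" for y
    using NF[OF that x(2)] by simp
  have "spectral_radius r H = F x" unfolding spectral_radius_def
  proof (rule Greatest_equality, goal_cases)
    case 1
    then show ?case using x0 xne xN by (intro exI[of _ x]) (auto simp: F_def N_def)
  next
    case (2 t)
    then obtain y where y: "\<forall>v\<in>?V. 0 \<le> y v" "\<exists>v\<in>?V. y v \<noteq> 0" "t = F y / N y"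
      unfolding F_def N_def by blast
    from y obtain u where u: "u \<in> ?V" "y u > 0" by force
    have "N y > 0" unfolding N_def by (rule sum_pos2[OF fin u(1)]) (use u y in auto)
    then show ?case using bound[of y] y by (simp add: pos_divide_le_eq)
  qed
  then show thesis using that[of x] x0 xne xN bound unfolding F_def N_def by simp
qed

lemma connected_hypergraph_closed:
  assumes c: "connected_hypergraph H" and u: "u \<in> verts H" "P u" and v: "v \<in> verts H"
    and step: "\<And>e a b. e \<in> edges H \<Longrightarrow> a \<in> e \<Longrightarrow> b \<in> e \<Longrightarrow> P a \<Longrightarrow> P b"
  shows "P v"
proof -
  obtain vs es where w: "hyper_walk H vs es" "hd vs = u" "last vs = v"
    using c u v unfolding connected_hypergraph_def by blast
  then have l: "length vs = Suc (length es)" by (simp add: hyper_walk_def)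
  have "i \<le> length es \<Longrightarrow> P (vs ! i)" for i
  proof (induction i)
    case 0
    then show ?case using w l u by (metis hd_conv_nth length_0_conv nat.distinct(1))
  next
    case (Suc i)
    then have "vs ! i \<in> es ! i" "vs ! Suc i \<in> es ! i" "es ! i \<in> edges H"
      using w by (auto simp: hyper_walk_def)
    then show ?case using step[of "es ! i" "vs ! i" "vs ! Suc i"] Suc by simp
  qed
  from this[of "length es"] show ?thesis using w l
    by (metis diff_Suc_1 last_conv_nth le_refl length_0_conv nat.distinct(1))
qed

text \<open>If \<open>x\<close> vanished somewhere, connectedness would give an edge
  \<open>e\<close> with both a zero and a nonzero vertex. Raising all zeros to a small
  \<open>t\<close> then gains at least order \<open>t ^ (r - 1)\<close> in the numerator but costs
  only order \<open>t ^ r\<close> in the denominator.\<close>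

lemma maximiser_pos:
  fixes H :: "'a hypergraph" and x :: "'a \<Rightarrow> real"
  assumes fin: "finite (verts H)" and conn: "connected_hypergraph H"
    and unif: "\<And>e. e \<in> edges H \<Longrightarrow> e \<subseteq> verts H \<and> card e = r"
    and x0: "\<And>v. v \<in> verts H \<Longrightarrow> x v \<ge> 0" and xne: "\<exists>v\<in>verts H. x v \<noteq> 0"
    and eq: "fact r * (\<Sum>e\<in>edges H. \<Prod>v\<in>e. x v) = \<rho> * (\<Sum>v\<in>verts H. x v ^ r)"
    and le: "\<And>y. (\<And>v. v \<in> verts H \<Longrightarrow> y v \<ge> 0) \<Longrightarrow>
       fact r * (\<Sum>e\<in>edges H. \<Prod>v\<in>e. y v) \<le> \<rho> * (\<Sum>v\<in>verts H. y v ^ r)"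
    and v: "v \<in> verts H"
  shows "x v > 0"
proof (rule ccontr)
  let ?V = "verts H" and ?E = "edges H"
  assume "\<not> x v > 0"
  then have xv: "x v = 0" using x0[OF v] by simp
  obtain u where u: "u \<in> ?V" "x u \<noteq> 0" using xne by auto
  have "\<exists>e a b. e \<in> ?E \<and> a \<in> e \<and> b \<in> e \<and> x a \<noteq> 0 \<and> x b = 0"
  proof (rule ccontr)
    assume "\<not> ?thesis"
    then have "x v \<noteq> 0"
      using connected_hypergraph_closed[of H u "\<lambda>a. x a \<noteq> 0" v] conn u v by blast
    with xv show False by simp
  qed
  then obtain e a b where e: "e \<in> ?E" "a \<in> e" "b \<in> e" "x a \<noteq> 0" "x b = 0" by blast
  have fe: "finite f" if "f \<in> ?E" for f using unif[OF that] fin finite_subset by auto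
  have finE: "finite ?E" using unif fin by (meson Pow_iff finite_Pow_iff rev_finite_subset subsetI)
  define Z where "Z = {w\<in>?V. x w = 0}"
  define c where "c = (\<Prod>w\<in>e - Z. x w)"
  have cpos: "c > 0" unfolding c_def
    by (rule prod_pos) (use unif[OF e(1)] x0 in \<open>force simp: Z_def\<close>)
  have r: "card (e \<inter> Z) \<le> r - 1" "r > 0"
  proof -
    have "e \<inter> Z \<subseteq> e - {a}" using e by (auto simp: Z_def)
    then have "card (e \<inter> Z) \<le> card (e - {a})" using fe[OF e(1)] by (intro card_mono) auto
    then show "card (e \<inter> Z) \<le> r - 1" using e fe unif by simp
    show "r > 0" using e fe unif by (metis card_gt_0_iff empty_iff)
  qed
  \<comment> \<open>The vertex \<open>a\<close> of \<open>e\<close> is not a zero, so at most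
    \<open>r - 1\<close> factors of \<open>e\<close> are raised; this is what leaves a spare factor
    \<open>t\<close> on the cost side.\<close>
  have key: "fact r * c \<le> \<rho> * card Z * t" if t: "0 < t" "t \<le> 1" for t
  proof -
    define y where "y w = (if w \<in> Z then t else x w)" for w
    have y0: "y w \<ge> 0" if "w \<in> ?V" for w using x0 that t by (simp add: y_def)
    have yx: "x w \<le> y w" if "w \<in> ?V" for w using t by (simp add: y_def Z_def)
    have ye: "(\<Prod>w\<in>e. y w) = t ^ card (e \<inter> Z) * c"
    proof -
      have "(\<Prod>w\<in>e. y w) = (\<Prod>w\<in>e \<inter> Z. y w) * (\<Prod>w\<in>e - Z. y w)"
        using prod.Int_Diff[OF fe[OF e(1)]] .
      then show ?thesis by (simp add: y_def c_def)
    qed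
    have "(\<Prod>w\<in>e. x w) = 0" using e fe by (intro prod_zero) auto
    then have "(\<Sum>f\<in>?E. \<Prod>w\<in>f. x w) = (\<Sum>f\<in>?E - {e}. \<Prod>w\<in>f. x w)"
      using finE e by (simp add: sum.remove)
    also have "\<dots> \<le> (\<Sum>f\<in>?E - {e}. \<Prod>w\<in>f. y w)"
      by (intro sum_mono prod_mono) (use unif x0 yx in blast)
    also have "\<dots> = (\<Sum>f\<in>?E. \<Prod>w\<in>f. y w) - t ^ card (e \<inter> Z) * c"
      using finE e ye by (simp add: sum.remove)
    finally have "fact r * (t ^ card (e \<inter> Z) * c) + fact r * (\<Sum>f\<in>?E. \<Prod>w\<in>f. x w)
       \<le> fact r * (\<Sum>f\<in>?E. \<Prod>w\<in>f. y w)" 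
      by (metis add.commute distrib_left fact_ge_zero le_diff_eq mult_left_mono)
    also have "\<dots> \<le> \<rho> * (\<Sum>w\<in>?V. y w ^ r)" by (rule le[OF y0])
    also have "(\<Sum>w\<in>?V. y w ^ r) = (\<Sum>w\<in>?V. x w ^ r) + card Z * t ^ r"
    proof -
      have "(\<Sum>w\<in>?V. y w ^ r) = (\<Sum>w\<in>?V. x w ^ r + (if w \<in> Z then t ^ r else 0))"
        by (rule sum.cong) (use r in \<open>auto simp: y_def Z_def\<close>)
      also have "\<dots> = (\<Sum>w\<in>?V. x w ^ r) + (\<Sum>w\<in>?V \<inter> Z. t ^ r)"
        by (simp only: sum.distrib sum.inter_restrict[OF fin])
      also have "?V \<inter> Z = Z" by (auto simp: Z_def)
      finally show ?thesis by simp
    qed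
    finally have "fact r * (t ^ card (e \<inter> Z) * c) \<le> \<rho> * card Z * t ^ r"
      using eq by (simp add: algebra_simps)
    moreover have "t ^ (r - 1) \<le> t ^ card (e \<inter> Z)" using r t by (intro power_decreasing) auto
    then have "fact r * (t ^ (r - 1) * c) \<le> fact r * (t ^ card (e \<inter> Z) * c)"
      using cpos by simp
    ultimately have "fact r * (t ^ (r - 1) * c) \<le> \<rho> * card Z * t ^ r" by linarith
    also have "t ^ r = t ^ (r - 1) * t" using r by (metis Suc_diff_1 power_Suc2)
    finally have "t ^ (r - 1) * (fact r * c) \<le> t ^ (r - 1) * (\<rho> * card Z * t)"
      by (simp add: algebra_simps)
    then show ?thesis using t by (metis mult_le_cancel_left_pos zero_less_power)
  qed
  define q where "q = \<rho> * card Z"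
  have fc: "fact r * c > (0::real)" using cpos by simp
  have q: "q \<ge> fact r * c" using key[of 1] by (simp add: q_def)
  \<comment> \<open>At this \<open>t\<close> the cost is half the gain. It is at most 1 because
    \<open>key\<close> at 1 gives \<open>q \<ge> fact r * c\<close>.\<close>
  have "fact r * c \<le> q * (fact r * c / (2 * q))"
    unfolding q_def
    by (rule key) (use fc q in \<open>auto simp: q_def[symmetric] field_simps\<close>)
  then show False using fc q by (simp add: field_simps)
qed

text \<open>Vary the single coordinate at \<open>v\<close>. Each edge product is affine in it, and
  the defect \<open>\<phi>\<close> is nonnegative for \<open>s \<ge> 0\<close> and zero at the
  interior point \<open>x v\<close>, so its derivative vanishes there.\<close>

lemma maximiser_stationary:
  fixes H :: "'a hypergraph" and x :: "'a \<Rightarrow> real"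
  assumes fin: "finite (verts H)"
    and unif: "\<And>e. e \<in> edges H \<Longrightarrow> e \<subseteq> verts H \<and> card e = r" and r: "r > 0"
    and xpos: "\<And>v. v \<in> verts H \<Longrightarrow> x v > 0"
    and eq: "fact r * (\<Sum>e\<in>edges H. \<Prod>v\<in>e. x v) = \<rho> * (\<Sum>v\<in>verts H. x v ^ r)"
    and le: "\<And>y. (\<And>v. v \<in> verts H \<Longrightarrow> y v \<ge> 0) \<Longrightarrow>
       fact r * (\<Sum>e\<in>edges H. \<Prod>v\<in>e. y v) \<le> \<rho> * (\<Sum>v\<in>verts H. y v ^ r)"
    and v: "v \<in> verts H"
  shows "\<rho> * x v ^ r = fact (r - 1) * (\<Sum>e\<in>{e\<in>edges H. v \<in> e}. \<Prod>w\<in>e. x w)"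
proof -
  let ?V = "verts H" and ?E = "edges H"
  have fe: "finite f" if "f \<in> ?E" for f using unif[OF that] fin finite_subset by auto
  have finE: "finite ?E" using unif fin by (meson Pow_iff finite_Pow_iff rev_finite_subset subsetI)
  define C where "C = (\<Sum>e\<in>{e\<in>?E. v \<in> e}. \<Prod>w\<in>e - {v}. x w)"
  define D where "D = (\<Sum>e\<in>{e\<in>?E. v \<notin> e}. \<Prod>w\<in>e. x w)"
  define A where "A = (\<Sum>w\<in>?V - {v}. x w ^ r)"
  define \<phi> where "\<phi> s = \<rho> * (A + s ^ r) - fact r * (D + s * C)" for s
  have split: "(\<Sum>e\<in>?E. \<Prod>w\<in>e. (x(v := s)) w) = D + s * C" for s
  proof -
    have "(\<Sum>e\<in>?E. \<Prod>w\<in>e. (x(v := s)) w) =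
       (\<Sum>e\<in>{e\<in>?E. v \<notin> e}. \<Prod>w\<in>e. (x(v := s)) w) + (\<Sum>e\<in>{e\<in>?E. v \<in> e}. \<Prod>w\<in>e. (x(v := s)) w)"
      using finE by (subst sum.union_disjoint[symmetric]) (auto intro!: sum.cong)
    also have "(\<Sum>e\<in>{e\<in>?E. v \<notin> e}. \<Prod>w\<in>e. (x(v := s)) w) = D"
      unfolding D_def by (intro sum.cong prod.cong) auto
    also have "(\<Sum>e\<in>{e\<in>?E. v \<in> e}. \<Prod>w\<in>e. (x(v := s)) w) = (\<Sum>e\<in>{e\<in>?E. v \<in> e}. s * (\<Prod>w\<in>e - {v}. x w))"
    proof (rule sum.cong[OF refl])
      fix e assume e: "e \<in> {e\<in>?E. v \<in> e}"
      then have "(\<Prod>w\<in>e. (x(v := s)) w) = s * (\<Prod>w\<in>e - {v}. (x(v := s)) w)"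
        using fe by (subst prod.remove[of e v]) auto
      then show "(\<Prod>w\<in>e. (x(v := s)) w) = s * (\<Prod>w\<in>e - {v}. x w)" by simp
    qed
    finally show ?thesis by (simp add: C_def sum_distrib_left)
  qed
  have splitV: "(\<Sum>w\<in>?V. (x(v := s)) w ^ r) = A + s ^ r" for s
    using fin v by (subst sum.remove[of _ v]) (auto simp: A_def)
  have pos: "\<phi> s \<ge> 0" if "s \<ge> 0" for s
    using le[of "x(v := s)"] that xpos less_imp_le[OF xpos] unfolding split splitV \<phi>_def by simp
  have zero: "\<phi> (x v) = 0"
    using eq split[of "x v"] splitV[of "x v"] by (simp add: \<phi>_def)
  have "(\<phi> has_real_derivative (\<rho> * (real r * x v ^ (r - 1)) - fact r * C)) (at (x v))"
    unfolding \<phi>_def by (auto intro!: derivative_eq_intros)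
  \<comment> \<open>The radius \<open>x v\<close> of the neighbourhood keeps \<open>s\<close>
    nonnegative, which is all that the maximality of \<open>\<rho>\<close> covers.\<close>
  then have "\<rho> * (real r * x v ^ (r - 1)) - fact r * C = 0"
    by (rule DERIV_local_min[of _ _ _ "x v"]) (use xpos[OF v] zero pos in auto)
  then have "real r * (\<rho> * x v ^ (r - 1)) = real r * (fact (r - 1) * C)"
    using r by (simp add: fact_reduce algebra_simps)
  then have "\<rho> * x v ^ (r - 1) * x v = fact (r - 1) * (x v * C)" using r by simp
  moreover have "x v ^ (r - 1) * x v = x v ^ r" using r by (metis Suc_diff_1 power_Suc2)
  moreover have "x v * C = (\<Sum>e\<in>{e\<in>?E. v \<in> e}. \<Prod>w\<in>e. x w)"
    unfolding C_def sum_distrib_left using fe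
    by (intro sum.cong) (auto simp: prod.remove)
  ultimately show ?thesis by (metis mult.assoc)
qed

lemma normal_labelling_exists:
  fixes H :: "'a hypergraph"
  assumes r: "3 \<le> r" and unif: "uniform_hypergraph r H" and conn: "connected_hypergraph H"
    and rho: "spectral_radius r H = fact (r - 1) * root r 4"
  shows "\<exists>B. normal_labelling r (verts H) (edges H) B"
proof -
  let ?V = "verts H" and ?E = "edges H"
  have fin: "finite ?V" and unif': "\<And>e. e \<in> ?E \<Longrightarrow> e \<subseteq> ?V \<and> card e = r"
    using unif by (auto simp: uniform_hypergraph_def)
  have ne: "?V \<noteq> {}" using conn by (simp add: connected_hypergraph_def)
  have r0: "r > 0" using r by simp
  obtain x where x: "\<And>v. v \<in> verts H \<Longrightarrow> x v \<ge> 0" "\<exists>v\<in>verts H. x v \<noteq> 0"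
    "fact r * (\<Sum>e\<in>edges H. \<Prod>v\<in>e. x v) = spectral_radius r H * (\<Sum>v\<in>verts H. x v ^ r)"
    "\<And>y. (\<And>v. v \<in> verts H \<Longrightarrow> y v \<ge> 0) \<Longrightarrow>
       fact r * (\<Sum>e\<in>edges H. \<Prod>v\<in>e. y v) \<le> spectral_radius r H * (\<Sum>v\<in>verts H. y v ^ r)"
    using spectral_radius_attained[OF fin ne unif' r0] by blast
  have xpos: "x v > 0" if "v \<in> ?V" for v
    using maximiser_pos[OF fin conn unif' x(1,2,3,4) that] .
  have stat: "root r 4 * x v ^ r = (\<Sum>e\<in>{e\<in>?E. v \<in> e}. \<Prod>w\<in>e. x w)" if "v \<in> ?V" for v
    using maximiser_stationary[OF fin unif' r0 xpos x(3,4) that] by (simp add: rho)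
  have root: "root r 4 > 0" "root r 4 ^ r = (4::real)" using r0 by auto
  define B where "B v e = (\<Prod>w\<in>e. x w) / (root r 4 * x v ^ r)" for v e
  have "normal_labelling r ?V ?E B"
  proof
    show "3 \<le> r" "finite ?V" by fact+
    show "e \<subseteq> ?V" "card e = r" if "e \<in> ?E" for e using unif'[OF that] by auto
    show "?E \<noteq> {}"
    proof
      assume "?E = {}"
      obtain v where "v \<in> ?V" using ne by auto
      then show False using stat[of v] xpos[of v] root \<open>?E = {}\<close> by simp
    qed
    show "0 < B v e" if "e \<in> ?E" "v \<in> e" for e v
      unfolding B_def using that unif'[OF that(1)] root xpos
      by (intro divide_pos_pos mult_pos_pos prod_pos zero_less_power) auto
    show "(\<Sum>e\<in>{e \<in> ?E. v \<in> e}. B v e) = 1" if "v \<in> ?V" for v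
      using stat[OF that] root xpos[OF that]
      by (simp add: B_def sum_divide_distrib[symmetric] flip: stat[OF that])
    \<comment> \<open>Each of the \<open>r\<close> factors contributes one \<open>root r 4\<close>
      to the denominator, together 4, and the powers \<open>x v ^ r\<close> cancel against the
      numerator.\<close>
    show "(\<Prod>v\<in>e. B v e) = 1/4" if "e \<in> ?E" for e
    proof -
      have p: "(\<Prod>w\<in>e. x w) > 0" using unif'[OF that] xpos by (intro prod_pos) auto
      have "(\<Prod>v\<in>e. B v e) = (\<Prod>w\<in>e. x w) ^ r / (\<Prod>v\<in>e. root r 4 * x v ^ r)"
        using unif'[OF that] by (simp add: B_def prod_dividef)
      also have "(\<Prod>v\<in>e. root r 4 * x v ^ r) = 4 * (\<Prod>w\<in>e. x w) ^ r"
        using unif'[OF that] root by (simp add: prod.distrib prod_power_distrib)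
      finally show ?thesis using p by simp
    qed
    show "S = ?E" if S: "S \<subseteq> ?E" "S \<noteq> {}" "\<And>e f. e \<in> S \<Longrightarrow> f \<in> ?E \<Longrightarrow> e \<inter> f \<noteq> {} \<Longrightarrow> f \<in> S" for S
    proof (rule ccontr)
      assume "S \<noteq> ?E"
      then obtain f where f: "f \<in> ?E" "f \<notin> S" using S by auto
      obtain e where e: "e \<in> S" using S by auto
      obtain v where v: "v \<in> f" using unif'[OF f(1)] r0 by (metis card.empty ex_in_conv less_irrefl)
      obtain u where u: "u \<in> e" using unif'[of e] e S r0 by (metis card.empty ex_in_conv less_irrefl subsetD)
      have "v \<in> \<Union>S"
        by (rule connected_hypergraph_closed[OF conn, of u "\<lambda>a. a \<in> \<Union>S"])
          (use u v e f S unif' in blast)+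
      then show False using S v f by (metis UnionE disjoint_iff)
    qed
  qed
  then show ?thesis by blast
qed

section \<open>Numerical consequences of the two local conditions\<close>

context normal_labelling
begin

definition inc :: "'a \<Rightarrow> 'a set set" where
  "inc v = {e \<in> E. v \<in> e}"

definition nonleaf :: "'a set \<Rightarrow> 'a set" where
  "nonleaf e = {v \<in> e. inc v \<noteq> {e}}"

lemma finite_edge: "e \<in> E \<Longrightarrow> finite e"
  using edge_sub finite_V by (blast intro: finite_subset)

lemma finite_E: "finite E"
  using edge_sub finite_V by (meson Pow_iff finite_Pow_iff rev_finite_subset subsetI)

lemma finite_inc: "finite (inc v)"
  using finite_E by (simp add: inc_def)

lemma in_inc [simp]: "e \<in> inc v \<longleftrightarrow> e \<in> E \<and> v \<in> e"
  by (simp add: inc_def)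

lemma inc_other: "\<lbrakk>e \<in> E; v \<in> e; inc v \<noteq> {e}\<rbrakk> \<Longrightarrow> \<exists>f\<in>inc v. f \<noteq> e"
  unfolding inc_def by blast

lemma B_sum_inc: "e \<in> E \<Longrightarrow> v \<in> e \<Longrightarrow> (\<Sum>f\<in>inc v. B v f) = 1"
  using B_sum[of v] edge_sub by (auto simp: inc_def)

lemma V_eq: "V = \<Union>E"
proof
  show "V \<subseteq> \<Union>E"
  proof
    fix v assume "v \<in> V"
    then have "{e \<in> E. v \<in> e} \<noteq> {}" using B_sum by (metis sum.empty zero_neq_one)
    then show "v \<in> \<Union>E" by blast
  qed
qed (use edge_sub in blast)

lemma B_sum_subset:
  assumes "e \<in> E" "v \<in> e" "A \<subseteq> inc v"
  shows "(\<Sum>f\<in>A. B v f) \<le> 1"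
proof -
  have "(\<Sum>f\<in>A. B v f) \<le> (\<Sum>f\<in>inc v. B v f)"
    by (rule sum_mono2) (use assms finite_inc less_imp_le[OF B_pos] in auto)
  then show ?thesis using B_sum_inc assms by simp
qed

lemma B_le_1: "e \<in> E \<Longrightarrow> v \<in> e \<Longrightarrow> B v e \<le> 1"
  using B_sum_subset[of e v "{e}"] by auto

lemma B_eq_1: assumes "e \<in> E" "v \<in> e" shows "B v e = 1 \<longleftrightarrow> inc v = {e}"
proof
  assume "inc v = {e}"
  then show "B v e = 1" using B_sum_inc[OF assms] by simp
next
  assume 1: "B v e = 1"
  show "inc v = {e}"
  proof (rule ccontr)
    assume "inc v \<noteq> {e}"
    then obtain f where f: "f \<in> inc v" "f \<noteq> e" using inc_other assms by blast
    then have "B v e + B v f \<le> 1" using B_sum_subset[of e v "{e, f}"] assms by auto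
    then show False using 1 B_pos[of f v] f by simp
  qed
qed

lemma B_prod_subset:
  assumes "e \<in> E" "A \<subseteq> e"
  shows "(\<Prod>v\<in>A. B v e) \<ge> 1/4"
proof -
  have "(\<Prod>v\<in>e. B v e) = (\<Prod>v\<in>A. B v e) * (\<Prod>v\<in>e - A. B v e)"
    using assms finite_edge by (metis mult.commute prod.subset_diff)
  also have "\<dots> \<le> (\<Prod>v\<in>A. B v e) * 1"
    using assms less_imp_le[OF B_pos] B_le_1
    by (intro mult_left_mono prod_le_1 prod_nonneg) auto
  finally show ?thesis using B_prod assms by simp
qed

lemma B_prod_nonleaf:
  assumes "e \<in> E" "nonleaf e \<subseteq> A" "A \<subseteq> e"
  shows "(\<Prod>v\<in>A. B v e) = 1/4"
proof -
  have "(\<Prod>v\<in>e. B v e) = (\<Prod>v\<in>A. B v e) * (\<Prod>v\<in>e - A. B v e)"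
    using assms finite_edge by (metis mult.commute prod.subset_diff)
  also have "(\<Prod>v\<in>e - A. B v e) = 1"
    using assms B_eq_1 by (intro prod.neutral) (auto simp: nonleaf_def)
  finally show ?thesis using B_prod assms by simp
qed

lemma B_ge: "e \<in> E \<Longrightarrow> v \<in> e \<Longrightarrow> B v e \<ge> 1/4"
  using B_prod_subset[of e "{v}"] by simp

lemma B_prod2: "\<lbrakk>e \<in> E; a \<in> e; b \<in> e; a \<noteq> b\<rbrakk> \<Longrightarrow> B a e * B b e \<ge> 1/4"
  using B_prod_subset[of e "{a, b}"] by simp

lemma B_prod3: "\<lbrakk>e \<in> E; a \<in> e; b \<in> e; c \<in> e; distinct [a, b, c]\<rbrakk> \<Longrightarrow> B a e * (B b e * B c e) \<ge> 1/4"
  using B_prod_subset[of e "{a, b, c}"] by simp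

text \<open>A second edge at \<open>v\<close> takes at least 1/4 of the sum by
  \<open>B_ge\<close>.\<close>

lemma B_le_34: assumes "e \<in> E" "v \<in> nonleaf e" shows "B v e \<le> 3/4"
proof -
  obtain f where f: "f \<in> inc v" "f \<noteq> e" using inc_other assms unfolding nonleaf_def by blast
  then have "B v e + B v f \<le> 1" using B_sum_subset[of e v "{e, f}"] assms by (auto simp: nonleaf_def)
  then show ?thesis using B_ge[of f v] f by simp
qed

text \<open>Five nonleaf vertices would push the product down to (3/4)^5 = 243/1024, just below 1/4.
  This is why uniformity 4 is the largest that has to be examined.\<close>

lemma card_nonleaf_le: assumes "e \<in> E" shows "card (nonleaf e) \<le> 4"
proof (rule ccontr)
  assume "\<not> ?thesis"
  then have "card (nonleaf e) \<ge> 5" by simp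
  have "1/4 \<le> (\<Prod>v\<in>nonleaf e. B v e)"
    using assms by (intro B_prod_subset) (auto simp: nonleaf_def)
  also have "\<dots> \<le> (\<Prod>v\<in>nonleaf e. 3/4)"
    using assms B_le_34 less_imp_le[OF B_pos] by (intro prod_mono) (auto simp: nonleaf_def)
  also have "\<dots> = (3/4) ^ card (nonleaf e)" by simp
  also have "\<dots> \<le> (3/4) ^ 5" using \<open>card (nonleaf e) \<ge> 5\<close> by (intro power_decreasing) auto
  finally show False by (simp add: eval_nat_numeral)
qed

text \<open>At a common vertex the two labels sum to at most 1, so their product is at most 1/4,
  whereas the products over the common vertices multiply to at least 1/16. This makes deleting one
  leaf per edge injective on edges.\<close>

lemma card_Int_le_2: assumes "e \<in> E" "f \<in> E" "e \<noteq> f" shows "card (e \<inter> f) \<le> 2"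
proof (rule ccontr)
  assume "\<not> ?thesis"
  then have "card (e \<inter> f) \<ge> 3" by simp
  have "1/16 \<le> (\<Prod>v\<in>e \<inter> f. B v e) * (\<Prod>v\<in>e \<inter> f. B v f)"
    using mult_mono[OF B_prod_subset[of e "e \<inter> f"] B_prod_subset[of f "e \<inter> f"]] assms B_pos
    by (auto intro: prod_nonneg less_imp_le)
  also have "\<dots> = (\<Prod>v\<in>e \<inter> f. B v e * B v f)" by (simp add: prod.distrib)
  also have "\<dots> \<le> (\<Prod>v\<in>e \<inter> f. 1/4)"
  proof (rule prod_mono, intro conjI)
    fix v assume v: "v \<in> e \<inter> f"
    then have "B v e + B v f \<le> 1" using B_sum_subset[of e v "{e, f}"] assms by auto
    moreover have "0 < B v e" "0 < B v f" using B_pos v assms by auto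
    moreover have "0 \<le> (B v e - B v f)\<^sup>2" by simp
    moreover from calculation have "(B v e + B v f)\<^sup>2 \<le> 1" by (intro power_le_one) auto
    ultimately have "4 * (B v e * B v f) \<le> 1"
      by (auto simp: power2_eq_square algebra_simps)
    then show "B v e * B v f \<le> 1/4" by simp
    show "0 \<le> B v e * B v f" using \<open>0 < B v e\<close> \<open>0 < B v f\<close> by simp
  qed
  also have "\<dots> = (1/4) ^ card (e \<inter> f)" by simp
  also have "\<dots> \<le> (1/4) ^ 3" using \<open>card (e \<inter> f) \<ge> 3\<close> by (intro power_decreasing) auto
  finally show False by (simp add: eval_nat_numeral)
qed

section \<open>Lowering the uniformity\<close>

text \<open>Every edge has more than \<open>s\<close> vertices but at most \<open>s\<close> nonleaf
  ones, so each has a leaf \<open>g e\<close> to delete. Leaves carry label 1, hence sums and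
  products are unchanged. The nonleaf sets are transported literally, so that the bound survives
  iteration and an edge with four nonleaf vertices remains recognisable.\<close>

lemma shrink_once:
  assumes s: "3 \<le> s" "s < r" and m: "\<And>e. e \<in> E \<Longrightarrow> card (nonleaf e) \<le> s"
  obtains V' E' B' where "normal_labelling (r - 1) V' E' B'"
    "extends (Hypergraph V E) (Hypergraph V' E')"
    "\<And>e'. e' \<in> E' \<Longrightarrow> \<exists>e\<in>E. normal_labelling.nonleaf E' e' = nonleaf e"
    "\<And>e. e \<in> E \<Longrightarrow> \<exists>e'\<in>E'. normal_labelling.nonleaf E' e' = nonleaf e"
proof -
  have "\<exists>x. x \<in> e \<and> inc x = {e}" if "e \<in> E" for e
  proof (rule ccontr)
    assume "\<not> ?thesis"
    then have "nonleaf e = e" by (auto simp: nonleaf_def)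
    then show False using m[OF that] s card_edge[OF that] by simp
  qed
  then obtain g where g: "\<And>e. e \<in> E \<Longrightarrow> g e \<in> e \<and> inc (g e) = {e}" by metis
  define h where "h e = e - {g e}" for e
  define V' where "V' = V - g ` E"
  define E' where "E' = h ` E"
  have gf: "g e \<in> f \<longleftrightarrow> e = f" if "e \<in> E" "f \<in> E" for e f
    using g[OF that(1)] that by (metis in_inc singletonD)
  \<comment> \<open>Two edges that become equal would share \<open>r - 1 \<ge> 3\<close>
    vertices.\<close>
  have inj: "inj_on h E"
  proof (rule inj_onI, rule ccontr)
    fix e f assume ef: "e \<in> E" "f \<in> E" "h e = h f" "e \<noteq> f"
    then have "h e \<subseteq> e \<inter> f" by (auto simp: h_def)
    then have "card (h e) \<le> card (e \<inter> f)" using finite_edge ef by (intro card_mono) auto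
    moreover have "card (h e) = r - 1" using g ef card_edge finite_edge by (simp add: h_def)
    ultimately show False using card_Int_le_2[of e f] ef s by simp
  qed
  define k where "k = inv_into E h"
  have k: "k (h e) = e" if "e \<in> E" for e using that inj by (simp add: k_def)
  define B' where "B' v e = B v (k e)" for v e
  have inc': "{e' \<in> E'. v \<in> e'} = h ` inc v" if "v \<in> V'" for v
    using that gf by (auto simp: E'_def h_def V'_def)
  have hV: "h e \<subseteq> V'" if "e \<in> E" for e
    using that edge_sub gf by (auto simp: h_def V'_def)
  interpret N': normal_labelling "r - 1" V' E' B'
  proof
    show "3 \<le> r - 1" using s by simp
    show "finite V'" using finite_V by (simp add: V'_def)
    show "e' \<subseteq> V'" if "e' \<in> E'" for e' using that hV by (auto simp: E'_def)
    show "card e' = r - 1" if "e' \<in> E'" for e'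
      using that g card_edge finite_edge by (auto simp: E'_def h_def)
    show "E' \<noteq> {}" using E_ne by (simp add: E'_def)
    show "0 < B' v e'" if "e' \<in> E'" "v \<in> e'" for e' v
      using that B_pos k by (auto simp: E'_def B'_def) (simp add: h_def)
    show "(\<Sum>e\<in>{e \<in> E'. v \<in> e}. B' v e) = 1" if "v \<in> V'" for v
    proof -
      have "(\<Sum>e\<in>{e \<in> E'. v \<in> e}. B' v e) = (\<Sum>e\<in>inc v. B' v (h e))"
        unfolding inc'[OF that] using inj by (intro sum.reindex_cong[of h]) (auto simp: inj_on_def)
      also have "\<dots> = (\<Sum>e\<in>inc v. B v e)" by (intro sum.cong) (auto simp: B'_def k)
      finally show ?thesis using B_sum[of v] that by (simp add: inc_def V'_def)
    qed
    show "(\<Prod>v\<in>e'. B' v e') = 1/4" if "e' \<in> E'" for e'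
    proof -
      from that obtain e where e: "e \<in> E" "e' = h e" by (auto simp: E'_def)
      have "(\<Prod>v\<in>e'. B' v e') = (\<Prod>v\<in>e - {g e}. B v e)"
        using e by (simp add: B'_def k h_def[symmetric])
      then show ?thesis using B_prod_nonleaf[OF e(1), of "e - {g e}"] g[OF e(1)]
        by (auto simp: nonleaf_def)
    qed
    show "S = E'" if S: "S \<subseteq> E'" "S \<noteq> {}" "\<And>e f. e \<in> S \<Longrightarrow> f \<in> E' \<Longrightarrow> e \<inter> f \<noteq> {} \<Longrightarrow> f \<in> S" for S
    proof -
      have "{e \<in> E. h e \<in> S} = E"
      proof (rule conn)
        show "{e \<in> E. h e \<in> S} \<noteq> {}" using S by (auto simp: E'_def)
        fix e f assume ef: "e \<in> {e \<in> E. h e \<in> S}" "f \<in> E" "e \<inter> f \<noteq> {}"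
        show "f \<in> {e \<in> E. h e \<in> S}"
        proof (cases "e = f")
          case False
          then have "h e \<inter> h f \<noteq> {}" using ef gf[of e f] gf[of f e] by (auto simp: h_def)
          then show ?thesis using S(3)[of "h e" "h f"] ef by (auto simp: E'_def)
        qed (use ef in simp)
      qed auto
      then show ?thesis using S(1) by (auto simp: E'_def)
    qed
  qed
  have nl: "N'.nonleaf (h e) = nonleaf e" if e: "e \<in> E" for e
  proof -
    have "v \<in> N'.nonleaf (h e) \<longleftrightarrow> v \<in> nonleaf e" for v
    proof (cases "v = g e")
      case True
      then show ?thesis using g[OF e] by (auto simp: N'.nonleaf_def nonleaf_def h_def)
    next
      case False
      show ?thesis
      proof (cases "v \<in> e")
        case True
        then have "v \<in> V'" using hV[OF e] False by (auto simp: h_def)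
        then have "N'.inc v = h ` inc v" using inc' by (simp add: N'.inc_def)
        moreover have "h ` inc v = {h e} \<longleftrightarrow> inc v = {e}"
        proof -
          have "inc v \<subseteq> E" by (auto simp: inc_def)
          then show ?thesis using inj_on_image_eq_iff[OF inj, of "inc v" "{e}"] e by simp
        qed
        ultimately show ?thesis using True False by (auto simp: N'.nonleaf_def nonleaf_def h_def)
      qed (auto simp: N'.nonleaf_def nonleaf_def h_def)
    qed
    then show ?thesis by blast
  qed
  have ins: "insert (g e) (h e) = e" if "e \<in> E" for e using g[OF that] by (auto simp: h_def)
  have "extends (Hypergraph V E) (Hypergraph V' E')"
    unfolding extends_def
  proof (intro exI[of _ "g \<circ> k"] conjI)
    show "inj_on (g \<circ> k) (edges (Hypergraph V' E'))"
    proof (rule inj_onI)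
      fix e' f' assume "e' \<in> edges (Hypergraph V' E')" "f' \<in> edges (Hypergraph V' E')"
        and eq: "(g \<circ> k) e' = (g \<circ> k) f'"
      then obtain e f where ef: "e \<in> E" "e' = h e" "f \<in> E" "f' = h f" by (auto simp: E'_def)
      have "g e = g f" using eq ef k by simp
      then have "g e \<in> f" using g[OF ef(3)] by simp
      then show "e' = f'" using gf[OF ef(1,3)] ef by simp
    qed
    have gk: "(g \<circ> k) ` E' = g ` E" unfolding E'_def image_image comp_def using k by simp
    then show "(g \<circ> k) ` edges (Hypergraph V' E') \<inter> verts (Hypergraph V' E') = {}"
      by (simp only: hypergraph.sel V'_def) blast
    show "verts (Hypergraph V E) = verts (Hypergraph V' E') \<union> (g \<circ> k) ` edges (Hypergraph V' E')"
      using g edge_sub by (simp only: gk hypergraph.sel V'_def) blast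
    show "edges (Hypergraph V E) = (\<lambda>e. insert ((g \<circ> k) e) e) ` edges (Hypergraph V' E')"
      using ins by (force simp: E'_def k image_image)
  qed
  moreover have "\<exists>e\<in>E. N'.nonleaf e' = nonleaf e" if "e' \<in> E'" for e'
    using that nl by (auto simp: E'_def)
  moreover have "\<exists>e'\<in>E'. N'.nonleaf e' = nonleaf e" if "e \<in> E" for e
    using that nl by (auto simp: E'_def)
  ultimately show thesis using that[OF N'.normal_labelling_axioms] by blast
qed

end

lemma shrink:
  assumes "normal_labelling r V E B" "3 \<le> s" "s \<le> r"
    and "\<And>e. e \<in> E \<Longrightarrow> card (normal_labelling.nonleaf E e) \<le> s"
  obtains V' E' B' where "normal_labelling s V' E' B'"
    "(extends ^^ (r - s)) (Hypergraph V E) (Hypergraph V' E')"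
    "\<forall>e\<in>E. \<exists>e'\<in>E'. normal_labelling.nonleaf E' e' = normal_labelling.nonleaf E e"
  using assms
proof (induction "r - s" arbitrary: r V E B thesis)
  case 0
  then show ?case by (metis diff_is_0_eq le_antisym relpowp_0_I)
next
  case (Suc n)
  interpret N: normal_labelling r V E B by (rule Suc.prems)
  have sr: "s < r" using Suc.hyps by simp
  obtain V1 E1 B1 where 1: "normal_labelling (r - 1) V1 E1 B1"
    "extends (Hypergraph V E) (Hypergraph V1 E1)"
    "\<And>e'. e' \<in> E1 \<Longrightarrow> \<exists>e\<in>E. normal_labelling.nonleaf E1 e' = N.nonleaf e"
    "\<And>e. e \<in> E \<Longrightarrow> \<exists>e'\<in>E1. normal_labelling.nonleaf E1 e' = N.nonleaf e"
    using N.shrink_once[OF Suc.prems(3) sr Suc.prems(5)] by blast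
  have n: "n = r - 1 - s" "s \<le> r - 1" using Suc.hyps by auto
  have c: "card (normal_labelling.nonleaf E1 e') \<le> s" if "e' \<in> E1" for e'
    using 1(3)[OF that] Suc.prems(5) by auto
  obtain V' E' B' where 2: "normal_labelling s V' E' B'"
    "(extends ^^ (r - 1 - s)) (Hypergraph V1 E1) (Hypergraph V' E')"
    "\<forall>e\<in>E1. \<exists>e'\<in>E'. normal_labelling.nonleaf E' e' = normal_labelling.nonleaf E1 e"
    using Suc.hyps(1)[OF n(1) _ 1(1) Suc.prems(3) n(2) c] by blast
  have "(extends ^^ Suc (r - 1 - s)) (Hypergraph V E) (Hypergraph V' E')"
    using relpowp_Suc_I2[OF 1(2) 2(2)] .
  moreover have "Suc (r - 1 - s) = r - s" using sr by simp
  ultimately show ?case using Suc.prems(1)[OF 2(1)] 1(4) 2(3) by metis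
qed

section \<open>Cycles\<close>

context normal_labelling
begin

text \<open>Pairs (child, parent) of flags: the branch at \<open>w\<close> through \<open>f\<close> hangs off the branch at \<open>v\<close>
  through \<open>e\<close>. Infinite descending chains are non-backtracking walks, so the relation is
  well-founded exactly when the hypergraph has no cycle.\<close>

definition child :: "(('a \<times> 'a set) \<times> ('a \<times> 'a set)) set" where
  "child = {((w, f), (v, e)). e \<in> E \<and> f \<in> E \<and> v \<in> e \<and> w \<in> e \<and> w \<noteq> v \<and> w \<in> f \<and> f \<noteq> e}"

text \<open>The last clause says that no flag repeats within a period. Vertices or edges alone may a
  priori repeat; that they do not is proved in \<open>pw_inj_vertices\<close> and
  \<open>pw_inj_edges\<close>.\<close>

definition periodic_walk :: "nat \<Rightarrow> (nat \<Rightarrow> 'a) \<Rightarrow> (nat \<Rightarrow> 'a set) \<Rightarrow> bool" where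
  "periodic_walk n \<nu> \<epsilon> \<longleftrightarrow> n > 0 \<and>
     (\<forall>i. ((\<nu> (Suc i), \<epsilon> (Suc i)), (\<nu> i, \<epsilon> i)) \<in> child) \<and>
     (\<forall>i. \<nu> (i + n) = \<nu> i \<and> \<epsilon> (i + n) = \<epsilon> i) \<and>
     (\<forall>i j. i < j \<and> j < n \<longrightarrow> (\<nu> i, \<epsilon> i) \<noteq> (\<nu> j, \<epsilon> j))"

lemma ex_periodic_walk:
  assumes "\<not> wf child"
  shows "\<exists>n \<nu> \<epsilon>. periodic_walk n \<nu> \<epsilon>"
proof -
  obtain f where f: "\<And>i. (f (Suc i), f i) \<in> child"
    using assms wf_iff_no_infinite_down_chain by blast
  have "f i \<in> V \<times> E" for i
    using f[of i] edge_sub by (cases "f i") (auto simp: child_def)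
  then have "range f \<subseteq> V \<times> E" by blast
  then have "finite (range f)" using finite_V finite_E by (meson finite_SigmaI finite_subset)
  then have "\<not> inj f" using finite_imageD infinite_UNIV_nat by blast
  then obtain i j where "f i = f j" "i < j" unfolding inj_def by (metis nat_neq_iff)
  then have "f (i + (j - i)) = f i \<and> 0 < j - i" by simp
  then have ex: "\<exists>n. n > 0 \<and> (\<exists>i. f (i + n) = f i)" by blast
  \<comment> \<open>The minimum is taken over all starting points at once, so it also forbids
    repetitions inside the chosen segment. That segment is then repeated periodically, since the
    tail of \<open>f\<close> itself need not be periodic.\<close>
  define n where "n = (LEAST n. n > 0 \<and> (\<exists>i. f (i + n) = f i))"
  have n: "n > 0" "\<exists>i. f (i + n) = f i" using LeastI_ex[OF ex] by (auto simp: n_def)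
  have least: "n \<le> m" if "m > 0" "f (i + m) = f i" for m i
    unfolding n_def using that by (intro Least_le) auto
  obtain p where p: "f (p + n) = f p" using n by blast
  define g where "g i = f (p + i mod n)" for i
  have "(g (Suc i), g i) \<in> child" for i
  proof (cases "Suc (i mod n) = n")
    case True
    then have "g (Suc i) = f (p + Suc (i mod n))" using p by (simp add: g_def mod_Suc)
    then show ?thesis using f by (simp add: g_def)
  next
    case False
    then show ?thesis using f by (simp add: g_def mod_Suc)
  qed
  moreover have "g i \<noteq> g j" if "i < j" "j < n" for i j
    using least[of "j - i" "p + i"] that by (auto simp: g_def add.assoc)
  ultimately have "periodic_walk n (fst \<circ> g) (snd \<circ> g)"
    using n by (auto simp: periodic_walk_def g_def prod_eq_iff)
  then show ?thesis by blast
qed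

context
  fixes n \<nu> \<epsilon>
  assumes pw: "periodic_walk n \<nu> \<epsilon>"
begin

lemma pw_step:
  "\<epsilon> i \<in> E" "\<nu> i \<in> \<epsilon> i" "\<nu> (Suc i) \<in> \<epsilon> i" "\<nu> (Suc i) \<noteq> \<nu> i" "\<epsilon> (Suc i) \<noteq> \<epsilon> i"
  and pw_period: "\<nu> (i + n) = \<nu> i" "\<epsilon> (i + n) = \<epsilon> i"
  using pw by (auto simp: periodic_walk_def child_def)

text \<open>With \<open>b\<close> the label on entering an edge and \<open>c\<close> the label on
  leaving it, \<open>b i * (1 - b (Suc i)) \<ge> 1/4\<close>, while
  \<open>p * (1 - p) \<le> 1/4\<close> for every \<open>p\<close>. So \<open>b\<close> does not
  increase; periodicity makes it constant, and equality in the second bound forces 1/2.\<close>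

lemma pw_half: "B (\<nu> i) (\<epsilon> i) = 1/2" and pw_half': "B (\<nu> (Suc i)) (\<epsilon> i) = 1/2"
proof -
  define b where "b i = B (\<nu> i) (\<epsilon> i)" for i
  define c where "c i = B (\<nu> (Suc i)) (\<epsilon> i)" for i
  have bpos: "b i > 0" for i unfolding b_def using pw_step B_pos by blast
  have bc: "b i * c i \<ge> 1/4" for i
    unfolding b_def c_def using pw_step[of i] by (intro B_prod2) auto
  have cb: "c i + b (Suc i) \<le> 1" for i
    unfolding b_def c_def using pw_step[of i] pw_step[of "Suc i"]
      B_sum_subset[of "\<epsilon> i" "\<nu> (Suc i)" "{\<epsilon> i, \<epsilon> (Suc i)}"] by auto
  have dec: "b (Suc i) \<le> b i" for i
  proof -
    have "b i * (1 - b (Suc i)) \<ge> b i * c i" using cb[of i] bpos[of i] by (intro mult_left_mono) auto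
    then have "b i * b (Suc i) \<le> b i - 1/4" using bc[of i] by (simp add: algebra_simps)
    also have "\<dots> \<le> b i * b i" using zero_le_power2[of "b i - 1/2"] by (simp add: power2_eq_square algebra_simps)
    finally show ?thesis using bpos[of i] by (simp add: mult_le_cancel_left_pos)
  qed
  have "b (i + n) \<le> b (Suc i)" for i
    using lift_Suc_antimono_le[of b "Suc i" "i + n"] dec pw by (simp add: periodic_walk_def)
  moreover have "b (i + n) = b i" for i by (simp add: b_def pw_period)
  ultimately have const: "b (Suc i) = b i" for i using dec[of i] by (metis antisym)
  have "b i = 1/2 \<and> c i = 1/2" for i
  proof -
    have "b i * (1 - b i) \<ge> b i * c i" using cb[of i] const[of i] bpos[of i] by (intro mult_left_mono) auto
    then have "b i * (1 - b i) \<ge> 1/4" using bc[of i] by simp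
    then have "(b i - 1/2)\<^sup>2 \<le> 0" by (simp add: power2_eq_square algebra_simps)
    then have b: "b i = 1/2" by simp
    have "1/2 * c i \<ge> 1/4" "c i + 1/2 \<le> 1" using bc[of i] cb[of i] const[of i] unfolding b by simp_all
    then show ?thesis using b by simp
  qed
  then show "B (\<nu> i) (\<epsilon> i) = 1/2" "B (\<nu> (Suc i)) (\<epsilon> i) = 1/2" by (auto simp: b_def c_def)
qed

lemma pw_inc: "inc (\<nu> (Suc i)) = {\<epsilon> i, \<epsilon> (Suc i)}"
proof (rule ccontr)
  assume "\<not> ?thesis"
  then obtain f where f: "f \<in> inc (\<nu> (Suc i))" "f \<noteq> \<epsilon> i" "f \<noteq> \<epsilon> (Suc i)"
    using pw_step[of i] pw_step[of "Suc i"] unfolding inc_def by blast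
  then have "B (\<nu> (Suc i)) (\<epsilon> i) + (B (\<nu> (Suc i)) (\<epsilon> (Suc i)) + B (\<nu> (Suc i)) f) \<le> 1"
    using B_sum_subset[of "\<epsilon> i" "\<nu> (Suc i)" "{\<epsilon> i, \<epsilon> (Suc i), f}"] pw_step[of i] pw_step[of "Suc i"] by auto
  then show False using pw_half[of "Suc i"] pw_half'[of i] B_pos[of f "\<nu> (Suc i)"] f by auto
qed

text \<open>The two labels 1/2 already use up the whole edge product, and a further nonleaf vertex
  would contribute a factor at most 3/4.\<close>

lemma pw_nonleaf: "nonleaf (\<epsilon> i) = {\<nu> i, \<nu> (Suc i)}"
proof
  show "{\<nu> i, \<nu> (Suc i)} \<subseteq> nonleaf (\<epsilon> i)"
  proof -
    have "inc (\<nu> i) \<noteq> {\<epsilon> i}"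
      using B_eq_1[OF pw_step(1) pw_step(2), of i] unfolding pw_half by simp
    moreover have "inc (\<nu> (Suc i)) \<noteq> {\<epsilon> i}"
      using B_eq_1[OF pw_step(1) pw_step(3), of i] unfolding pw_half' by simp
    ultimately show ?thesis using pw_step[of i] by (simp add: nonleaf_def)
  qed
  show "nonleaf (\<epsilon> i) \<subseteq> {\<nu> i, \<nu> (Suc i)}"
  proof
    fix u assume u: "u \<in> nonleaf (\<epsilon> i)"
    show "u \<in> {\<nu> i, \<nu> (Suc i)}"
    proof (rule ccontr)
      assume "u \<notin> {\<nu> i, \<nu> (Suc i)}"
      then have "1/4 \<le> B u (\<epsilon> i) * (B (\<nu> i) (\<epsilon> i) * B (\<nu> (Suc i)) (\<epsilon> i))"
        using u pw_step[of i] by (intro B_prod3) (auto simp: nonleaf_def)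
      then have "1/4 \<le> B u (\<epsilon> i) * (1/2 * (1/2))" unfolding pw_half pw_half' .
      then show False using B_le_34[OF pw_step(1) u] by simp
    qed
  qed
qed

lemma pw_edges: "E = \<epsilon> ` {..<n}"
proof -
  have n: "n > 0" using pw by (simp add: periodic_walk_def)
  have mod: "\<epsilon> i = \<epsilon> (i mod n)" for i
  proof (induction i rule: less_induct)
    case (less i)
    show ?case
    proof (cases "i < n")
      case False
      then show ?thesis using less[of "i - n"] pw_period(2)[of "i - n"] n by (simp add: le_mod_geq)
    qed simp
  qed
  have "range \<epsilon> = E"
  proof (rule conn)
    fix e f assume e: "e \<in> range \<epsilon>" "f \<in> E" "e \<inter> f \<noteq> {}"
    \<comment> \<open>The index is shifted to a successor because \<open>pw_inc\<close> describes
      only vertices that have a predecessor on the walk.\<close>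
    then obtain i where i: "e = \<epsilon> (Suc i)" using pw_period(2) n by (metis Suc_pred add_gr_0 rangeE)
    from e obtain v where v: "v \<in> e" "v \<in> f" by auto
    show "f \<in> range \<epsilon>"
    proof (cases "v \<in> nonleaf e")
      case True
      then have "v = \<nu> (Suc i) \<or> v = \<nu> (Suc (Suc i))" using pw_nonleaf[of "Suc i"] i by simp
      moreover have "f \<in> inc v" using v e by simp
      ultimately have "f \<in> {\<epsilon> i, \<epsilon> (Suc i), \<epsilon> (Suc (Suc i))}" using pw_inc by blast
      then show ?thesis by blast
    next
      case False
      then have "inc v = {e}" using v by (simp add: nonleaf_def)
      moreover have "f \<in> inc v" using v e by simp
      ultimately show ?thesis using e by blast
    qed
  qed (use pw_step in auto)
  moreover have "\<epsilon> i \<in> \<epsilon> ` {..<n}" for i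
    using mod[of i] n by (metis imageI lessThan_iff mod_less_divisor)
  ultimately show ?thesis by blast
qed

text \<open>A walk that returned along itself could be folded inward two steps at a time, until two
  consecutive edges or two consecutive vertices coincide, which non-backtracking excludes.\<close>

lemma pw_no_reversal: "\<nu> (Suc i + k) = \<nu> (Suc i) \<Longrightarrow> \<epsilon> (Suc i + k) \<noteq> \<epsilon> i"
proof (induction k arbitrary: i rule: less_induct)
  case (less k)
  consider "k = 0" | "k = 1" | m where "k = Suc (Suc m)" by (metis One_nat_def not0_implies_Suc)
  then show ?case
  proof cases
    case 1 then show ?thesis using pw_step(5)[of i] by simp
  next
    case 2 then show ?thesis using less.prems pw_step(4)[of "Suc i"] by simp
  next
    case (3 m)
    show ?thesis
    proof
      assume e: "\<epsilon> (Suc i + k) = \<epsilon> i"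
      have "inc (\<nu> (Suc (i + k))) = {\<epsilon> i, \<epsilon> (Suc i)}" using less.prems pw_inc[of i] by simp
      then have e2: "\<epsilon> (i + k) = \<epsilon> (Suc i)"
        using pw_inc[of "i + k"] e pw_step(5)[of "i + k"] by auto
      have "\<nu> (i + k) = \<nu> (Suc (Suc i))"
        using pw_nonleaf[of "i + k"] pw_nonleaf[of "Suc i"] e2 less.prems pw_step(4)[of "i + k"]
        by (auto simp: doubleton_eq_iff)
      then have "\<epsilon> (Suc (Suc i) + m) \<noteq> \<epsilon> (Suc i)" using 3 by (intro less.IH) auto
      then show False using e2 3 by simp
    qed
  qed
qed

text \<open>A vertex of the walk lies in two edges only. A second visit leaves either by the same
  edge, repeating a flag within the period, or by the edge of arrival, which is a reversal.\<close>

lemma pw_inj_vertices: "inj_on \<nu> {..<n}"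
proof (rule linorder_inj_onI')
  fix i j assume ij: "i \<in> {..<n}" "j \<in> {..<n}" "i < j"
  show "\<nu> i \<noteq> \<nu> j"
  proof
    assume eq: "\<nu> i = \<nu> j"
    \<comment> \<open>The cyclic predecessor of \<open>i\<close>, so that \<open>i = 0\<close> needs
      no separate treatment.\<close>
    define p where "p = i + n - 1"
    have p: "Suc p = i + n" using ij by (simp add: p_def)
    have "\<epsilon> j \<in> inc (\<nu> (Suc p))" using pw_step[of j] eq p pw_period(1)[of i] by auto
    then have "\<epsilon> j = \<epsilon> p \<or> \<epsilon> j = \<epsilon> i" using pw_inc[of p] p pw_period(2)[of i] by auto
    moreover have "\<epsilon> j \<noteq> \<epsilon> i" using pw ij eq unfolding periodic_walk_def by (metis lessThan_iff)
    moreover have "Suc p + (j - i) = j + n" using p ij by simp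
    then have "\<epsilon> j \<noteq> \<epsilon> p"
      using pw_no_reversal[of p "j - i"] p eq pw_period[of j] pw_period[of i] by metis
    ultimately show False by blast
  qed
qed

lemma pw_inj_edges: "inj_on \<epsilon> {..<n}"
proof (rule linorder_inj_onI')
  fix i j assume ij: "i \<in> {..<n}" "j \<in> {..<n}" "i < j"
  have inj: "k = l" if "\<nu> k = \<nu> l" "k < n" "l < n" for k l
    using pw_inj_vertices that by (auto simp: inj_on_def)
  show "\<epsilon> i \<noteq> \<epsilon> j"
  proof
    assume "\<epsilon> i = \<epsilon> j"
    then have "{\<nu> i, \<nu> (Suc i)} = {\<nu> j, \<nu> (Suc j)}" using pw_nonleaf by metis
    moreover have "\<nu> i \<noteq> \<nu> j" using inj[of i j] ij by auto
    ultimately have eq: "\<nu> i = \<nu> (Suc j)" "\<nu> (Suc i) = \<nu> j" by (auto simp: doubleton_eq_iff)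
    have "Suc i = j" using inj[OF eq(2)] ij by simp
    then show False using \<open>\<epsilon> i = \<epsilon> j\<close> pw_step(5)[of i] by simp
  qed
qed

end

text \<open>This rules out cycles as soon as some edge has four nonleaf vertices.\<close>

lemma card_nonleaf_cycle:
  assumes "\<not> wf child" "e \<in> E"
  shows "card (nonleaf e) = 2"
proof -
  obtain n \<nu> \<epsilon> where pw: "periodic_walk n \<nu> \<epsilon>" using ex_periodic_walk assms by blast
  then show ?thesis
    using pw_edges[OF pw] pw_nonleaf[OF pw] pw_step(4)[OF pw] assms(2) by (auto simp: card_2_iff')
qed

lemma cycle_classification:
  assumes "\<not> wf child" and r3: "r = 3"
  shows "(\<exists>n\<ge>3. C3 n (Hypergraph V E)) \<or> C3_2 (Hypergraph V E)"
proof -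
  obtain n \<nu> \<epsilon> where pw: "periodic_walk n \<nu> \<epsilon>" using ex_periodic_walk assms by blast
  note step = pw_step[OF pw] and inc = pw_inc[OF pw] and nonleaf = pw_nonleaf[OF pw]
    and period = pw_period[OF pw] and edges = pw_edges[OF pw]
  have "\<exists>w. \<epsilon> i = {\<nu> i, \<nu> (Suc i), w} \<and> inc w = {\<epsilon> i}" for i
  proof -
    have "card (\<epsilon> i - {\<nu> i, \<nu> (Suc i)}) = 1"
      using step[of i] card_edge[of "\<epsilon> i"] finite_edge[of "\<epsilon> i"] r3 by (simp add: card_Diff_subset)
    then obtain w where "\<epsilon> i - {\<nu> i, \<nu> (Suc i)} = {w}" by (auto simp: card_1_singleton_iff)
    then show ?thesis using step[of i] nonleaf[of i] by (intro exI[of _ w]) (auto simp: nonleaf_def)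
  qed
  then obtain w where w: "\<And>i. \<epsilon> i = {\<nu> i, \<nu> (Suc i), w i}" "\<And>i. inc (w i) = {\<epsilon> i}" by metis
  have w_ne: "w i \<noteq> \<nu> (Suc j)" for i j
  proof
    assume "w i = \<nu> (Suc j)"
    then have "{\<epsilon> i} = {\<epsilon> j, \<epsilon> (Suc j)}" using w(2)[of i] inc[of j] by simp
    then show False using step(5)[of j] by auto
  qed
  have n0: "n > 0" using pw by (simp add: periodic_walk_def)
  \<comment> \<open>Period 1 would make consecutive edges equal; period 2 is the pair of edges
    sharing two vertices.\<close>
  have n1: "n \<noteq> 1" using step(5)[of 0] period(2)[of 0] by auto
  show ?thesis
  proof (cases "n = 2")
    case True
    have "{..<n} = {0, 1}" using True by auto
    then have E: "E = {\<epsilon> 0, \<epsilon> 1}" using edges by simp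
    have "\<nu> (Suc (Suc 0)) = \<nu> 0" using period(1)[of 0] True by (simp add: numeral_2_eq_2)
    then have e: "\<epsilon> 0 = {\<nu> 0, \<nu> 1, w 0}" "\<epsilon> 1 = {\<nu> 1, \<nu> 0, w 1}" using w(1)[of 0] w(1)[of 1] by auto
    moreover have "w 0 \<noteq> w 1" using w(2)[of 0] w(2)[of 1] step(5)[of 0] by auto
    moreover have "w 0 \<noteq> \<nu> 1" "w 1 \<noteq> \<nu> 1" "w 0 \<noteq> \<nu> 0" "w 1 \<noteq> \<nu> 0"
      using w_ne[of 0 0] w_ne[of 1 0] w_ne[of 0 1] w_ne[of 1 1] \<open>\<nu> (Suc (Suc 0)) = \<nu> 0\<close> by auto
    ultimately have "\<epsilon> 0 \<inter> \<epsilon> 1 = {\<nu> 0, \<nu> 1}" by auto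
    then have "card (\<epsilon> 0 \<inter> \<epsilon> 1) = 2" using step(4)[of 0] by auto
    moreover have "card (\<epsilon> 0) = 3" "card (\<epsilon> 1) = 3" using card_edge[OF step(1)] r3 by auto
    moreover have "V = \<epsilon> 0 \<union> \<epsilon> 1" unfolding V_eq unfolding E by simp
    ultimately have "C3_2 (Hypergraph V E)" unfolding C3_2_def using E by blast
    then show ?thesis ..
  next
    case False
    then have n3: "n \<ge> 3" using n0 n1 by simp
    have mod: "\<nu> (Suc i mod n) = \<nu> (Suc i)" if "i < n" for i
      using that period(1)[of 0] by (cases "Suc i = n") auto
    have "C3 n (Hypergraph V E)" unfolding C3_def
    proof (rule exI[of _ \<nu>], rule exI[of _ w], intro conjI)
      show "inj_on \<nu> {..<n}" by (rule pw_inj_vertices[OF pw])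
      show "inj_on w {..<n}"
      proof (rule inj_onI)
        fix i j assume "i \<in> {..<n}" "j \<in> {..<n}" "w i = w j"
        then show "i = j" using w(2)[of i] w(2)[of j] pw_inj_edges[OF pw] by (auto simp: inj_on_def)
      qed
      show "\<nu> ` {..<n} \<inter> w ` {..<n} = {}"
      proof -
        have "\<nu> j = \<nu> (Suc (j + n - 1))" for j using period(1)[of j] n0 by simp
        then have "w i \<noteq> \<nu> j" for i j using w_ne by metis
        then show ?thesis by (metis disjoint_iff imageE)
      qed
      have E': "E = (\<lambda>i. {\<nu> i, \<nu> (Suc i mod n), w i}) ` {..<n}"
        unfolding edges using w(1) mod by (intro image_cong) auto
      have "V = \<nu> ` {..<n} \<union> w ` {..<n}"
        unfolding V_eq E' using n0 by auto
      with E' show "Hypergraph V E = Hypergraph (\<nu> ` {..<n} \<union> w ` {..<n})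
         ((\<lambda>i. {\<nu> i, \<nu> (Suc i mod n), w i}) ` {..<n})" by simp
    qed
    with n3 show ?thesis by blast
  qed
qed

end

section \<open>Walks and chains in hypertrees\<close>

locale hypertree = normal_labelling +
  assumes wf_child: "wf child"
begin

text \<open>\<open>v\<close> is any vertex of the first edge, and the junctions are only required
  not to backtrack. That such a sequence is a path in the sense of \<open>hyper_path\<close> is a
  consequence of acyclicity, proved in \<open>walk_hyper_path\<close>.\<close>

inductive walk :: "'a \<Rightarrow> 'a set list \<Rightarrow> bool" where
  single: "\<lbrakk>e \<in> E; v \<in> e\<rbrakk> \<Longrightarrow> walk v [e]"
| step: "\<lbrakk>e \<in> E; v \<in> e; w \<in> e; w \<noteq> v; hd es \<noteq> e; walk w es\<rbrakk> \<Longrightarrow> walk v (e # es)"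

lemma walk_basic: assumes "walk v es"
  shows "es \<noteq> []" "set es \<subseteq> E" "v \<in> hd es" "hd es \<in> E"
  using assms by (induction) auto

text \<open>Two vertices common to two different edges would give a 2-cycle of
  \<open>child\<close>.\<close>

lemma linear: assumes "e \<in> E" "f \<in> E" "u \<in> e" "u \<in> f" "w \<in> e" "w \<in> f" "u \<noteq> w" shows "e = f"
proof (rule ccontr)
  assume "e \<noteq> f"
  then have "((w, f), (u, e)) \<in> child" "((u, e), (w, f)) \<in> child"
    using assms by (auto simp: child_def)
  then show False using wf_child wf_not_sym by metis
qed

lemma walk_last:
  assumes "walk v es" "length es \<ge> 2"
  shows "\<exists>y\<in>last es. y \<in> last (butlast es) \<and> ((y, last es), (v, hd es)) \<in> child\<^sup>+"
  using assms
proof (induction)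
  case (step e v w es)
  have c: "((w, hd es), (v, e)) \<in> child"
    using step walk_basic[OF \<open>walk w es\<close>] by (auto simp: child_def)
  show ?case
  proof (cases "length es \<ge> 2")
    case True
    then obtain y where y: "y \<in> last es" "y \<in> last (butlast es)" "((y, last es), (w, hd es)) \<in> child\<^sup>+"
      using step.IH by blast
    have "es \<noteq> []" "butlast es \<noteq> []" using True by (cases es rule: rev_cases; auto)+
    then show ?thesis using y c by (intro bexI[of _ y]) (auto intro: trancl_into_trancl)
  next
    case False
    then obtain f where "es = [f]" using walk_basic[OF \<open>walk w es\<close>] by (cases es; cases "tl es") auto
    then show ?thesis using step c walk_basic[OF \<open>walk w es\<close>] by (intro bexI[of _ w]) auto
  qed
qed simp

lemma walk_take:
  assumes "walk v es" "n \<ge> 1"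
  shows "walk v (take n es)"
  using assms
proof (induction arbitrary: n)
  case (single e v)
  then show ?case by (cases n) (auto intro: walk.single)
next
  case (step e v w es)
  obtain m where n: "n = Suc m" using step.prems by (cases n) auto
  show ?case
  proof (cases "m = 0")
    case True
    then show ?thesis using n step by (auto intro: walk.single)
  next
    case False
    then have "walk w (take m es)" "hd (take m es) = hd es" using step.IH[of m] by auto
    then show ?thesis using n step by (auto intro!: walk.step[of e v w])
  qed
qed

text \<open>If the walk came back to \<open>v\<close>, the first flag would be a child of the last
  one, closing a cycle in \<open>child\<close>. The side conditions \<open>y \<noteq> v\<close> and
  \<open>last es \<noteq> e\<close> come from the induction hypothesis for the walk without its last
  and without its first edge; length 2 is linearity.\<close>

lemma walk_not_closed:
  assumes "walk v es" "length es \<ge> 2"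
  shows "v \<notin> last es"
  using assms
proof (induction "length es" arbitrary: v es rule: less_induct)
  case less
  show ?case
  proof
    assume v: "v \<in> last es"
    obtain y where y: "y \<in> last es" "y \<in> last (butlast es)" "((y, last es), (v, hd es)) \<in> child\<^sup>+"
      using walk_last[OF less.prems] by blast
    from less.prems(1) obtain e es' w where es: "es = e # es'" "e \<in> E" "v \<in> e" "w \<in> e" "w \<noteq> v"
      "hd es' \<noteq> e" "walk w es'"
      using less.prems(2) by (cases rule: walk.cases) auto
    have ne: "es' \<noteq> []" using walk_basic(1)[OF es(7)] .
    have lastE: "last es \<in> E" using walk_basic(2)[OF es(7)] ne es(1) by auto
    show False
    proof (cases "length es' \<ge> 2")
      case False
      then obtain f where f: "es' = [f]" using ne by (cases es'; cases "tl es'") auto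
      then have "w \<in> f" "f \<in> E" using walk_basic[OF es(7)] by auto
      then show False using linear[of e f v w] es f v by auto
    next
      case True
      have "butlast es = take (length es - 1) es" by (simp add: butlast_conv_take)
      moreover have "1 \<le> length es - 1" using True es(1) by simp
      ultimately have "walk v (butlast es)" using walk_take[OF less.prems(1), of "length es - 1"] by simp
      moreover have "length (butlast es) < length es" "2 \<le> length (butlast es)"
        using True by (auto simp add: es(1))
      ultimately have "v \<notin> last (butlast es)" using less.hyps by blast
      then have yv: "y \<noteq> v" using y by auto
      have "w \<notin> last es'" using less.hyps[of es' w] es(7) True by (simp add: es(1))
      then have "last es \<noteq> e" using es(1,4) ne by auto
      then have "((v, e), (y, last es)) \<in> child"
        using es(2,3) lastE y(1) v yv by (simp add: child_def)
      with y(3) have "((v, e), (v, e)) \<in> child\<^sup>+" using es(1) by (simp add: trancl_into_trancl2)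
      then show False using wf_acyclic[OF wf_child] by (auto simp: acyclic_def)
    qed
  qed
qed

lemma walk_start_notin:
  assumes "walk v es" "1 \<le> j" "j < length es"
  shows "v \<notin> es ! j"
proof -
  have "walk v (take (Suc j) es)" using walk_take[OF assms(1)] by simp
  then have "v \<notin> last (take (Suc j) es)" using walk_not_closed assms by simp
  then show ?thesis using assms by (simp add: take_Suc_conv_app_nth)
qed

lemma walk_start_unique:
  assumes "walk v es" "e \<in> set es" "v \<in> e"
  shows "e = hd es"
proof -
  obtain j where "j < length es" "e = es ! j" using assms by (metis in_set_conv_nth)
  then show ?thesis using walk_start_notin[OF assms(1), of j] assms walk_basic(1)[OF assms(1)]
    by (cases j) (auto simp: hd_conv_nth)
qed

lemma walk_hyper_path: "walk v es \<Longrightarrow> hyper_path r es"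
proof (induction rule: walk.induct)
  case (single e v)
  then show ?case using card_edge finite_edge by (auto simp: hyper_path_def)
next
  case (step e v w es)
  note basic = walk_basic[OF \<open>walk w es\<close>]
  have e0: "e \<inter> es ! 0 = {w}"
    using linear[of e "es ! 0" w] basic step by (auto simp: hd_conv_nth)
  have ej: "e \<inter> es ! j = {}" if j: "1 \<le> j" "j < length es" for j
  proof (rule ccontr)
    assume "e \<inter> es ! j \<noteq> {}"
    then obtain x where x: "x \<in> e" "x \<in> es ! j" by auto
    show False
    proof (cases "x = w")
      case True
      then show False using walk_start_notin[OF \<open>walk w es\<close> j] x by simp
    next
      case False
      \<comment> \<open>Any vertex of the first edge other than the exit may serve as the start, so
        a common vertex \<open>x\<close> yields a walk that returns to its own start.\<close>
      then have "walk x (e # es)" using step x by (intro walk.step[of e x w]) auto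
      then show False using walk_start_notin[of x "e # es" "Suc j"] x j by simp
    qed
  qed
  show ?case unfolding hyper_path_def
  proof (intro conjI allI impI)
    have "set (e # es) \<subseteq> E" using basic(2) step.hyps(1) by simp
    then show "\<forall>f\<in>set (e # es). finite f \<and> card f = r" using card_edge finite_edge by blast
    show "card ((e # es) ! i \<inter> (e # es) ! Suc i) = 1" if "Suc i < length (e # es)" for i
      using that e0 step.IH by (cases i) (auto simp: hyper_path_def)
    show "(e # es) ! i \<inter> (e # es) ! j = {}" if "i + 2 \<le> j \<and> j < length (e # es)" for i j
    proof (cases i)
      case 0
      then show ?thesis using that ej[of "j - 1"] by (cases j) auto
    next
      case (Suc m)
      then show ?thesis using that step.IH by (cases j) (auto simp: hyper_path_def)
    qed
  qed simp
qed

text \<open>Only the last edge of a chain, entered at \<open>y\<close>, may branch.\<close>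

inductive chain :: "'a \<Rightarrow> 'a set list \<Rightarrow> 'a \<Rightarrow> bool" where
  single: "\<lbrakk>e \<in> E; v \<in> e\<rbrakk> \<Longrightarrow> chain v [e] v"
| step: "\<lbrakk>e \<in> E; v \<in> e; w \<in> e; w \<noteq> v; hd es \<noteq> e; inc w = {e, hd es}; nonleaf e \<subseteq> {v, w};
    chain w es y\<rbrakk> \<Longrightarrow> chain v (e # es) y"

definition pendant :: "'a \<Rightarrow> 'a set list \<Rightarrow> bool" where
  "pendant v es \<longleftrightarrow> (\<exists>y. chain v es y \<and> nonleaf (last es) \<subseteq> {y})"

lemma chain_walk: "chain v es y \<Longrightarrow> walk v es"
  by (induction rule: chain.induct) (auto intro: walk.intros)

lemma chain_ne: "chain v es y \<Longrightarrow> es \<noteq> []"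
  by (induction rule: chain.induct) auto

lemma chain_last: assumes "chain v es y" shows "y \<in> last es" "last es \<in> E"
  using assms by (induction rule: chain.induct) (auto dest: chain_ne)

lemma pendant_walk: "pendant v es \<Longrightarrow> walk v es"
  by (auto simp: pendant_def chain_walk)

lemma chain_append:
  assumes "chain v es y" "a \<in> last es" "a \<noteq> y" "walk a fs" "hd fs \<noteq> last es"
  shows "walk v (es @ fs)"
  using assms
proof (induction rule: chain.induct)
  case (single e v)
  then show ?case by (auto intro: walk.step[of e v a])
next
  case (step e v w es y)
  have "es \<noteq> []" using chain_ne[OF \<open>chain w es y\<close>] .
  then have "walk w (es @ fs)" "hd (es @ fs) = hd es" using step by auto
  then show ?case using step by (auto intro!: walk.step[of e v w])
qed

text \<open>These are the vertices whose incident edges the chain exhausts. The start may have edges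
  elsewhere, and so may the exits of the last edge.\<close>

lemma chain_inc:
  assumes "chain v es y" "u \<in> \<Union>(set es)" "u \<noteq> v" "u \<in> nonleaf (last es) \<longrightarrow> u = y"
  shows "inc u \<subseteq> set es"
  using assms
proof (induction rule: chain.induct)
  case (single e v)
  then have "u \<in> e" "u \<notin> nonleaf e" by auto
  then show ?case by (simp add: nonleaf_def)
next
  case (step e v w es y)
  have ne: "es \<noteq> []" using chain_ne[OF \<open>chain w es y\<close>] .
  show ?case
  proof (cases "u = w")
    case True
    then show ?thesis using step ne by auto
  next
    case uw: False
    show ?thesis
    proof (cases "u \<in> \<Union>(set es)")
      case True
      then have "inc u \<subseteq> set es" using step uw ne by auto
      then show ?thesis by auto
    next
      case False
      then have "u \<in> e" "u \<notin> nonleaf e" using step uw by auto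
      then show ?thesis by (simp add: nonleaf_def)
    qed
  qed
qed

lemma pendant_inc:
  assumes "pendant v es" "u \<in> \<Union>(set es)" "u \<noteq> v"
  shows "inc u \<subseteq> set es"
proof -
  obtain y where "chain v es y" "nonleaf (last es) \<subseteq> {y}" using assms(1) by (auto simp: pendant_def)
  then show ?thesis using chain_inc[of v es y u] assms(2,3) by blast
qed

lemma chain_prev:
  assumes "chain v es y"
  shows "length es = 1 \<and> y = v \<or> length es \<ge> 2 \<and> y \<in> es ! (length es - 2)"
  using assms
proof (induction rule: chain.induct)
  case (step e v w es y)
  then show ?case using chain_walk[OF \<open>chain w es y\<close>] walk_basic(1)
    by (auto simp: nth_Cons split: nat.splits)
      (metis Suc_diff_Suc diff_Suc_Suc diff_zero lessI numeral_2_eq_2 Suc_le_lessD le_numeral_extra(4) not_less_eq_eq)+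
qed simp

subsection \<open>Labels along chains\<close>

lemma B_plain:
  assumes "e \<in> E" "v \<in> e" "w \<in> e" "w \<noteq> v" "f \<noteq> e" "inc w = {e, f}" "nonleaf e \<subseteq> {v, w}"
  shows "B v e * (1 - B w f) = 1/4" "B w f < 1"
proof -
  have 1: "B v e * B w e = 1/4" using B_prod_nonleaf[of e "{v, w}"] assms by simp
  have "B w e + B w f = 1" using B_sum_inc[of e w] assms by simp
  then have 2: "B w e = 1 - B w f" by simp
  show "B v e * (1 - B w f) = 1/4" using 1 unfolding 2 .
  show "B w f < 1" using 2 B_pos[of e w] assms by simp
qed

text \<open>In the coordinate \<open>t\<close> the label 1/4 is 2, and each further edge adds 1, so
  the top has \<open>t = length es + 1\<close>.\<close>

lemma chain_B_end:
  assumes "chain v es y" "B y (last es) = 1/4"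
  shows "B v (hd es) = length es / (2 * (length es + 1))"
  using assms
proof (induction rule: chain.induct)
  case (step e v w es y)
  have ne: "es \<noteq> []" using chain_ne[OF \<open>chain w es y\<close>] .
  define n where "n = real (length es)"
  have n: "n \<ge> 1" using ne by (cases es) (auto simp: n_def)
  have "B w (hd es) = n / (2 * (n + 1))" using step ne by (simp add: n_def)
  then have b: "1 - B w (hd es) = (n + 2) / (2 * (n + 1))" using n by (simp add: field_simps)
  have "B v e * (1 - B w (hd es)) = 1/4" using B_plain(1)[of e v w "hd es"] step.hyps by simp
  then have "B v e * ((n + 2) / (2 * (n + 1))) = 1/4" unfolding b .
  then have "B v e = (n + 1) / (2 * (n + 2))" using n by (simp add: field_simps)
  then show ?case by (simp add: n_def add.commute add.left_commute)
qed simp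

text \<open>The hypothesis is \<open>t = - c\<close>. Read downwards, \<open>t\<close> drops by 1 at
  each junction, so \<open>c\<close> grows by \<open>length es - 1\<close> and the label stays above
  1/2.\<close>

lemma chain_B_down:
  assumes "chain v es y" "c > 0" "B v (hd es) = (c + 1) / (2 * c)"
  shows "B y (last es) = (c + length es) / (2 * (c + length es - 1))"
  using assms
proof (induction arbitrary: c rule: chain.induct)
  case (step e v w es y)
  have ne: "es \<noteq> []" using chain_ne[OF \<open>chain w es y\<close>] .
  have b: "B v e = (c + 1) / (2 * c)" using step.prems by simp
  have "B v e * (1 - B w (hd es)) = 1/4" using B_plain(1)[of e v w "hd es"] step.hyps by simp
  then have "(c + 1) / (2 * c) * (1 - B w (hd es)) = 1/4" unfolding b .
  then have "B w (hd es) = (c + 1 + 1) / (2 * (c + 1))" using step.prems(1) by (simp add: field_simps)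
  then have "B y (last es) = (c + 1 + length es) / (2 * (c + 1 + length es - 1))"
    using step.IH[of "c + 1"] step.prems(1) by simp
  then show ?case using ne by (simp add: algebra_simps)
qed simp

lemma chain_B_half:
  assumes "chain v es y" "B v (hd es) = 1/2"
  shows "B y (last es) = 1/2"
  using assms
proof (induction rule: chain.induct)
  case (step e v w es y)
  have ne: "es \<noteq> []" using chain_ne[OF \<open>chain w es y\<close>] .
  have b: "B v e = 1/2" using step.prems by simp
  have "B v e * (1 - B w (hd es)) = 1/4" using B_plain(1)[of e v w "hd es"] step.hyps by simp
  then have "B w (hd es) = 1/2" unfolding b by simp
  then show ?case using step.IH ne by simp
qed simp

text \<open>The fixed point of \<open>p \<mapsto> 1 / (4 * (1 - p))\<close> is \<open>1/2\<close>, so labels below it increase up the chain and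
  labels above it stay above it.\<close>

lemma chain_B_mono:
  assumes "chain v es y" "t \<le> 1/2" "t \<le> B y (last es)"
  shows "t \<le> B v (hd es)"
  using assms
proof (induction rule: chain.induct)
  case (step e v w es y)
  have ne: "es \<noteq> []" using chain_ne[OF \<open>chain w es y\<close>] .
  define p where "p = B w (hd es)"
  have p: "t \<le> p" using step ne by (simp add: p_def)
  have eq: "B v e * (1 - p) = 1/4"
    using B_plain[of e v w "hd es"] step unfolding p_def by auto
  have b: "B v e > 0" using step B_pos by auto
  have "t * (1 - t) \<le> 1/4" using zero_le_power2[of "t - 1/2"] by (simp add: power2_eq_square algebra_simps)
  also have "1/4 \<le> B v e * (1 - t)" using eq p b by (metis diff_left_mono less_imp_le mult_left_mono)
  finally have "t \<le> B v e" using step.prems by (simp add: mult_le_cancel_right)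
  then show ?case by simp
qed simp

section \<open>How maximal chains end\<close>

text \<open>Exactly the condition under which \<open>chain.step\<close> applies to \<open>f\<close>
  entered at \<open>y\<close>; its failure marks the end of a maximal chain.\<close>

definition plain :: "'a \<Rightarrow> 'a set \<Rightarrow> bool" where
  "plain y f \<longleftrightarrow> (\<exists>w g. w \<in> f \<and> w \<noteq> y \<and> g \<noteq> f \<and> inc w = {f, g} \<and> nonleaf f \<subseteq> {y, w})"

lemma inc_pair: assumes "f \<in> E" "inc w = {f, g}" shows "g \<in> E" "w \<in> g" "w \<in> f"
  using assms in_inc[of g w] in_inc[of f w] by blast+

text \<open>Extending a chain passes to a child flag, so well-foundedness stops the extension at an
  edge that is not plain.\<close>

lemma ex_chain:
  assumes "e \<in> E" "v \<in> e"
  shows "\<exists>es y. chain v es y \<and> hd es = e \<and> \<not> plain y (last es)"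
proof -
  have "fst p \<in> snd p \<Longrightarrow> snd p \<in> E \<Longrightarrow>
      \<exists>es y. chain (fst p) es y \<and> hd es = snd p \<and> \<not> plain y (last es)" for p
    using wf_child
  proof (induction p rule: wf_induct_rule)
    case (less p)
    obtain v e where p: "p = (v, e)" by (cases p)
    show ?case
    proof (cases "plain v e")
      case False
      then show ?thesis using less.prems p by (intro exI[of _ "[e]"] exI[of _ v]) (auto intro: chain.single)
    next
      case True
      then obtain w g where w: "w \<in> e" "w \<noteq> v" "g \<noteq> e" "inc w = {e, g}" "nonleaf e \<subseteq> {v, w}"
        unfolding plain_def by blast
      have g: "g \<in> E" "w \<in> g" using inc_pair[OF _ w(4)] less.prems p by auto
      then have "((w, g), p) \<in> child" using w less.prems p by (auto simp: child_def)
      from less.IH[OF this] g obtain es y where es: "chain w es y" "hd es = g" "\<not> plain y (last es)"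
        by auto
      then have "chain v (e # es) y" using w less.prems p by (intro chain.step[of e v w]) auto
      then show ?thesis using es chain_ne[OF es(1)] p
        by (intro exI[of _ "e # es"] exI[of _ y]) auto
    qed
  qed
  from this[of "(v, e)"] show ?thesis using assms by simp
qed

text \<open>If \<open>f\<close> has exactly one exit \<open>a\<close>, then \<open>a\<close> lies in
  a second edge, and with only two edges there \<open>f\<close> would be plain. So the branching
  happens at a vertex of degree at least 3 or inside the edge.\<close>

lemma not_plain_cases:
  assumes "f \<in> E" "\<not> plain y f"
  obtains (leaf) "nonleaf f \<subseteq> {y}"
    | (vertex) a g h where "a \<in> f" "a \<noteq> y" "nonleaf f \<subseteq> {y, a}" "{f, g, h} \<subseteq> inc a" "distinct [f, g, h]"
    | (edge) a b where "a \<in> nonleaf f" "b \<in> nonleaf f" "distinct [y, a, b]"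
proof (cases "nonleaf f \<subseteq> {y}")
  case True
  then show ?thesis by (rule leaf)
next
  case False
  then obtain a where a: "a \<in> nonleaf f" "a \<noteq> y" by blast
  then have af: "a \<in> f" "inc a \<noteq> {f}" by (auto simp: nonleaf_def)
  show ?thesis
  proof (cases "nonleaf f \<subseteq> {y, a}")
    case True
    obtain g where g: "g \<in> inc a" "g \<noteq> f" using inc_other[OF assms(1) af] by blast
    have "inc a \<noteq> {f, g}" using assms(2) True a af g unfolding plain_def by blast
    moreover have "{f, g} \<subseteq> inc a" using g af assms(1) by simp
    ultimately obtain h where "h \<in> inc a" "h \<notin> {f, g}" by blast
    then show ?thesis using vertex[of a g h] a af g True \<open>{f, g} \<subseteq> inc a\<close> by auto
  next
    case False
    then obtain b where "b \<in> nonleaf f" "b \<noteq> y" "b \<noteq> a" by blast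
    then show ?thesis using edge[of a b] a by auto
  qed
qed

text \<open>All other labels in the edge must be 1, while nonleaf ones are at most 3/4.\<close>

lemma B_quarter:
  assumes "e \<in> E" "v \<in> e" "B v e = 1/4"
  shows "nonleaf e \<subseteq> {v}"
proof
  fix u assume u: "u \<in> nonleaf e"
  show "u \<in> {v}"
  proof (rule ccontr)
    assume "u \<notin> {v}"
    then have "1/4 \<le> B v e * B u e" using assms u by (intro B_prod2) (auto simp: nonleaf_def)
    then show False using assms B_le_34[OF assms(1) u] by simp
  qed
qed

lemma pendant_single: "\<lbrakk>e \<in> E; v \<in> e; nonleaf e \<subseteq> {v}\<rbrakk> \<Longrightarrow> pendant v [e]"
  by (auto simp: pendant_def intro!: exI[of _ v] chain.single)

lemma pendant_step:
  assumes "e \<in> E" "v \<in> e" "w \<in> e" "w \<noteq> v" "hd es \<noteq> e" "inc w = {e, hd es}" "nonleaf e \<subseteq> {v, w}"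
    "pendant w es"
  shows "pendant v (e # es)"
proof -
  obtain y where y: "chain w es y" "nonleaf (last es) \<subseteq> {y}" using assms(8) by (auto simp: pendant_def)
  then have "chain v (e # es) y" using assms by (intro chain.step[of e v w]) auto
  then show ?thesis using y chain_ne[OF y(1)] by (auto simp: pendant_def)
qed

lemma pendant_B:
  assumes "pendant v es"
  shows "B v (hd es) = length es / (2 * (length es + 1))" "length es \<ge> 1"
proof -
  obtain y where y: "chain v es y" "nonleaf (last es) \<subseteq> {y}" using assms by (auto simp: pendant_def)
  have "B y (last es) = 1/4" using B_prod_nonleaf[of "last es" "{y}"] chain_last[OF y(1)] y(2) by simp
  then show "B v (hd es) = length es / (2 * (length es + 1))" using chain_B_end[OF y(1)] by simp
  show "length es \<ge> 1" using chain_ne[OF y(1)] by (cases es) auto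
qed

text \<open>Follow the maximal chain. At a branching vertex two other edges leave at most 1/2 for
  \<open>a\<close>, so the entry label is at least 1/2; at a branching edge it is at least (1/4) /
  (3/4)^2 = 4/9. As 4/9 is below 1/2, \<open>chain_B_mono\<close> carries this bound to the top. The
  alternatives overlap: long pendant paths also reach 4/9.\<close>

lemma flag_dichotomy:
  assumes "e \<in> E" "v \<in> e"
  shows "(\<exists>es. pendant v es \<and> hd es = e) \<or> B v e \<ge> 4/9"
proof -
  obtain es y where es: "chain v es y" "hd es = e" "\<not> plain y (last es)" using ex_chain[OF assms] by blast
  note l = chain_last[OF es(1)]
  from l(2) es(3) show ?thesis
  proof (cases rule: not_plain_cases)
    case leaf
    then show ?thesis using es by (auto simp: pendant_def)
  next
    case (vertex a g h)
    let ?f = "last es"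
    have E: "?f \<in> E" "g \<in> E" "h \<in> E" "a \<in> g" "a \<in> h" using vertex(4) by (auto simp del: last.simps)
    have "B a ?f + (B a g + B a h) \<le> 1" using B_sum_subset[OF E(2,4) vertex(4)] vertex(5) by simp
    then have "B a ?f \<le> 1/2" using B_ge[OF E(2,4)] B_ge[OF E(3,5)] by simp
    moreover have "B y ?f * B a ?f = 1/4" using B_prod_nonleaf[of ?f "{y, a}"] vertex l by simp
    moreover have "B y ?f > 0" using B_pos l by simp
    ultimately have "1/4 \<le> B y ?f * (1/2)" by (metis less_imp_le mult_left_mono)
    then have "4/9 \<le> B y ?f" by simp
    then show ?thesis using chain_B_mono[OF es(1), of "4/9"] es by simp
  next
    case (edge a b)
    let ?f = "last es"
    have ab: "a \<in> ?f" "b \<in> ?f" using edge by (auto simp: nonleaf_def)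
    have "1/4 \<le> B y ?f * (B a ?f * B b ?f)" using edge l ab by (intro B_prod3) auto
    also have "\<dots> \<le> B y ?f * (3/4 * (3/4))"
      using B_le_34[OF l(2)] edge B_pos[OF l(2)] l ab by (intro mult_left_mono mult_mono) (auto intro: less_imp_le)
    finally have "4/9 \<le> B y ?f" by simp
    then show ?thesis using chain_B_mono[OF es(1), of "4/9"] es by simp
  qed
qed

text \<open>Less than 1/2 is left at \<open>a\<close>, which is too little for two other edges with
  at least 1/4 each.\<close>

lemma nonleaf_B_ge_half:
  assumes "f \<in> E" "a \<in> nonleaf f" "B a f > 1/2"
  shows "\<exists>g. g \<in> E \<and> a \<in> g \<and> inc a = {f, g} \<and> g \<noteq> f \<and> B a g = 1 - B a f"
proof -
  have af: "a \<in> f" "inc a \<noteq> {f}" using assms(2) by (auto simp: nonleaf_def)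
  obtain g where g: "g \<in> inc a" "g \<noteq> f" using inc_other[OF assms(1) af] by blast
  have inc: "inc a = {f, g}"
  proof (rule ccontr)
    assume "inc a \<noteq> {f, g}"
    moreover have sub: "{f, g} \<subseteq> inc a" using g af assms(1) by simp
    ultimately obtain h where h: "h \<in> inc a" "h \<notin> {f, g}" by blast
    then have "h \<noteq> f" "h \<noteq> g" "{f, g, h} \<subseteq> inc a" using sub by blast+
    then have "B a f + (B a g + B a h) \<le> 1"
      using B_sum_subset[OF assms(1) af(1), of "{f, g, h}"] g(2) by simp
    then show False using assms(3) B_ge[of g a] B_ge[of h a] g h by simp
  qed
  have "B a f + B a g = 1" using B_sum_inc[OF assms(1) af(1)] g(2) unfolding inc by simp
  then have "B a g = 1 - B a f" by simp
  moreover have "g \<in> E" "a \<in> g" using g by simp_all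
  ultimately show ?thesis using inc g(2) by blast
qed

text \<open>The threshold is 5/9 = 1 - 4/9: the remaining edge at \<open>a\<close> has label below
  4/9, so by \<open>flag_dichotomy\<close> it starts a pendant path.\<close>

lemma nonleaf_B_pendant:
  assumes "f \<in> E" "a \<in> nonleaf f" "B a f > 5/9"
  obtains p where "pendant a p" "inc a = {f, hd p}" "hd p \<noteq> f"
    "B a f = (length p + 2) / (2 * (length p + 1))" "length p \<ge> 1"
proof -
  obtain g where g: "g \<in> E" "a \<in> g" "inc a = {f, g}" "g \<noteq> f" "B a g = 1 - B a f"
    using nonleaf_B_ge_half[OF assms(1,2)] assms(3) by auto
  then obtain p where p: "pendant a p" "hd p = g" using flag_dichotomy[OF g(1,2)] assms(3) by auto
  have "B a f = 1 - B a g" using g(5) by simp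
  also have "B a g = length p / (2 * (length p + 1))" using pendant_B(1)[OF p(1)] p(2) by simp
  also have "1 - \<dots> = (length p + 2) / (2 * (length p + 1))" by (simp add: field_simps)
  finally show thesis using that[OF p(1)] p(2) g(3,4) pendant_B(2)[OF p(1)] by simp
qed

text \<open>Above 5/9 the only values are \<open>(k + 2) / (2 * (k + 1))\<close>, that is 3/4, 2/3,
  5/8 and so on. The gap below 3/4 settles most of the products later.\<close>

lemma nonleaf_B_cases:
  assumes "f \<in> E" "a \<in> nonleaf f"
  shows "B a f = 3/4 \<or> B a f \<le> 2/3"
proof (rule ccontr)
  assume *: "\<not> ?thesis"
  then have "B a f > 5/9" by simp
  then obtain p where "pendant a p" "inc a = {f, hd p}" "hd p \<noteq> f"
      and p: "B a f = (length p + 2) / (2 * (length p + 1))" "length p \<ge> 1"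
    by (rule nonleaf_B_pendant[OF assms])
  show False
  proof (cases "length p = 1")
    case True
    have "B a f = 3/4" unfolding p(1) True by simp
    with * show False by blast
  next
    case False
    then have "2 \<le> real (length p)" using p(2) by linarith
    then have "real (length p + 2) / real (2 * (length p + 1)) \<le> 2/3" by (simp add: divide_le_eq)
    with * p(1) show False by linarith
  qed
qed

subsection \<open>Attaching pendant paths\<close>

text \<open>Connectedness of a subfamily in cut form: every proper nonempty part meets its
  complement. Unlike \<open>conn\<close> it speaks about \<open>S\<close> alone, so it applies to
  the partial hypergraphs that arise while paths are attached.\<close>

definition connected_edges :: "'a set set \<Rightarrow> bool" where
  "connected_edges S \<longleftrightarrow> (\<forall>Q. Q \<subseteq> S \<and> Q \<noteq> {} \<and> Q \<noteq> S \<longrightarrow> (\<exists>g\<in>Q. \<exists>h\<in>S - Q. g \<inter> h \<noteq> {}))"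

lemma connected_edges_Un:
  assumes "connected_edges S" "connected_edges T" "a \<in> S" "b \<in> T" "a \<inter> b \<noteq> {}"
  shows "connected_edges (S \<union> T)"
  unfolding connected_edges_def
proof (intro allI impI)
  fix Q assume Q: "Q \<subseteq> S \<union> T \<and> Q \<noteq> {} \<and> Q \<noteq> S \<union> T"
  consider "Q \<inter> S \<noteq> {}" "Q \<inter> S \<noteq> S" | "Q \<inter> T \<noteq> {}" "Q \<inter> T \<noteq> T"
    | "Q \<inter> S = S" "Q \<inter> T = {}" | "Q \<inter> S = {}" "Q \<inter> T = T" using Q by blast
  then show "\<exists>g\<in>Q. \<exists>h\<in>S \<union> T - Q. g \<inter> h \<noteq> {}"
  proof cases
    case 1
    then obtain g h where "g \<in> Q \<inter> S" "h \<in> S - Q \<inter> S" "g \<inter> h \<noteq> {}"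
      using assms(1) unfolding connected_edges_def by (metis Int_lower2)
    then show ?thesis by blast
  next
    case 2
    then obtain g h where "g \<in> Q \<inter> T" "h \<in> T - Q \<inter> T" "g \<inter> h \<noteq> {}"
      using assms(2) unfolding connected_edges_def by (metis Int_lower2)
    then show ?thesis by blast
  next
    case 3
    then have "a \<in> Q" "b \<in> S \<union> T - Q" using assms(3,4) by blast+
    then show ?thesis using assms(5) by blast
  next
    case 4
    then have "b \<in> Q" "a \<in> S \<union> T - Q" using assms(3,4) by blast+
    then show ?thesis using assms(5) by blast
  qed
qed

lemma connected_edges_single [simp]: "connected_edges {e}"
  unfolding connected_edges_def by blast

lemma connected_edges_walk: "walk v es \<Longrightarrow> connected_edges (set es)"
proof (induction rule: walk.induct)
  case (step e v w es)
  have "hd es \<in> set es" "e \<inter> hd es \<noteq> {}"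
    using walk_basic[OF \<open>walk w es\<close>] step by auto
  then show ?case using connected_edges_Un[of "{e}" "set es" e "hd es"] step.IH by simp
qed simp

abbreviation sub :: "'a set set \<Rightarrow> 'a hypergraph" where
  "sub S \<equiv> Hypergraph (\<Union>S) S"

text \<open>If \<open>S\<close> met the path without being inside it, the cut property would give an
  edge of the path meeting an edge outside it. The common vertex cannot be an inner one by
  \<open>pendant_inc\<close>, and at \<open>v\<close> the path has only its first edge, which is not
  in \<open>S\<close>.\<close>

lemma pendant_disjoint:
  assumes "pendant v es" "S \<subseteq> E" "connected_edges S" "v \<in> \<Union>S" "hd es \<notin> S"
  shows "S \<inter> set es = {}"
proof (rule ccontr)
  note w = pendant_walk[OF assms(1)]
  assume ne: "S \<inter> set es \<noteq> {}"
  obtain h where h: "h \<in> S" "v \<in> h" using assms(4) by blast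
  then have "h \<notin> set es" using walk_start_unique[OF w] assms(5) by blast
  then have "S \<inter> set es \<noteq> S" using h by blast
  then obtain g k where gk: "g \<in> S \<inter> set es" "k \<in> S - S \<inter> set es" "g \<inter> k \<noteq> {}"
    using assms(3) ne unfolding connected_edges_def by (metis Int_lower1)
  then obtain x where x: "x \<in> g" "x \<in> k" by blast
  show False
  proof (cases "x = v")
    case True
    then show False using walk_start_unique[OF w, of g] gk x assms(5) by blast
  next
    case False
    then have "inc x \<subseteq> set es" using pendant_inc[OF assms(1), of x] gk x by blast
    moreover have "k \<in> inc x" using gk x assms(2) by auto
    ultimately show False using gk by blast
  qed
qed

lemma attach_pendant:
  assumes "pendant v es" "S \<subseteq> E" "connected_edges S" "v \<in> \<Union>S" "hd es \<notin> S"
  shows "attach r (length es) v (sub S) (sub (S \<union> set es))"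
  unfolding attach_def
proof (intro exI[of _ es] conjI)
  note w = pendant_walk[OF assms(1)]
  note basic = walk_basic[OF w]
  show "hyper_path r es" using walk_hyper_path[OF w] .
  show "v \<in> es ! 0" using basic by (simp add: hd_conv_nth)
  show "\<forall>j. 1 \<le> j \<and> j < length es \<longrightarrow> v \<notin> es ! j" using walk_start_notin[OF w] by blast
  show "(\<Union> (set es) - {v}) \<inter> verts (sub S) = {}"
  proof (rule ccontr)
    assume "\<not> ?thesis"
    then obtain x k where x: "x \<in> \<Union> (set es)" "x \<noteq> v" "k \<in> S" "x \<in> k" by auto
    then have "inc x \<subseteq> set es" "k \<in> inc x" using pendant_inc[OF assms(1)] assms(2) by auto
    then show False using pendant_disjoint[OF assms] x by blast
  qed
qed (use assms(4) in auto)

text \<open>A list of attachments, so that one result serves the families built with two, three or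
  four of them.\<close>

fun attaches :: "'a hypergraph \<Rightarrow> ('a \<times> 'a set list) list \<Rightarrow> 'a hypergraph \<Rightarrow> bool" where
  "attaches H [] K \<longleftrightarrow> H = K"
| "attaches H ((v, es) # ps) K \<longleftrightarrow> (\<exists>H'. attach r (length es) v H H' \<and> attaches H' ps K)"

text \<open>The core \<open>S\<close> grows by one path at a time. Distinct starting flags guarantee
  that the remaining paths do not begin inside what has already been attached.\<close>

lemma attaches_pendants:
  assumes "S \<subseteq> E" "connected_edges S"
    and "\<And>v es. (v, es) \<in> set ps \<Longrightarrow> pendant v es \<and> v \<in> \<Union>S \<and> hd es \<notin> S"
    and "distinct (map (\<lambda>(v, es). (v, hd es)) ps)"
  shows "attaches (sub S) ps (sub (S \<union> (\<Union>(v, es)\<in>set ps. set es)))"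
  using assms
proof (induction ps arbitrary: S)
  case (Cons p ps)
  obtain v es where p: "p = (v, es)" by (cases p)
  have v: "pendant v es" "v \<in> \<Union>S" "hd es \<notin> S" using Cons.prems(3) p by auto
  note basic = walk_basic[OF pendant_walk[OF v(1)]]
  let ?S = "S \<union> set es"
  have disj: "S \<inter> set es = {}" using pendant_disjoint[OF v(1) Cons.prems(1,2) v(2,3)] .
  have "attach r (length es) v (sub S) (sub ?S)"
    using attach_pendant[OF v(1) Cons.prems(1,2) v(2,3)] .
  moreover have "attaches (sub ?S) ps (sub (?S \<union> (\<Union>(v, es)\<in>set ps. set es)))"
  proof (rule Cons.IH)
    show "?S \<subseteq> E" using Cons.prems(1) basic by simp
    obtain h where "h \<in> S" "v \<in> h" using v(2) by blast
    then show "connected_edges ?S"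
      using connected_edges_Un[OF Cons.prems(2) connected_edges_walk[OF pendant_walk[OF v(1)]], of h "hd es"]
        basic by auto
    show "distinct (map (\<lambda>(v, es). (v, hd es)) ps)" using Cons.prems(4) by simp
    fix u fs assume u: "(u, fs) \<in> set ps"
    then have u': "pendant u fs" "u \<in> \<Union>S" "hd fs \<notin> S" using Cons.prems(3) by auto
    note basic' = walk_basic[OF pendant_walk[OF u'(1)]]
    have "hd fs \<notin> set es"
    proof
      assume fs: "hd fs \<in> set es"
      show False
      proof (cases "u = v")
        case True
        then have "hd fs = hd es"
          using walk_start_unique[OF pendant_walk[OF v(1)] fs] basic'(3) by simp
        then have "(v, hd es) \<in> (\<lambda>(v, es). (v, hd es)) ` set ps"
          using True u by (force intro: rev_image_eqI)
        then show False using Cons.prems(4) p by simp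
      next
        case False
        then have "inc u \<subseteq> set es" using pendant_inc[OF v(1), of u] fs basic'(3) by blast
        moreover obtain k where "k \<in> S" "u \<in> k" using u'(2) by blast
        moreover then have "k \<in> inc u" using Cons.prems(1) by auto
        ultimately show False using disj by blast
      qed
    qed
    then show "pendant u fs \<and> u \<in> \<Union>?S \<and> hd fs \<notin> ?S" using u' by auto
  qed
  ultimately show ?case using p by (auto simp: Un_assoc)
qed simp

text \<open>The closure hypothesis says that nothing but the listed paths leaves the core. Inner
  vertices of pendant paths have no other edges, so core and paths together are closed under
  intersection and exhaust \<open>E\<close>.\<close>

lemma attaches_all:
  assumes "S \<subseteq> E" "S \<noteq> {}" "connected_edges S"
    and ps: "\<And>v es. (v, es) \<in> set ps \<Longrightarrow> pendant v es \<and> v \<in> \<Union>S \<and> hd es \<notin> S"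
    and "distinct (map (\<lambda>(v, es). (v, hd es)) ps)"
    and closed: "\<And>u. u \<in> \<Union>S \<Longrightarrow> inc u \<subseteq> S \<union> (hd \<circ> snd) ` set ps"
  shows "attaches (sub S) ps (Hypergraph V E)"
proof -
  let ?T = "S \<union> (\<Union>(v, es)\<in>set ps. set es)"
  have hds: "(hd \<circ> snd) ` set ps \<subseteq> ?T"
    using ps walk_basic(1)[OF pendant_walk] by (force intro!: bexI hd_in_set)
  have sub: "?T \<subseteq> E" using assms(1) ps walk_basic(2)[OF pendant_walk] by blast
  have "?T = E"
  proof (rule conn)
    fix e f assume ef: "e \<in> ?T" "f \<in> E" "e \<inter> f \<noteq> {}"
    then obtain x where x: "x \<in> e" "x \<in> f" by blast
    then have f: "f \<in> inc x" using ef by simp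
    show "f \<in> ?T"
    proof (cases "x \<in> \<Union>S")
      case True
      then show ?thesis using closed[OF True] hds f by blast
    next
      case False
      then obtain v es where es: "(v, es) \<in> set ps" "e \<in> set es" using ef x by blast
      then have "x \<noteq> v" using ps False by blast
      then have "inc x \<subseteq> set es" using pendant_inc[of v es x] ps[OF es(1)] es x by blast
      then show ?thesis using f es by blast
    qed
  qed (use sub assms(2) in blast)+
  then show ?thesis using attaches_pendants[OF assms(1,3) ps assms(5)] V_eq by simp
qed

section \<open>Recognising the families\<close>

lemma edge3: "\<lbrakk>r = 3; f \<in> E; y \<in> f; a \<in> f; b \<in> f; distinct [y, a, b]\<rbrakk> \<Longrightarrow> f = {y, a, b}"
  using card_edge[of f] finite_edge[of f] card_subset_eq[of f "{y, a, b}"] by auto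

lemma inc_memD: "inc v = S \<Longrightarrow> e \<in> S \<Longrightarrow> e \<in> E \<and> v \<in> e"
  by (auto simp: inc_def)

lemma ex_other_vertex: assumes "e \<in> E" shows "\<exists>x\<in>e. x \<noteq> v"
proof (rule ccontr)
  assume "\<not> ?thesis"
  then have "e \<subseteq> {v}" by blast
  then have "card e \<le> card {v}" by (intro card_mono) auto
  then show False using card_edge[OF assms] r_ge by simp
qed

text \<open>The penultimate edge meets the last one only in \<open>y\<close> by linearity, and all
  earlier edges are disjoint from it.\<close>

lemma walk_end_unique:
  assumes "walk x L" "length L \<ge> 2" "y \<in> L ! (length L - 2)" "y \<in> last L" "u \<in> last L" "u \<noteq> y"
    and g: "g \<in> set L" "u \<in> g"
  shows "g = last L"
proof -
  let ?n = "length L"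
  have hp: "hyper_path r L" using walk_hyper_path[OF assms(1)] .
  have L: "last L = L ! (?n - 1)" using assms(2) by (intro last_conv_nth) auto
  obtain j where j: "j < ?n" "g = L ! j" using g by (metis in_set_conv_nth)
  consider "j = ?n - 1" | "j = ?n - 2" | "j + 2 \<le> ?n - 1" using j assms(2) by linarith
  then show ?thesis
  proof cases
    case 1 then show ?thesis using L j by simp
  next
    case 2
    have "last L \<in> set L" using assms(2) by (intro last_in_set) auto
    then have E: "g \<in> E" "last L \<in> E" using walk_basic(2)[OF assms(1)] g by auto
    show ?thesis using linear[OF E, of u y] assms g 2 j by auto
  next
    case 3
    then have "L ! j \<inter> L ! (?n - 1) = {}" using hp assms(2) unfolding hyper_path_def by auto
    then show ?thesis using g j L assms(5) by auto
  qed
qed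

lemma chain_Cons_prev:
  assumes "chain c es y" "c \<in> e"
  shows "y \<in> (e # es) ! (length (e # es) - 2)" "length (e # es) \<ge> 2"
proof -
  have "es \<noteq> []" by (rule chain_ne[OF assms(1)])
  then show "length (e # es) \<ge> 2" by (cases es) auto
  show "y \<in> (e # es) ! (length (e # es) - 2)"
    using chain_prev[OF assms(1)]
  proof
    assume *: "2 \<le> length es \<and> y \<in> es ! (length es - 2)"
    then have "length (e # es) - 2 = Suc (length es - 2)" by (simp add: numeral_2_eq_2 Suc_diff_Suc)
    then show ?thesis using * by simp
  qed (use assms(2) in simp)
qed

text \<open>Four labels of at least 1/4 already sum to 1, so there are exactly four edges at
  \<open>v\<close>, all with label 1/4, and each is a pendant edge by
  \<open>B_quarter\<close>.\<close>

lemma S3_4_build: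
  assumes r3: "r = 3" and v: "card (inc v) \<ge> 4"
  shows "S3_4 (Hypergraph V E)"
proof -
  obtain A where A: "A \<subseteq> inc v" "card A = 4" using obtain_subset_with_card_n[OF v] by auto
  have finA: "finite A" using A finite_inc finite_subset by blast
  obtain e where e: "e \<in> inc v" using A by (metis card.empty equals0I subset_empty zero_neq_numeral)
  then have eE: "e \<in> E" "v \<in> e" by simp_all
  have ge: "B v f \<ge> 1/4" if "f \<in> inc v" for f using that B_ge by simp
  have sumA: "(\<Sum>f\<in>A. B v f) \<ge> 1"
  proof -
    have "(\<Sum>f\<in>A. 1/4) \<le> (\<Sum>f\<in>A. B v f)" using ge A by (intro sum_mono) blast
    then show ?thesis using A by simp
  qed
  have sum1: "(\<Sum>f\<in>inc v. B v f) = 1" using B_sum_inc[OF eE] .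
  have "inc v = A"
  proof (rule ccontr)
    assume "inc v \<noteq> A"
    then obtain f where f: "f \<in> inc v" "f \<notin> A" using A by blast
    then have "(\<Sum>f\<in>insert f A. B v f) \<le> 1"
      using B_sum_subset[OF eE, of "insert f A"] A by blast
    then show False using f finA sumA ge[OF f(1)] by simp
  qed
  then have c4: "card (inc v) = 4" using A by simp
  have quarter: "B v f = 1/4" if f: "f \<in> inc v" for f
  proof (rule ccontr)
    assume "B v f \<noteq> 1/4"
    then have "1/4 < B v f" using ge[OF f] by linarith
    then have "(\<Sum>f\<in>inc v. 1/4) < (\<Sum>f\<in>inc v. B v f)"
      using f ge finite_inc by (intro sum_strict_mono_ex1 bexI[of _ f] ballI) blast+
    then show False using c4 sum1 by simp
  qed
  have leafs: "inc u = {f}" if "f \<in> inc v" "u \<in> f" "u \<noteq> v" for f u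
    using B_quarter[OF _ _ quarter[OF that(1)]] that by (auto simp: nonleaf_def)
  have "inc v = E"
  proof (rule conn)
    fix f g assume fg: "f \<in> inc v" "g \<in> E" "f \<inter> g \<noteq> {}"
    then obtain x where x: "x \<in> f" "x \<in> g" by blast
    then have g: "g \<in> inc x" using fg by simp
    show "g \<in> inc v"
    proof (cases "x = v")
      case False
      then have "g = f" using g leafs[OF fg(1) x(1)] by (metis singletonD)
      then show ?thesis using fg(1) by blast
    qed (use g in blast)
  next
    show "inc v \<subseteq> E" unfolding inc_def by blast
    show "inc v \<noteq> {}" using e by blast
  qed
  then have iE: "E = inc v" by (rule sym)
  have "e \<inter> f = {v}" if "e \<in> E" "f \<in> E" "e \<noteq> f" for e f
  proof -
    have "e \<in> inc v" "f \<in> inc v" using that(1,2) iE by metis+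
    then have "v \<in> e" "v \<in> f" by simp_all
    then show ?thesis using linear[OF that(1,2)] that(3) by blast
  qed
  moreover have "card E = 4" using c4 iE by metis
  ultimately show ?thesis unfolding S3_4_def using V_eq card_edge r3 by auto
qed

lemma E3_build:
  assumes r3: "r = 3" and p: "pendant v p" "pendant v q" "pendant v s"
    and d: "distinct [hd p, hd q, hd s]" and inc: "inc v = {hd p, hd q, hd s}"
  shows "E3 (length p) (length q) (length s) (Hypergraph V E)"
proof -
  note w = pendant_walk[OF p(1)]
  note basic = walk_basic[OF w]
  have nin: "hd t \<notin> set p" if "pendant v t" "hd t \<noteq> hd p" for t
    using walk_start_unique[OF w, of "hd t"] that walk_basic(3)[OF pendant_walk[OF that(1)]] by blast
  have vp: "v \<in> \<Union>(set p)" using basic by auto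
  \<comment> \<open>The first path is attached by hand: the starting hypergraph has an isolated
    vertex, so it is not of the form \<open>sub S\<close>.\<close>
  have 1: "attach 3 (length p) v (Hypergraph {v} {}) (sub (set p))"
    unfolding attach_def
  proof (intro exI[of _ p] conjI)
    show "hyper_path 3 p" using walk_hyper_path[OF w] r3 by simp
    show "v \<in> p ! 0" using basic by (simp add: hd_conv_nth)
    show "\<forall>j. 1 \<le> j \<and> j < length p \<longrightarrow> v \<notin> p ! j" using walk_start_notin[OF w] by blast
    show "sub (set p) = Hypergraph (verts (Hypergraph {v} {}) \<union> \<Union> (set p)) (edges (Hypergraph {v} {}) \<union> set p)"
      using vp by auto
  qed auto
  have "attaches (sub (set p)) [(v, q), (v, s)] (Hypergraph V E)"
  proof (rule attaches_all)
    show "connected_edges (set p)" using connected_edges_walk[OF w] .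
    show "pendant u es \<and> u \<in> \<Union> (set p) \<and> hd es \<notin> set p" if "(u, es) \<in> set [(v, q), (v, s)]" for u es
      using that p nin d vp by auto
    show "inc u \<subseteq> set p \<union> (hd \<circ> snd) ` set [(v, q), (v, s)]" if "u \<in> \<Union> (set p)" for u
    proof (cases "u = v")
      case True
      then show ?thesis using inc basic by auto
    next
      case False
      then show ?thesis using pendant_inc[OF p(1) that] by blast
    qed
  qed (use basic d in auto)
  then have "\<exists>H2. attach r (length q) v (sub (set p)) H2 \<and> attach r (length s) v H2 (Hypergraph V E)"
    by simp
  then show ?thesis using 1 unfolding E3_def r3 by blast
qed

lemma F3_build:
  assumes r3: "r = 3" and e: "e \<in> E" "e = {a, b, c}" "distinct [a, b, c]"
    and a: "pendant a p" "inc a = {e, hd p}" "hd p \<noteq> e"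
    and b: "pendant b q" "inc b = {e, hd q}" "hd q \<noteq> e"
    and c: "pendant c s" "inc c = {e, hd s}" "hd s \<noteq> e"
  shows "F3 (length p) (length q) (length s) (Hypergraph V E)"
proof -
  have m: "a \<in> e" "b \<in> e" "c \<in> e" using e by simp_all
  have "attaches (sub {e}) [(a, p), (b, q), (c, s)] (Hypergraph V E)"
  proof (rule attaches_all)
    show "pendant v es \<and> v \<in> \<Union>{e} \<and> hd es \<notin> {e}" if "(v, es) \<in> set [(a, p), (b, q), (c, s)]" for v es
      using that a(1,3) b(1,3) c(1,3) m by auto
    show "inc u \<subseteq> {e} \<union> (hd \<circ> snd) ` set [(a, p), (b, q), (c, s)]" if "u \<in> \<Union>{e}" for u
    proof -
      have "u = a \<or> u = b \<or> u = c" using that e(2) by simp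
      then show ?thesis using a(2) b(2) c(2) by (elim disjE) simp_all
    qed
  qed (use e(1,3) in simp_all)
  moreover have "sub {e} = Hypergraph {a, b, c} {{a, b, c}}" using e by simp
  ultimately show ?thesis using e(3) r3 unfolding F3_def attaches.simps by metis
qed

lemma H4_build:
  assumes r4: "r = 4" and e: "e \<in> E" "e = {a, b, c, d}" "distinct [a, b, c, d]"
    and a: "pendant a p" "inc a = {e, hd p}" "hd p \<noteq> e"
    and b: "pendant b q" "inc b = {e, hd q}" "hd q \<noteq> e"
    and c: "pendant c s" "inc c = {e, hd s}" "hd s \<noteq> e"
    and d: "pendant d t" "inc d = {e, hd t}" "hd t \<noteq> e"
  shows "H4 (length p) (length q) (length s) (length t) (Hypergraph V E)"
proof -
  have m: "a \<in> e" "b \<in> e" "c \<in> e" "d \<in> e" using e by simp_all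
  have "attaches (sub {e}) [(a, p), (b, q), (c, s), (d, t)] (Hypergraph V E)"
  proof (rule attaches_all)
    show "pendant v es \<and> v \<in> \<Union>{e} \<and> hd es \<notin> {e}"
      if "(v, es) \<in> set [(a, p), (b, q), (c, s), (d, t)]" for v es
      using that a(1,3) b(1,3) c(1,3) d(1,3) m by auto
    show "inc u \<subseteq> {e} \<union> (hd \<circ> snd) ` set [(a, p), (b, q), (c, s), (d, t)]" if "u \<in> \<Union>{e}" for u
    proof -
      have "u = a \<or> u = b \<or> u = c \<or> u = d" using that e(2) by simp
      then show ?thesis using a(2) b(2) c(2) d(2) by (elim disjE) simp_all
    qed
  qed (use e(1,3) in simp_all)
  moreover have "sub {e} = Hypergraph {a, b, c, d} {{a, b, c, d}}" using e by simp
  ultimately show ?thesis using e(3) r4 unfolding H4_def attaches.simps by metis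
qed

text \<open>The core is the path \<open>e # es\<close>, with \<open>length es - 1\<close> edges
  strictly between its two end edges. \<open>y\<close> is where the chain enters the last edge, so
  \<open>u3\<close> and \<open>u4\<close> are that edge's free vertices.\<close>

lemma G3_build:
  assumes r3: "r = 3" and e: "e \<in> E" "e = {u1, u2, c}" "distinct [u1, u2, c]"
    and c: "chain c es y" "inc c = {e, hd es}" "hd es \<noteq> e"
    and l: "last es = {y, u3, u4}" "distinct [y, u3, u4]"
    and p1: "pendant u1 p1" "inc u1 = {e, hd p1}" "hd p1 \<noteq> e"
    and p2: "pendant u2 p2" "inc u2 = {e, hd p2}" "hd p2 \<noteq> e"
    and p3: "pendant u3 p3" "inc u3 = {last es, hd p3}" "hd p3 \<noteq> last es"
    and p4: "pendant u4 p4" "inc u4 = {last es, hd p4}" "hd p4 \<noteq> last es"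
  shows "G3 (length p1) (length p2) (length es - 1) (length p3) (length p4) (Hypergraph V E)"
proof -
  let ?L = "e # es"
  have ne: "es \<noteq> []" by (rule chain_ne[OF c(1)])
  note cw = chain_walk[OF c(1)]
  have es: "set es \<subseteq> E" "c \<in> hd es" using walk_basic[OF cw] by auto
  have w: "walk u (e # es)" if "u = u1 \<or> u = u2" for u
    by (rule walk.step[of e u c]) (use that e c cw in auto)
  note w1 = w[of u1, simplified] and w2 = w[of u2, simplified]
  have yl: "y \<in> last es" using l by simp
  have start: "hd p \<notin> set ?L" if "walk u ?L" "pendant u p" "hd p \<noteq> e" for u p
    using walk_start_unique[OF that(1), of "hd p"] that walk_basic(3)[OF pendant_walk[OF that(2)]] by auto
  have ce: "c \<in> e" using e by simp
  have fin: "hd p \<notin> set ?L" if "u = u3 \<or> u = u4" "pendant u p" "hd p \<noteq> last es" for u p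
    using walk_end_unique[OF w1 chain_Cons_prev(2)[OF c(1) ce] chain_Cons_prev(1)[OF c(1) ce], of u "hd p"]
      that l ne walk_basic(3)[OF pendant_walk[OF that(2)]] by auto
  have "attaches (sub (set ?L)) [(u1, p1), (u2, p2), (u3, p3), (u4, p4)] (Hypergraph V E)"
  proof (rule attaches_all)
    show "set ?L \<subseteq> E" using es e by simp
    show "connected_edges (set ?L)" using connected_edges_walk[OF w1] .
    have lin: "last es \<in> set es" using ne by simp
    show "pendant v q \<and> v \<in> \<Union> (set ?L) \<and> hd q \<notin> set ?L"
      if "(v, q) \<in> set [(u1, p1), (u2, p2), (u3, p3), (u4, p4)]" for v q
    proof -
      have m: "u1 \<in> e" "u2 \<in> e" "u3 \<in> last es" "u4 \<in> last es" using e(2) l(1) by simp_all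
      have "u1 \<in> \<Union> (set ?L)" "u2 \<in> \<Union> (set ?L)" "u3 \<in> \<Union> (set ?L)" "u4 \<in> \<Union> (set ?L)"
        using m lin by auto
      moreover have "hd p1 \<notin> set ?L" "hd p2 \<notin> set ?L" "hd p3 \<notin> set ?L" "hd p4 \<notin> set ?L"
        using start[OF w1 p1(1,3)] start[OF w2 p2(1,3)] fin[of u3 p3] fin[of u4 p4] p3(1,3) p4(1,3) by simp_all
      moreover have "v = u1 \<and> q = p1 \<or> v = u2 \<and> q = p2 \<or> v = u3 \<and> q = p3 \<or> v = u4 \<and> q = p4"
        using that by simp
      ultimately show ?thesis using p1(1) p2(1) p3(1) p4(1) by blast
    qed
    have "u3 \<noteq> u1 \<and> u3 \<noteq> u2 \<and> u4 \<noteq> u1 \<and> u4 \<noteq> u2"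
    proof -
      have "u \<notin> last es" if "walk u ?L" for u
        using walk_not_closed[OF that] ne by (cases es) auto
      then have "u1 \<notin> last es" "u2 \<notin> last es" using w1 w2 by blast+
      then show ?thesis unfolding l(1) by blast
    qed
    then show "distinct (map (\<lambda>(v, es). (v, hd es)) [(u1, p1), (u2, p2), (u3, p3), (u4, p4)])"
      using e(3) l(2) by auto
    fix u assume u: "u \<in> \<Union> (set ?L)"
    show "inc u \<subseteq> set ?L \<union> (hd \<circ> snd) ` set [(u1, p1), (u2, p2), (u3, p3), (u4, p4)]"
    proof (cases "u \<in> e")
      case True
      have "hd es \<in> set es" using ne by simp
      moreover have "u = u1 \<or> u = u2 \<or> u = c" using True e(2) by simp
      ultimately show ?thesis using p1(2) p2(2) c(2) by (elim disjE) simp_all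
    next
      case False
      then have uE: "u \<in> \<Union>(set es)" "u \<noteq> c" using u ce by auto
      show ?thesis
      proof (cases "u = u3 \<or> u = u4")
        case True
        then show ?thesis using p3(2) p4(2) lin by (elim disjE) simp_all
      next
        case False
        have "nonleaf (last es) \<subseteq> {y, u3, u4}" unfolding l(1)[symmetric] nonleaf_def by blast
        then have "u \<in> nonleaf (last es) \<longrightarrow> u = y" using False by blast
        then show ?thesis using chain_inc[OF c(1) uE] by auto
      qed
    qed
  qed simp
  then have att: "attaches (path_hypergraph ?L) [(u1, p1), (u2, p2), (u3, p3), (u4, p4)] (Hypergraph V E)"
    by (simp only: path_hypergraph_def)
  have k: "length es - 1 + 2 = length ?L" using ne by (cases es) auto
  have first: "{u1, u2} = ?L ! 0 - ?L ! 1"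
  proof -
    have "es ! 0 = hd es" using ne by (simp add: hd_conv_nth)
    moreover have "u1 \<notin> hd es" "u2 \<notin> hd es"
      using walk_start_notin[OF w1, of 1] walk_start_notin[OF w2, of 1] ne by (auto simp: hd_conv_nth)
    ultimately show ?thesis using es(2) e(3) unfolding e(2) by auto
  qed
  have final: "{u3, u4} = ?L ! (length es - 1 + 1) - ?L ! (length es - 1)"
  proof -
    have a: "?L ! (length es - 1 + 1) = last es" using ne by (simp add: last_conv_nth)
    have b: "length ?L - 2 = length es - 1" by simp
    have yin: "y \<in> ?L ! (length es - 1)" using chain_Cons_prev(1)[OF c(1) ce] unfolding b .
    have mem: "?L ! (length es - 1) \<in> set ?L" by (rule nth_mem) (use ne in simp)
    have neq: "?L ! (length es - 1) \<noteq> last es"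
    proof -
      have "hyper_path r ?L" using walk_hyper_path[OF w1] .
      moreover have "Suc (length es - 1) < length ?L" using ne by simp
      ultimately have "card (?L ! (length es - 1) \<inter> ?L ! Suc (length es - 1)) = 1"
        unfolding hyper_path_def by blast
      then have "card (?L ! (length es - 1) \<inter> last es) = 1" using a by simp
      moreover have "card (last es) = 3" using l by simp
      ultimately show ?thesis by auto
    qed
    have "u \<notin> ?L ! (length es - 1)" if "u = u3 \<or> u = u4" for u
    proof
      assume "u \<in> ?L ! (length es - 1)"
      then have "?L ! (length es - 1) = last ?L"
        by (intro walk_end_unique[OF w1 chain_Cons_prev(2)[OF c(1) ce] chain_Cons_prev(1)[OF c(1) ce] _ _ _ mem])
          (use that l ne in auto)
      then show False using neq ne by simp
    qed
    then have "u3 \<notin> ?L ! (length es - 1)" "u4 \<notin> ?L ! (length es - 1)" by blast+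
    then show ?thesis using yin unfolding a l(1) by blast
  qed
  have "\<exists>H1 H2 H3. attach r (length p1) u1 (path_hypergraph ?L) H1 \<and> attach r (length p2) u2 H1 H2 \<and>
    attach r (length p3) u3 H2 H3 \<and> attach r (length p4) u4 H3 (Hypergraph V E)"
    using att unfolding attaches.simps by blast
  then obtain H1 H2 H3 where H: "attach 3 (length p1) u1 (path_hypergraph ?L) H1" "attach 3 (length p2) u2 H1 H2"
    "attach 3 (length p3) u3 H2 H3" "attach 3 (length p4) u4 H3 (Hypergraph V E)"
    unfolding r3 by blast
  show ?thesis unfolding G3_def
    by (rule exI[of _ ?L], rule exI[of _ u1], rule exI[of _ u2], rule exI[of _ u3], rule exI[of _ u4],
        rule exI[of _ H1], rule exI[of _ H2], rule exI[of _ H3])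
      (use H walk_hyper_path[OF w1] k first final e l r3 in simp)
qed

text \<open>Of the two pendant edges at \<open>v\<close>, one becomes the first edge of the path and
  the other the attached edge; likewise \<open>g\<close> and \<open>h\<close> at \<open>a\<close>.
  The path \<open>e1 # es @ [g]\<close> has \<open>length es + 2\<close> edges, which must equal
  \<open>n - 2\<close>.\<close>

lemma D3_tilde_build:
  assumes r3: "r = 3" and v: "inc v = {e1, e2, hd es}" "distinct [e1, e2, hd es]"
    and e: "nonleaf e1 \<subseteq> {v}" "nonleaf e2 \<subseteq> {v}" and c: "chain v es y"
    and a: "a \<in> last es" "a \<noteq> y" "nonleaf (last es) \<subseteq> {y, a}" "inc a = {last es, g, h}" "distinct [last es, g, h]"
    and gh: "nonleaf g \<subseteq> {a}" "nonleaf h \<subseteq> {a}"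
  shows "D3_tilde (length es + 4) (Hypergraph V E)"
proof -
  let ?L = "e1 # es @ [g]"
  have ne: "es \<noteq> []" by (rule chain_ne[OF c])
  have E: "e1 \<in> E" "v \<in> e1" "e2 \<in> E" "v \<in> e2" "g \<in> E" "a \<in> g" "h \<in> E" "a \<in> h"
    using inc_memD[OF v(1), of e1] inc_memD[OF v(1), of e2] inc_memD[OF a(4), of g] inc_memD[OF a(4), of h]
    by simp_all
  have hdE: "v \<in> hd es" "set es \<subseteq> E" using walk_basic[OF chain_walk[OF c]] by auto
  have wv: "walk v (es @ [g])"
    by (rule chain_append[OF c a(1,2)]) (use E a in \<open>auto intro: walk.single\<close>)
  \<comment> \<open>The walk has to leave \<open>e1\<close> through \<open>v\<close>, so it starts
    at some other vertex of \<open>e1\<close>.\<close>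
  obtain x where x: "x \<in> e1" "x \<noteq> v" using ex_other_vertex[OF E(1)] by blast
  have w: "walk x ?L" by (rule walk.step[of e1 x v]) (use x E v wv ne in auto)
  have wx: "walk x (e1 # es)" by (rule walk.step[of e1 x v]) (use x E v chain_walk[OF c] in auto)
  have lin: "last es \<in> set es" using ne by simp
  have e2L: "e2 \<notin> set ?L"
    using walk_start_unique[OF wv, of e2] E v(2) ne by auto
  have a_unique: "f = last es" if "f \<in> set (e1 # es)" "a \<in> f" for f
    using walk_end_unique[OF wx chain_Cons_prev(2)[OF c E(2)] chain_Cons_prev(1)[OF c E(2)], of a f]
      that chain_last(1)[OF c] a ne by auto
  have hL: "h \<notin> set ?L" using a_unique[of h] E a(5) by auto
  have "attaches (sub (set ?L)) [(v, [e2]), (a, [h])] (Hypergraph V E)"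
  proof (rule attaches_all)
    show "set ?L \<subseteq> E" using hdE E by simp
    show "connected_edges (set ?L)" using connected_edges_walk[OF w] .
    show "pendant u q \<and> u \<in> \<Union> (set ?L) \<and> hd q \<notin> set ?L"
      if "(u, q) \<in> set [(v, [e2]), (a, [h])]" for u q
      using that pendant_single[OF E(3,4) e(2)] pendant_single[OF E(7,8) gh(2)] E e2L hL by auto
    show "distinct (map (\<lambda>(v, es). (v, hd es)) [(v, [e2]), (a, [h])])"
      using hL e2L E a_unique[of e1] a(5) walk_start_unique[OF wv, of g] v(2) ne walk_not_closed[OF wv] by (cases es) auto
    fix u assume u: "u \<in> \<Union> (set ?L)"
    show "inc u \<subseteq> set ?L \<union> (hd \<circ> snd) ` set [(v, [e2]), (a, [h])]"
    proof (cases "u = v \<or> u = a")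
      case True
      have "hd es \<in> set es" using ne by simp
      then show ?thesis using True v(1) a(4) lin by auto
    next
      case False
      show ?thesis
      proof (cases "u \<in> \<Union>(set es)")
        case True
        then show ?thesis using chain_inc[OF c True] False a(3) by auto
      next
        case uE: False
        then have "u \<in> e1 \<or> u \<in> g" using u by auto
        then have "inc u = {e1} \<or> inc u = {g}" using False e(1) gh(1) unfolding nonleaf_def by blast
        then show ?thesis by auto
      qed
    qed
  qed simp
  then have "\<exists>H1. attach r 1 v (path_hypergraph ?L) H1 \<and> attach r 1 a H1 (Hypergraph V E)"
    by (simp add: path_hypergraph_def)
  then obtain H1 where H: "attach 3 1 v (path_hypergraph ?L) H1" "attach 3 1 a H1 (Hypergraph V E)"
    unfolding r3 by blast
  have "?L ! length es = last es" "?L ! Suc (length es) = g"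
    using ne by (cases es rule: rev_cases; simp add: nth_append)+
  moreover have "?L ! 1 = hd es" using ne by (simp add: nth_append hd_conv_nth)
  ultimately show ?thesis unfolding D3_tilde_def
    by (intro exI[of _ ?L], rule_tac exI[of _ v], rule_tac exI[of _ a], rule_tac exI[of _ H1])
      (use H walk_hyper_path[OF w] r3 E hdE a in \<open>simp add: numeral_3_eq_3 numeral_2_eq_2\<close>)
qed

text \<open>The pendant path \<open>q\<close> of length 2 continues the main path beyond the
  branching edge, so that edge is third from the end; \<open>h\<close> is the pendant edge at its
  remaining vertex. The path has \<open>length es + 3\<close> edges, and \<open>last es\<close> has
  index \<open>length es = n - 5\<close>.\<close>

lemma BD3_tilde_build:
  assumes r3: "r = 3" and v: "inc v = {e1, e2, hd es}" "distinct [e1, e2, hd es]"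
    and e: "nonleaf e1 \<subseteq> {v}" "nonleaf e2 \<subseteq> {v}" and c: "chain v es y"
    and l: "last es = {y, a, b}" "distinct [y, a, b]"
    and a: "inc a = {last es, h}" "h \<noteq> last es" "nonleaf h \<subseteq> {a}"
    and b: "inc b = {last es, hd q}" "hd q \<noteq> last es" "pendant b q" "length q = 2"
  shows "BD3_tilde (length es + 5) (Hypergraph V E)"
proof -
  let ?L = "e1 # es @ q"
  have ne: "es \<noteq> []" by (rule chain_ne[OF c])
  have E: "e1 \<in> E" "v \<in> e1" "e2 \<in> E" "v \<in> e2" "h \<in> E" "a \<in> h" "last es \<in> E"
    using inc_memD[OF v(1), of e1] inc_memD[OF v(1), of e2] inc_memD[OF a(1), of h] inc_memD[OF a(1), of "last es"]
    by simp_all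
  have hdE: "v \<in> hd es" "set es \<subseteq> E" using walk_basic[OF chain_walk[OF c]] by auto
  have ab: "a \<in> last es" "b \<in> last es" "y \<in> last es" using l by auto
  have wq: "walk b q" using pendant_walk[OF b(3)] .
  note basicq = walk_basic[OF wq]
  have wv: "walk v (es @ q)"
    by (rule chain_append[OF c ab(2) _ wq b(2)]) (use l in auto)
  obtain x where x: "x \<in> e1" "x \<noteq> v" using ex_other_vertex[OF E(1)] by blast
  have w: "walk x ?L" by (rule walk.step[of e1 x v]) (use x E v wv ne in auto)
  have wx: "walk x (e1 # es)" by (rule walk.step[of e1 x v]) (use x E v chain_walk[OF c] in auto)
  have lin: "last es \<in> set es" using ne by simp
  have e2L: "e2 \<notin> set ?L"
    using walk_start_unique[OF wv, of e2] E v(2) ne by auto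
  have a_unique: "f = last es" if "f \<in> set (e1 # es)" "a \<in> f" for f
    using walk_end_unique[OF wx chain_Cons_prev(2)[OF c E(2)] chain_Cons_prev(1)[OF c E(2)], of a f]
      that l ne by auto
  have waq: "walk a (last es # q)"
    by (rule walk.step[of _ a b]) (use E ab l b wq in auto)
  have aq: "a \<notin> f" if "f \<in> set q" for f
    using walk_start_unique[OF waq, of f] that walk_start_notin[OF waq] by (metis One_nat_def Suc_le_mono Suc_less_eq in_set_conv_nth le0 length_Cons nth_Cons_Suc)
  have hL: "h \<notin> set ?L" using a_unique[of h] E a(2) aq[of h] by auto
  have av: "a \<noteq> v"
    using walk_not_closed[OF wx chain_Cons_prev(2)[OF c E(2)]] a_unique[OF _ , of e1] E ab l ne
      walk_hyper_path[OF wx] walk_start_unique[OF chain_walk[OF c] lin] chain_prev[OF c] walk_not_closed[OF chain_walk[OF c]] by auto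
  have "attaches (sub (set ?L)) [(v, [e2]), (a, [h])] (Hypergraph V E)"
  proof (rule attaches_all)
    show "set ?L \<subseteq> E" using hdE E basicq by simp
    show "connected_edges (set ?L)" using connected_edges_walk[OF w] .
    show "pendant u s \<and> u \<in> \<Union> (set ?L) \<and> hd s \<notin> set ?L"
      if "(u, s) \<in> set [(v, [e2]), (a, [h])]" for u s
      using that pendant_single[OF E(3,4) e(2)] pendant_single[OF E(5,6) a(3)] E e2L hL lin ab by auto
    show "distinct (map (\<lambda>(v, es). (v, hd es)) [(v, [e2]), (a, [h])])" using av by auto
    fix u assume u: "u \<in> \<Union> (set ?L)"
    show "inc u \<subseteq> set ?L \<union> (hd \<circ> snd) ` set [(v, [e2]), (a, [h])]"
    proof (cases "u = v \<or> u = a \<or> u = b")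
      case True
      have "hd es \<in> set es" "hd q \<in> set q" using ne basicq by simp_all
      then show ?thesis using True v(1) a(1) b(1) lin by auto
    next
      case False
      show ?thesis
      proof (cases "u \<in> \<Union>(set es)")
        case True
        have "nonleaf (last es) \<subseteq> {y, a, b}" unfolding l(1)[symmetric] nonleaf_def by blast
        then have "u \<in> nonleaf (last es) \<longrightarrow> u = y" using False by blast
        then show ?thesis using chain_inc[OF c True] False by auto
      next
        case uE: False
        then have "u \<in> e1 \<or> u \<in> \<Union>(set q)" using u by auto
        then show ?thesis
        proof
          assume "u \<in> e1"
          then have "inc u = {e1}" using False e(1) unfolding nonleaf_def by blast
          then show ?thesis by auto
        next
          assume "u \<in> \<Union>(set q)"
          then have "inc u \<subseteq> set q" using pendant_inc[OF b(3)] False by blast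
          then show ?thesis by auto
        qed
      qed
    qed
  qed simp
  then have "\<exists>H1. attach r 1 v (path_hypergraph ?L) H1 \<and> attach r 1 a H1 (Hypergraph V E)"
    by (simp add: path_hypergraph_def)
  then obtain H1 where H: "attach 3 1 v (path_hypergraph ?L) H1" "attach 3 1 a H1 (Hypergraph V E)"
    unfolding r3 by blast
  have Ln: "?L ! length es = last es"
    using ne by (cases es rule: rev_cases) (simp_all add: nth_append)
  have L1: "?L ! 1 = hd es" using ne by (simp add: nth_append hd_conv_nth)
  have others: "a \<notin> ?L ! j" if j: "j < length es + 3" "j \<noteq> length es" for j
  proof (cases "j < length es")
    case True
    have Lj: "?L ! j = (e1 # es) ! j" using True by (cases j) (auto simp: nth_append)
    have hp: "hyper_path 3 ?L" using walk_hyper_path[OF w] r3 by simp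
    show ?thesis
    proof
      assume "a \<in> ?L ! j"
      moreover have "(e1 # es) ! j \<in> set (e1 # es)" using True by (intro nth_mem) simp
      ultimately have eq: "?L ! j = last es" using a_unique Lj by metis
      have c3: "card (last es) = 3" using l by simp
      have "?L ! j \<inter> ?L ! length es = last es" using eq Ln by simp
      moreover have "card (?L ! j \<inter> ?L ! length es) \<le> 1"
      proof (cases "Suc j = length es")
        case True
        then have "Suc j < length ?L" by simp
        then have "card (?L ! j \<inter> ?L ! Suc j) = 1" using hp unfolding hyper_path_def by blast
        then show ?thesis unfolding True by simp
      next
        case False
        then have "j + 2 \<le> length es \<and> length es < length ?L" using \<open>j < length es\<close> by simp
        then have "?L ! j \<inter> ?L ! length es = {}" using hp unfolding hyper_path_def by blast
        then show ?thesis by simp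
      qed
      ultimately show False using c3 by simp
    qed
  next
    case False
    define k where "k = j - Suc (length es)"
    have k: "j = Suc (length es + k)" "k < length q" using j b(4) False by (simp_all add: k_def)
    then have "?L ! j = q ! k" by (simp add: nth_append)
    then show ?thesis using aq k by simp
  qed
  have n: "length es + 5 - 2 = length es + 3" "length es + 5 - 5 = length es" by simp_all
  show ?thesis unfolding BD3_tilde_def n
    by (intro exI[of _ ?L], rule_tac exI[of _ v], rule_tac exI[of _ a], rule_tac exI[of _ H1])
      (use H walk_hyper_path[OF w] r3 E hdE ab b(4) Ln L1 others in simp)
qed

end

section \<open>Classification of the 3-uniform hypertrees\<close>

definition listed3 :: "'a hypergraph \<Rightarrow> bool" where
  "listed3 K \<longleftrightarrow> (\<exists>n\<ge>3. C3 n K) \<or> (\<exists>n\<ge>5. D3_tilde n K) \<or> (\<exists>n\<ge>8. B3_tilde n K) \<or>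
     (\<exists>n\<ge>6. BD3_tilde n K) \<or> C3_2 K \<or> S3_4 K \<or> E3_tilde_6 K \<or> E3_tilde_7 K \<or> E3_tilde_8 K \<or>
     F3 2 3 4 K \<or> F3 2 2 7 K \<or> F3 1 5 6 K \<or> F3 1 4 8 K \<or> F3 1 3 14 K \<or>
     G3 1 1 0 1 4 K \<or> G3 1 1 6 1 3 K"

section \<open>The Diophantine equations\<close>

text \<open>This is 1/x + 1/y + 1/z = 1 with denominators cleared, so the smallest denominator is at
  most 3. The solutions are the classical triples behind the affine diagrams E6, E7 and E8.\<close>

lemma E_arith:
  fixes x y z :: nat
  assumes "2 \<le> x" "x \<le> y" "y \<le> z" and eq: "y * z + x * z + x * y = x * y * z"
  shows "(x, y, z) \<in> {(3, 3, 3), (2, 4, 4), (2, 3, 6)}"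
proof -
  have "x < 4"
  proof (rule ccontr)
    assume "\<not> x < 4"
    then have "4 * (y * z) \<le> x * (y * z)" by (intro mult_right_mono) auto
    moreover have "x * z \<le> y * z" using assms by (intro mult_right_mono) auto
    moreover have "x * y \<le> y * z" using assms mult_le_mono[of x z y y] by (simp add: mult.commute)
    moreover have "y * z > 0" using assms by simp
    ultimately show False using eq[unfolded mult.assoc] by linarith
  qed
  then consider "x = 2" | "x = 3" using assms by linarith
  then show ?thesis
  proof cases
    case 1
    have "y < 5"
    proof (rule ccontr)
      assume "\<not> y < 5"
      then have "5 * z \<le> y * z" by (intro mult_right_mono) auto
      then show False using eq[unfolded 1] assms(3) \<open>\<not> y < 5\<close> by linarith
    qed
    then consider "y = 2" | "y = 3" | "y = 4" using assms by linarith
    then show ?thesis using eq 1 assms by cases auto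
  next
    case 2
    have "y < 4"
    proof (rule ccontr)
      assume "\<not> y < 4"
      then have "4 * z \<le> y * z" by (intro mult_right_mono) auto
      then show False using eq[unfolded 2] assms(3) \<open>\<not> y < 4\<close> by linarith
    qed
    then have "y = 3" using assms 2 by linarith
    then show ?thesis using eq 2 by auto
  qed
qed

text \<open>With all lengths at least 3 the product of the factors 1 + 1/(k + 1) is at most (5/4)^3
  = 125/64, which is below 2. Hence \<open>i\<close> is 1 or 2.\<close>

lemma F_arith:
  fixes i j k :: nat
  assumes "1 \<le> i" "i \<le> j" "j \<le> k" and eq: "(i + 2) * (j + 2) * (k + 2) = 2 * ((i + 1) * (j + 1) * (k + 1))"
  shows "(i, j, k) \<in> {(2, 3, 4), (2, 2, 7), (1, 5, 6), (1, 4, 8), (1, 3, 14)}"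
proof -
  have "i < 3"
  proof (rule ccontr)
    assume "\<not> i < 3"
    then have h: "4 * (i + 2) \<le> 5 * (i + 1)" "4 * (j + 2) \<le> 5 * (j + 1)" "4 * (k + 2) \<le> 5 * (k + 1)"
      using assms(2,3) by presburger+
    have "4 * (i + 2) * (4 * (j + 2)) * (4 * (k + 2)) \<le> 5 * (i + 1) * (5 * (j + 1)) * (5 * (k + 1))"
      by (rule mult_le_mono[OF mult_le_mono[OF h(1,2)] h(3)])
    then have "64 * ((i + 2) * (j + 2) * (k + 2)) \<le> 125 * ((i + 1) * (j + 1) * (k + 1))"
      by (simp add: algebra_simps)
    then show False unfolding eq by simp
  qed
  then consider "i = 1" | "i = 2" using assms by linarith
  then show ?thesis
  proof cases
    case 1
    \<comment> \<open>Equivalently (j - 2) (k - 2) = 12.\<close>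
    have e: "j * k = 2 * j + 2 * k + 8" using eq unfolding 1 by (simp add: algebra_simps)
    have "j < 6"
    proof (rule ccontr)
      assume "\<not> j < 6"
      then have "6 * k \<le> j * k" by (intro mult_right_mono) auto
      then show False using e \<open>\<not> j < 6\<close> assms(3) by linarith
    qed
    then consider "j = 1" | "j = 2" | "j = 3" | "j = 4" | "j = 5" using assms by linarith
    then show ?thesis using e 1 by cases auto
  next
    case 2
    \<comment> \<open>Equivalently (j - 1) (k - 1) = 6.\<close>
    have e: "j * k = j + k + 5" using eq unfolding 2 by (simp add: algebra_simps)
    have "j < 4"
    proof (rule ccontr)
      assume "\<not> j < 4"
      then have "4 * k \<le> j * k" by (intro mult_right_mono) auto
      then show False using e \<open>\<not> j < 4\<close> assms(3) by linarith
    qed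
    then consider "j = 2" | "j = 3" using assms 2 by linarith
    then show ?thesis using e 2 by cases auto
  qed
qed

text \<open>The third factor (9 + n) / (8 + n) belongs to a branch with negative \<open>t\<close>,
  which starts at -9 and ends after \<open>n\<close> edges at -(8 + n). For \<open>k \<ge> 2\<close>
  the product is at most (4/3)^2 (9 + n) / (8 + n), below 2 for every
  \<open>n \<ge> 1\<close>.\<close>

lemma G_arith:
  fixes k l n :: nat
  assumes "1 \<le> k" "k \<le> l" "1 \<le> n" and eq: "(k + 2) * (l + 2) * (9 + n) = 2 * (8 + n) * ((k + 1) * (l + 1))"
  shows "(k, l, n) \<in> {(1, 4, 1), (1, 3, 7)}"
proof -
  have "k < 2"
  proof (rule ccontr)
    assume "\<not> k < 2"
    then have h: "3 * (k + 2) \<le> 4 * (k + 1)" "3 * (l + 2) \<le> 4 * (l + 1)" using assms(2) by presburger+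
    have "3 * (k + 2) * (3 * (l + 2)) * (9 + n) \<le> 4 * (k + 1) * (4 * (l + 1)) * (9 + n)"
      by (rule mult_le_mono[OF mult_le_mono[OF h(1,2)] le_refl])
    then have "9 * ((k + 2) * (l + 2) * (9 + n)) \<le> ((k + 1) * (l + 1)) * (16 * (9 + n))"
      by (simp add: algebra_simps)
    then have "((k + 1) * (l + 1)) * (18 * (8 + n)) \<le> ((k + 1) * (l + 1)) * (16 * (9 + n))"
      unfolding eq by (simp add: algebra_simps)
    then have "18 * (8 + n) \<le> 16 * (9 + n)" by (simp only: mult_le_cancel1) simp
    then show False using assms by simp
  qed
  then have k: "k = 1" using assms by simp
  \<comment> \<open>Equivalently (l - 2) (n + 5) = 12.\<close>
  have e: "l * (n + 5) = 2 * n + 22" using eq unfolding k by (simp add: algebra_simps)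
  have "l > 2"
  proof (rule ccontr)
    assume "\<not> l > 2"
    then have "l * (n + 5) \<le> 2 * (n + 5)" by (intro mult_right_mono) auto
    then show False using e by simp
  qed
  then have "3 * (n + 5) \<le> l * (n + 5)" by (intro mult_right_mono) auto
  then have "n \<le> 7" using e by simp
  then consider "n = 1" | "n = 2" | "n = 3" | "n = 4" | "n = 5" | "n = 6" | "n = 7" using assms by linarith
  then show ?thesis using e k by cases (auto; presburger)+
qed

context hypertree
begin

lemma nonleaf_34:
  assumes "f \<in> E" "a \<in> nonleaf f" "B a f = 3/4"
  obtains g where "inc a = {f, g}" "g \<noteq> f" "g \<in> E" "a \<in> g" "nonleaf g \<subseteq> {a}" "pendant a [g]"
proof -
  obtain g where g: "g \<in> E" "a \<in> g" "inc a = {f, g}" "g \<noteq> f" "B a g = 1 - B a f"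
    using nonleaf_B_ge_half[OF assms(1,2)] assms(3) by auto
  then have "nonleaf g \<subseteq> {a}" using B_quarter assms(3) by simp
  then show thesis using that[OF g(3,4,1,2)] pendant_single g(1,2) by blast
qed

lemma nonleaf_23:
  assumes "f \<in> E" "a \<in> nonleaf f" "B a f = 2/3"
  obtains q where "pendant a q" "inc a = {f, hd q}" "hd q \<noteq> f" "length q = 2"
proof -
  have "B a f > 5/9" using assms(3) by simp
  then obtain p where p: "pendant a p" "inc a = {f, hd p}" "hd p \<noteq> f"
    "B a f = (length p + 2) / (2 * (length p + 1))" "length p \<ge> 1"
    by (rule nonleaf_B_pendant[OF assms(1,2)])
  have "real (length p + 2) / real (2 * (length p + 1)) = 2/3" using p(4) assms(3) by linarith
  then have "length p = 2" by (simp add: field_simps)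
  then show thesis using that p(1-3) by blast
qed

lemma B_prod_edge3:
  assumes "r = 3" "f \<in> E" "f = {y, a, b}" "distinct [y, a, b]"
  shows "B y f * (B a f * B b f) = 1/4"
  using B_prod[OF assms(2)] assms(3,4) by simp

text \<open>The label 1/2 reaches the end of the chain unchanged. At a branching vertex the
  remaining 1/2 splits into two labels 1/4, that is two pendant edges; in a branching edge the other
  labels have product 1/2 = (3/4) (2/3). Two such ends joined by a chain give the D, BD or B
  families.\<close>

lemma half_end:
  assumes r3: "r = 3" and c: "chain v es y" and np: "\<not> plain y (last es)" and half: "B v (hd es) = 1/2"
  obtains (vertex_end) a g h where "a \<in> last es" "a \<noteq> y" "nonleaf (last es) \<subseteq> {y, a}" "inc a = {last es, g, h}"
      "distinct [last es, g, h]" "nonleaf g \<subseteq> {a}" "nonleaf h \<subseteq> {a}"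
  | (edge_end) a b h q where "last es = {y, a, b}" "distinct [y, a, b]"
      "inc a = {last es, h}" "h \<noteq> last es" "nonleaf h \<subseteq> {a}" "pendant a [h]"
      "inc b = {last es, hd q}" "hd q \<noteq> last es" "pendant b q" "length q = 2"
proof -
  define f where "f = last es"
  have l: "y \<in> f" "f \<in> E" using chain_last[OF c] by (auto simp: f_def)
  have By: "B y f = 1/2" using chain_B_half[OF c half] by (simp add: f_def)
  have np': "\<not> plain y f" using np by (simp add: f_def)
  from l(2) np' show thesis
  proof (cases rule: not_plain_cases)
    case leaf
    then have "B y f = 1/4" using B_prod_nonleaf[of f "{y}"] l by simp
    then show thesis using By by simp
  next
    case (vertex a g h)
    have "B y f * B a f = 1/4" using B_prod_nonleaf[of f "{y, a}"] vertex l by simp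
    then have Ba: "B a f = 1/2" using By by simp
    have gh: "g \<in> E" "a \<in> g" "h \<in> E" "a \<in> h" using vertex(4) by (auto simp: subset_iff)
    note ge = B_ge[OF gh(1,2)] B_ge[OF gh(3,4)]
    have sum: "B a f + (B a g + B a h) \<le> 1" using B_sum_subset[OF gh(1,2) vertex(4)] vertex(5) by simp
    have q: "B a g = 1/4" "B a h = 1/4" using ge sum Ba by simp_all
    have "inc a = {f, g, h}"
    proof (rule ccontr)
      assume "inc a \<noteq> {f, g, h}"
      then obtain k where k: "k \<in> inc a" "k \<notin> {f, g, h}" using vertex(4) by blast
      then have "B a k + (\<Sum>x\<in>{f, g, h}. B a x) \<le> 1"
        using B_sum_subset[OF gh(1,2), of "insert k {f, g, h}"] vertex(4) by simp
      then have "B a k + (B a f + (B a g + B a h)) \<le> 1" using vertex(5) by simp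
      then show False using q Ba B_ge[of k a] k by simp
    qed
    then show thesis
      using vertex_end[of a g h] vertex B_quarter[OF gh(1,2) q(1)] B_quarter[OF gh(3,4) q(2)] by (simp add: f_def)
  next
    case (edge a b)
    have ab: "a \<in> f" "b \<in> f" using edge by (auto simp: nonleaf_def)
    have f: "f = {y, a, b}" using edge3[OF r3 l(2) l(1) ab edge(3)] .
    have "1/2 * (B a f * B b f) = 1/4" using B_prod_edge3[OF r3 l(2) f edge(3)] By by simp
    then have prod: "B a f * B b f = 1/2" by simp
    have *: thesis if u: "u \<in> nonleaf f" "w \<in> nonleaf f" "f = {y, u, w}" "distinct [y, u, w]" "B u f = 3/4" "B w f = 2/3" for u w
    proof -
      obtain h where h: "inc u = {f, h}" "h \<noteq> f" "h \<in> E" "u \<in> h" "nonleaf h \<subseteq> {u}" "pendant u [h]"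
        by (rule nonleaf_34[OF l(2) u(1,5)])
      obtain q where q: "pendant w q" "inc w = {f, hd q}" "hd q \<noteq> f" "length q = 2"
        by (rule nonleaf_23[OF l(2) u(2,6)])
      show thesis
        by (rule edge_end[of u w h q, folded f_def, OF u(3,4) h(1,2,5,6) q(2,3,1,4)])
    qed
    show thesis
    proof (cases "B a f = 3/4")
      case True
      have "3/4 * B b f = 1/2" using prod unfolding True .
      then have "B b f = 2/3" by simp
      then show thesis using *[of a b] edge f True by blast
    next
      case nt: False
      show thesis
      proof (cases "B b f = 3/4")
        case True
        have "B a f * (3/4) = 1/2" using prod unfolding True .
        then have "B a f = 2/3" by simp
        moreover have "f = {y, b, a}" using f by blast
        moreover have "distinct [y, b, a]" using edge(3) by auto
        ultimately show thesis using *[of b a] edge(1,2) True by blast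
      next
        case False
        \<comment> \<open>Without a label 3/4 the product is at most 4/9, which is less than
          1/2.\<close>
        then have "B a f \<le> 2/3" "B b f \<le> 2/3" using nt nonleaf_B_cases[OF l(2)] edge(1,2) by blast+
        then have "B a f * B b f \<le> 2/3 * (2/3)"
          using B_pos[OF l(2) ab(1)] B_pos[OF l(2) ab(2)] by (intro mult_mono) auto
        then show thesis using prod by simp
      qed
    qed
  qed
qed

lemma degree3_half:
  assumes r3: "r = 3" and v: "inc v = {e1, e2, e3}" "distinct [e1, e2, e3]"
    and q: "B v e1 = 1/4" "B v e2 = 1/4"
  shows "listed3 (Hypergraph V E)"
proof -
  have E: "e1 \<in> E" "v \<in> e1" "e2 \<in> E" "v \<in> e2" "e3 \<in> E" "v \<in> e3"
    using inc_memD[OF v(1), of e1] inc_memD[OF v(1), of e2] inc_memD[OF v(1), of e3] by simp_all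
  have "B v e1 + (B v e2 + B v e3) = 1" using B_sum_inc[OF E(1,2)] v(2) unfolding v(1) by simp
  then have half: "B v e3 = 1/2" using q by simp
  obtain es y where es: "chain v es y" "hd es = e3" "\<not> plain y (last es)"
    using ex_chain[OF E(5,6)] by blast
  have nl: "nonleaf e1 \<subseteq> {v}" "nonleaf e2 \<subseteq> {v}" using B_quarter E q by auto
  have v': "inc v = {e1, e2, hd es}" "distinct [e1, e2, hd es]" using v es(2) by simp_all
  have half': "B v (hd es) = 1/2" using half es(2) by simp
  have len: "length es \<ge> 1" using chain_ne[OF es(1)] by (cases es) auto
  from r3 es(1,3) half' show ?thesis
  proof (cases rule: half_end)
    case (vertex_end a g h)
    have "D3_tilde (length es + 4) (Hypergraph V E)"
      by (rule D3_tilde_build[OF r3 v' nl es(1) vertex_end])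
    moreover have "length es + 4 \<ge> 5" using len by simp
    ultimately show ?thesis unfolding listed3_def by blast
  next
    case (edge_end a b h q)
    have "BD3_tilde (length es + 5) (Hypergraph V E)"
      by (rule BD3_tilde_build[OF r3 v' nl es(1) edge_end(1-5,7-10)])
    moreover have "length es + 5 \<ge> 6" using len by simp
    ultimately show ?thesis unfolding listed3_def by blast
  qed
qed

lemma E_classification:
  assumes r3: "r = 3" and p: "pendant v p" "pendant v q" "pendant v s"
    and d: "distinct [hd p, hd q, hd s]" and inc: "inc v = {hd p, hd q, hd s}"
  shows "listed3 (Hypergraph V E)"
proof -
  have sorted: "listed3 (Hypergraph V E)"
    if p: "pendant v p" "pendant v q" "pendant v s"
      and d: "distinct [hd p, hd q, hd s]" and inc: "inc v = {hd p, hd q, hd s}"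
      and le: "length p \<le> length q" "length q \<le> length s" for p q s
  proof -
    have E: "hd p \<in> E" "v \<in> hd p" using inc_memD[OF inc, of "hd p"] by simp_all
    have sum: "B v (hd p) + (B v (hd q) + B v (hd s)) = 1"
      using B_sum_inc[OF E] d unfolding inc by simp
    define x y z where "x = length p + 1" and "y = length q + 1" and "z = length s + 1"
    have ge: "2 \<le> x" "x \<le> y" "y \<le> z"
      using pendant_B(2)[OF p(1)] le by (simp_all add: x_def y_def z_def)
    have h: "B v (hd p) = (real x - 1) / (2 * real x)" "B v (hd q) = (real y - 1) / (2 * real y)"
      "B v (hd s) = (real z - 1) / (2 * real z)"
      using pendant_B(1)[OF p(1)] pendant_B(1)[OF p(2)] pendant_B(1)[OF p(3)]
      by (simp_all add: x_def y_def z_def)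
    have "(real x - 1) / (2 * real x) + ((real y - 1) / (2 * real y) + (real z - 1) / (2 * real z)) = 1"
      using sum unfolding h .
    then have "real y * real z + real x * real z + real x * real y = real x * real y * real z"
      using ge by (simp add: field_simps)
    then have "real (y * z + x * z + x * y) = real (x * y * z)" by simp
    then have "y * z + x * z + x * y = x * y * z" by (simp only: of_nat_eq_iff)
    from E_arith[OF ge this] have
      "(length p, length q, length s) \<in> {(2, 2, 2), (1, 3, 3), (1, 2, 5)}"
      by (auto simp: x_def y_def z_def)
    moreover have "E3 (length p) (length q) (length s) (Hypergraph V E)"
      by (rule E3_build[OF r3 p d inc])
    ultimately show ?thesis
      unfolding listed3_def E3_tilde_6_def E3_tilde_7_def E3_tilde_8_def by auto
  qed
  consider "length p \<le> length q" "length q \<le> length s" | "length p \<le> length s" "length s \<le> length q"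
    | "length q \<le> length p" "length p \<le> length s" | "length q \<le> length s" "length s \<le> length p"
    | "length s \<le> length p" "length p \<le> length q" | "length s \<le> length q" "length q \<le> length p"
    by linarith
  then show ?thesis
  proof cases
    case 1 show ?thesis by (rule sorted[of p q s]) (use p d inc 1 in auto)
  next
    case 2 show ?thesis by (rule sorted[of p s q]) (use p d inc 2 in \<open>auto simp: insert_commute\<close>)
  next
    case 3 show ?thesis by (rule sorted[of q p s]) (use p d inc 3 in \<open>auto simp: insert_commute\<close>)
  next
    case 4 show ?thesis by (rule sorted[of q s p]) (use p d inc 4 in \<open>auto simp: insert_commute\<close>)
  next
    case 5 show ?thesis by (rule sorted[of s p q]) (use p d inc 5 in \<open>auto simp: insert_commute\<close>)
  next
    case 6 show ?thesis by (rule sorted[of s q p]) (use p d inc 6 in \<open>auto simp: insert_commute\<close>)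
  qed
qed

text \<open>Pendant labels are 1/4, 1/3, 3/8 and so on. Since 4/9 + 1/3 + 1/4 > 1, one label of at
  least 4/9 at a vertex of degree 3 forces the other two to be 1/4.\<close>

lemma flag_B_cases:
  assumes "e \<in> E" "v \<in> e"
  shows "B v e = 1/4 \<or> B v e \<ge> 1/3"
proof (cases "B v e \<ge> 4/9")
  case False
  then obtain p where p: "pendant v p" "hd p = e" using flag_dichotomy[OF assms] by blast
  have b: "B v e = real (length p) / (2 * (real (length p) + 1))" "length p \<ge> 1"
    using pendant_B[OF p(1)] p(2) by simp_all
  show ?thesis
  proof (cases "length p = 1")
    case False
    then have "real (length p) \<ge> 2" using b(2) by linarith
    then have "1/3 \<le> real (length p) / (2 * (real (length p) + 1))" by (simp add: le_divide_eq)
    then show ?thesis unfolding b(1) by blast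
  qed (simp add: b(1))
qed simp

lemma degree3_classification:
  assumes r3: "r = 3" and c: "card (inc v) = 3"
  shows "listed3 (Hypergraph V E)"
proof -
  obtain e1 e2 e3 where v: "inc v = {e1, e2, e3}" and d: "distinct [e1, e2, e3]"
    using c by (auto simp: card_3_iff)
  have E: "e1 \<in> E" "v \<in> e1" "e2 \<in> E" "v \<in> e2" "e3 \<in> E" "v \<in> e3"
    using inc_memD[OF v, of e1] inc_memD[OF v, of e2] inc_memD[OF v, of e3] by simp_all
  have sum: "B v e1 + (B v e2 + B v e3) = 1" using B_sum_inc[OF E(1,2)] d unfolding v by simp
  note ge = B_ge[OF E(1,2)] B_ge[OF E(3,4)] B_ge[OF E(5,6)]
  note cs = flag_B_cases[OF E(1,2)] flag_B_cases[OF E(3,4)] flag_B_cases[OF E(5,6)]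
  consider "B v e1 \<ge> 4/9" | "B v e2 \<ge> 4/9" | "B v e3 \<ge> 4/9"
    | p q s where "pendant v p" "hd p = e1" "pendant v q" "hd q = e2" "pendant v s" "hd s = e3"
    using flag_dichotomy[OF E(1,2)] flag_dichotomy[OF E(3,4)] flag_dichotomy[OF E(5,6)] by blast
  then show ?thesis
  proof cases
    case 1
    then have "B v e2 = 1/4" "B v e3 = 1/4" using sum ge cs by linarith+
    then show ?thesis using v d by (intro degree3_half[OF r3, of v e2 e3 e1]) auto
  next
    case 2
    then have "B v e1 = 1/4" "B v e3 = 1/4" using sum ge cs by linarith+
    then show ?thesis using v d by (intro degree3_half[OF r3, of v e1 e3 e2]) auto
  next
    case 3
    then have "B v e1 = 1/4" "B v e2 = 1/4" using sum ge cs by linarith+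
    then show ?thesis using v d by (intro degree3_half[OF r3, of v e1 e2 e3]) auto
  next
    case (4 p q s)
    then show ?thesis using v d by (intro E_classification[OF r3, of v p q s]) simp_all
  qed
qed

lemma pendant_B_edge:
  assumes "e \<in> E" "pendant u t" "inc u = {e, hd t}" "hd t \<noteq> e"
  shows "B u e = (real (length t) + 2) / (2 * (real (length t) + 1))" "u \<in> e" "u \<in> nonleaf e"
proof -
  show u: "u \<in> e" using inc_memD[OF assms(3), of e] by simp
  then show "u \<in> nonleaf e" using assms(3,4) by (auto simp: nonleaf_def doubleton_eq_iff)
  have "B u e + B u (hd t) = 1" using B_sum_inc[OF assms(1) u] assms(4) unfolding assms(3) by simp
  then have "B u e = 1 - real (length t) / (2 * (real (length t) + 1))"
    using pendant_B(1)[OF assms(2)] by (simp add: algebra_simps)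
  then show "B u e = (real (length t) + 2) / (2 * (real (length t) + 1))" by (simp add: field_simps)
qed

lemma F_classification:
  assumes r3: "r = 3" and e: "e \<in> E" "e = {a, b, c}" "distinct [a, b, c]"
    and a: "pendant a p" "inc a = {e, hd p}" "hd p \<noteq> e"
    and b: "pendant b q" "inc b = {e, hd q}" "hd q \<noteq> e"
    and c: "pendant c s" "inc c = {e, hd s}" "hd s \<noteq> e"
  shows "listed3 (Hypergraph V E)"
proof -
  have sorted: "listed3 (Hypergraph V E)"
    if e': "e = {a, b, c}" "distinct [a, b, c]"
      and a: "pendant a p" "inc a = {e, hd p}" "hd p \<noteq> e"
      and b: "pendant b q" "inc b = {e, hd q}" "hd q \<noteq> e"
      and c: "pendant c s" "inc c = {e, hd s}" "hd s \<noteq> e"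
      and le: "length p \<le> length q" "length q \<le> length s" for a b c p q s
  proof -
    note B1 = pendant_B_edge(1)[OF e(1)]
    define i j k where "i = length p" and "j = length q" and "k = length s"
    have prod: "B a e * (B b e * B c e) = 1/4" using B_prod_edge3[OF r3 e(1) e'] .
    have "(real i + 2) / (2 * (real i + 1)) * ((real j + 2) / (2 * (real j + 1)) * ((real k + 2) / (2 * (real k + 1)))) = 1/4"
      using prod unfolding B1[OF a] B1[OF b] B1[OF c] i_def j_def k_def .
    then have "(real i + 2) * ((real j + 2) * (real k + 2)) = 2 * ((real i + 1) * ((real j + 1) * (real k + 1)))"
      by (simp add: divide_simps) (simp add: algebra_simps)
    then have "real ((i + 2) * (j + 2) * (k + 2)) = real (2 * ((i + 1) * (j + 1) * (k + 1)))"
      by (simp only: of_nat_mult of_nat_add of_nat_numeral of_nat_1 mult.assoc)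
    then have eq: "(i + 2) * (j + 2) * (k + 2) = 2 * ((i + 1) * (j + 1) * (k + 1))"
      by (simp only: of_nat_eq_iff)
    have "(i, j, k) \<in> {(2, 3, 4), (2, 2, 7), (1, 5, 6), (1, 4, 8), (1, 3, 14)}"
      by (rule F_arith[OF _ _ _ eq]) (use pendant_B(2)[OF a(1)] le in \<open>simp_all add: i_def j_def k_def\<close>)
    moreover have "F3 i j k (Hypergraph V E)"
      unfolding i_def j_def k_def by (rule F3_build[OF r3 e(1) e' a b c])
    ultimately show ?thesis unfolding listed3_def by auto
  qed
  have perm: "e = {a, c, b}" "e = {b, a, c}" "e = {b, c, a}" "e = {c, a, b}" "e = {c, b, a}"
    using e(2) by blast+
  have d: "distinct [a, c, b]" "distinct [b, a, c]" "distinct [b, c, a]" "distinct [c, a, b]" "distinct [c, b, a]"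
    using e(3) by auto
  consider "length p \<le> length q" "length q \<le> length s" | "length p \<le> length s" "length s \<le> length q"
    | "length q \<le> length p" "length p \<le> length s" | "length q \<le> length s" "length s \<le> length p"
    | "length s \<le> length p" "length p \<le> length q" | "length s \<le> length q" "length q \<le> length p"
    by linarith
  then show ?thesis
  proof cases
    case 1 show ?thesis by (rule sorted[OF e(2,3) a b c 1])
  next
    case 2 show ?thesis by (rule sorted[OF perm(1) d(1) a c b 2])
  next
    case 3 show ?thesis by (rule sorted[OF perm(2) d(2) b a c 3])
  next
    case 4 show ?thesis by (rule sorted[OF perm(3) d(3) b c a 4])
  next
    case 5 show ?thesis by (rule sorted[OF perm(4) d(4) c a b 5])
  next
    case 6 show ?thesis by (rule sorted[OF perm(5) d(5) c b a 6])
  qed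
qed

section \<open>Trees in which every vertex lies in at most two edges\<close>

context
  assumes r3: "r = 3" and deg2: "\<And>v. card (inc v) \<le> 2"
begin

lemma deg2_nonleaf:
  assumes "e \<in> E" "a \<in> nonleaf e"
  obtains g where "g \<in> E" "a \<in> g" "inc a = {e, g}" "g \<noteq> e" "B a g = 1 - B a e"
proof -
  have ae: "a \<in> e" "inc a \<noteq> {e}" using assms(2) by (auto simp: nonleaf_def)
  obtain g where g: "g \<in> inc a" "g \<noteq> e" using inc_other[OF assms(1) ae] by blast
  have "{e, g} \<subseteq> inc a" using g ae assms(1) by simp
  moreover have "card (inc a) \<le> card {e, g}" using deg2[of a] g(2) by simp
  ultimately have inc: "inc a = {e, g}" using card_seteq[OF finite_inc] by metis
  have "B a e + B a g = 1" using B_sum_inc[OF assms(1) ae(1)] g(2) unfolding inc by simp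
  then have "B a g = 1 - B a e" by simp
  moreover have "g \<in> E" "a \<in> g" using g(1) by simp_all
  ultimately show thesis using that inc g(2) by blast
qed

lemma no_branch_vertex: "{f, g, h} \<subseteq> inc a \<Longrightarrow> distinct [f, g, h] \<Longrightarrow> False"
  using card_mono[OF finite_inc, of "{f, g, h}" a] deg2[of a] by simp

text \<open>Descend along child flags that do not start a pendant path. At a lowest such flag every
  exit carries a pendant path, and there must be two exits, since with none or one the flag itself
  would start a pendant path.\<close>

lemma ex_end_edge:
  assumes "e \<in> E" "v \<in> nonleaf e" "\<nexists>p. pendant v p \<and> hd p = e"
  shows "\<exists>f a b c p q. f \<in> E \<and> f = {a, b, c} \<and> distinct [a, b, c] \<and>
    pendant a p \<and> inc a = {f, hd p} \<and> hd p \<noteq> f \<and> pendant b q \<and> inc b = {f, hd q} \<and> hd q \<noteq> f \<and>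
    c \<in> nonleaf f" (is ?concl)
proof -
  have "snd p \<in> E \<Longrightarrow> fst p \<in> nonleaf (snd p) \<Longrightarrow> \<nexists>q. pendant (fst p) q \<and> hd q = snd p \<Longrightarrow> ?concl" for p
    using wf_child
  proof (induction p rule: wf_induct_rule)
    case (less p)
    obtain v e where p: "p = (v, e)" by (cases p)
    have e: "e \<in> E" "v \<in> nonleaf e" "\<nexists>q. pendant v q \<and> hd q = e" using less.prems p by simp_all
    have ve: "v \<in> e" using e(2) by (simp add: nonleaf_def)
    \<comment> \<open>At an exit \<open>a\<close> there is only one other edge; either it starts a
      pendant path, or it gives a smaller flag to which the induction hypothesis applies.\<close>
    have descend: "(\<exists>q. pendant a q \<and> inc a = {e, hd q} \<and> hd q \<noteq> e) \<or> ?concl"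
      if a: "a \<in> nonleaf e" "a \<noteq> v" for a
    proof -
      obtain g where g: "g \<in> E" "a \<in> g" "inc a = {e, g}" "g \<noteq> e" by (rule deg2_nonleaf[OF e(1) a(1)])
      have "a \<in> e" using a(1) by (simp add: nonleaf_def)
      then have ch: "((a, g), p) \<in> child" using g a(2) e(1) ve p by (simp add: child_def)
      have ag: "a \<in> nonleaf g" using g by (auto simp: nonleaf_def doubleton_eq_iff)
      show ?thesis
      proof (cases "\<exists>q. pendant a q \<and> hd q = g")
        case True
        then show ?thesis using g(3,4) by blast
      next
        case False
        then have ?concl using less.IH[OF ch] g(1) ag by simp
        then show ?thesis ..
      qed
    qed
    have "\<not> nonleaf e \<subseteq> {v}"
      using pendant_single[OF e(1) ve] e(3) by (metis list.sel(1))
    then obtain a where a: "a \<in> nonleaf e" "a \<noteq> v" by blast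
    have ae: "a \<in> e" using a(1) by (simp add: nonleaf_def)
    show ?case
    proof (cases ?concl)
      case False
      then obtain q where q: "pendant a q" "inc a = {e, hd q}" "hd q \<noteq> e" using descend[OF a] by blast
      have "\<not> nonleaf e \<subseteq> {v, a}"
        using pendant_step[OF e(1) ve ae a(2) q(3,2) _ q(1)] e(3) by (metis list.sel(1))
      then obtain b where b: "b \<in> nonleaf e" "b \<noteq> v" "b \<noteq> a" by blast
      then obtain s where s: "pendant b s" "inc b = {e, hd s}" "hd s \<noteq> e" using descend[of b] False by blast
      have be: "b \<in> e" using b(1) by (simp add: nonleaf_def)
      have d: "distinct [a, b, v]" using a b by auto
      have "e = {a, b, v}" by (rule edge3[OF r3 e(1) ae be ve d])
      with e(1,2) d q s have C: "e \<in> E \<and> e = {a, b, v} \<and> distinct [a, b, v] \<and>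
        pendant a q \<and> inc a = {e, hd q} \<and> hd q \<noteq> e \<and> pendant b s \<and> inc b = {e, hd s} \<and> hd s \<noteq> e \<and>
        v \<in> nonleaf e" by (intro conjI)
      show ?thesis by (intro exI, rule C)
    qed
  qed
  from this[of "(v, e)"] show ?thesis using assms by simp
qed

text \<open>Two pendant edges leave label 4/9 at \<open>c\<close>, hence 5/9 for the branch beyond
  it. All labels down the chain stay above 1/2, so the chain can only end in a branching edge, and
  both further branches there turn out to be pendant paths.\<close>

lemma G_classification:
  assumes e: "e \<in> E" "e = {a, b, c}" "distinct [a, b, c]" "a \<in> nonleaf e" "b \<in> nonleaf e" "c \<in> nonleaf e"
    and B: "B a e = 3/4" "B b e = 3/4"
  shows "listed3 (Hypergraph V E)"
proof -
  obtain ga where ga: "inc a = {e, ga}" "ga \<noteq> e" "ga \<in> E" "a \<in> ga" "nonleaf ga \<subseteq> {a}" "pendant a [ga]"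
    by (rule nonleaf_34[OF e(1,4) B(1)])
  obtain gb where gb: "inc b = {e, gb}" "gb \<noteq> e" "gb \<in> E" "b \<in> gb" "nonleaf gb \<subseteq> {b}" "pendant b [gb]"
    by (rule nonleaf_34[OF e(1,5) B(2)])
  obtain g where g: "g \<in> E" "c \<in> g" "inc c = {e, g}" "g \<noteq> e" "B c g = 1 - B c e"
    by (rule deg2_nonleaf[OF e(1,6)])
  have "3/4 * (3/4 * B c e) = 1/4" using B_prod_edge3[OF r3 e(1-3)] unfolding B .
  then have Bg: "B c g = 5/9" using g(5) by simp
  obtain es y where es: "chain c es y" "hd es = g" "\<not> plain y (last es)"
    using ex_chain[OF g(1,2)] by blast
  define n where "n = length es"
  have n: "n \<ge> 1" using chain_ne[OF es(1)] by (cases es) (auto simp: n_def)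
  \<comment> \<open>The form required by \<open>chain_B_down\<close> with
    \<open>c = 9\<close>.\<close>
  have "B c (hd es) = (9 + 1) / (2 * 9)" using Bg es(2) by simp
  from chain_B_down[OF es(1) _ this]
  have Bend: "B y (last es) = (9 + real n) / (2 * (8 + real n))" by (simp add: n_def algebra_simps)
  define f where "f = last es"
  have l: "y \<in> f" "f \<in> E" using chain_last[OF es(1)] by (simp_all add: f_def)
  have Bf: "B y f = (9 + real n) / (2 * (8 + real n))" using Bend by (simp add: f_def)
  have gt: "B y f > 1/2" unfolding Bf by (simp add: field_simps)
  have "\<not> plain y f" using es(3) by (simp add: f_def)
  with l(2) show ?thesis
  proof (cases rule: not_plain_cases)
    case leaf
    then have "B y f = 1/4" using B_prod_nonleaf[of f "{y}"] l by simp
    then show ?thesis using gt by simp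
  next
    case (vertex a g h)
    then show ?thesis using no_branch_vertex[OF vertex(4,5)] by simp
  next
    case (edge u w)
    have uw: "u \<in> f" "w \<in> f" using edge by (auto simp: nonleaf_def)
    have f: "f = {y, u, w}" using edge3[OF r3 l(2) l(1) uw edge(3)] .
    have prod: "B y f * (B u f * B w f) = 1/4" using B_prod_edge3[OF r3 l(2) f edge(3)] .
    have le: "B u f \<le> 3/4" "B w f \<le> 3/4" using B_le_34[OF l(2)] edge(1,2) by auto
    have pos: "B u f > 0" "B w f > 0" using B_pos[OF l(2)] uw by auto
    have Bf_le: "B y f \<le> 5/9" unfolding Bf using n by (simp add: field_simps)
    have "1/4 \<le> 5/9 * (B u f * B w f)"
      using prod Bf_le pos by (metis less_imp_le mult_pos_pos mult_right_mono)
    then have prod_ge: "9/20 \<le> B u f * B w f" by simp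
    \<comment> \<open>As each factor is at most 3/4, a product of at least 9/20 makes each factor at
      least 3/5, above the threshold 5/9 for pendant paths.\<close>
    have "B u f * B w f \<le> B u f * (3/4)" "B u f * B w f \<le> 3/4 * B w f"
      using le pos by (auto intro: mult_left_mono mult_right_mono)
    then have "B u f > 5/9" "B w f > 5/9" using prod_ge by linarith+
    then obtain p q where p: "pendant u p" "inc u = {f, hd p}" "hd p \<noteq> f"
      and q: "pendant w q" "inc w = {f, hd q}" "hd q \<noteq> f"
      using nonleaf_B_pendant[OF l(2)] edge(1,2) by metis
    have sorted: "listed3 (Hypergraph V E)"
      if f: "f = {y, u, w}" "distinct [y, u, w]"
        and p: "pendant u p" "inc u = {f, hd p}" "hd p \<noteq> f"
        and q: "pendant w q" "inc w = {f, hd q}" "hd q \<noteq> f" and lpq: "length p \<le> length q" for u w p q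
    proof -
      define k m where "k = length p" and "m = length q"
      have Bu: "B u f = (real k + 2) / (2 * (real k + 1))" "B w f = (real m + 2) / (2 * (real m + 1))"
        using pendant_B_edge(1)[OF l(2) p] pendant_B_edge(1)[OF l(2) q] by (simp_all add: k_def m_def)
      have "(9 + real n) / (2 * (8 + real n)) * ((real k + 2) / (2 * (real k + 1)) * ((real m + 2) / (2 * (real m + 1)))) = 1/4"
        using B_prod_edge3[OF r3 l(2) f] unfolding Bf Bu .
      then have "(9 + real n) * ((real k + 2) * (real m + 2)) = 2 * (8 + real n) * ((real k + 1) * (real m + 1))"
        by (simp add: divide_simps) (simp add: algebra_simps)
      then have "(real k + 2) * (real m + 2) * (9 + real n) = 2 * (8 + real n) * ((real k + 1) * (real m + 1))"
        by (simp only: mult.commute)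
      then have "real ((k + 2) * (m + 2) * (9 + n)) = real (2 * (8 + n) * ((k + 1) * (m + 1)))"
        by (simp only: of_nat_mult of_nat_add of_nat_numeral of_nat_1)
      then have eq: "(k + 2) * (m + 2) * (9 + n) = 2 * (8 + n) * ((k + 1) * (m + 1))"
        by (simp only: of_nat_eq_iff)
      have "1 \<le> k" "k \<le> m" using pendant_B(2)[OF p(1)] lpq by (simp_all add: k_def m_def)
      from G_arith[OF this n eq] have cs: "(k, m, n) \<in> {(1, 4, 1), (1, 3, 7)}" .
      have "G3 (length [ga]) (length [gb]) (length es - 1) (length p) (length q) (Hypergraph V E)"
        by (rule G3_build[OF r3 e(1-3) es(1), of u w])
          (use g(3,4) es(2) ga(1,2,6) gb(1,2,6) f p q in \<open>simp_all add: f_def[symmetric] del: insert_iff\<close>)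
      then have "G3 1 1 (n - 1) k m (Hypergraph V E)" by (simp add: n_def k_def m_def)
      then show ?thesis using cs unfolding listed3_def by auto
    qed
    show ?thesis
    proof (cases "length p \<le> length q")
      case True
      then show ?thesis using sorted[OF f edge(3) p q] by blast
    next
      case False
      moreover have "f = {y, w, u}" "distinct [y, w, u]" using f edge(3) by auto
      ultimately show ?thesis using sorted[OF _ _ q p] by simp
    qed
  qed
qed

text \<open>If the branch beyond \<open>c\<close> is not pendant, its label is at least 4/9, which
  limits the pendant lengths at \<open>f\<close> to 1 and at most 4. Length 2 is the balanced case
  with label 1/2; for length 1 the branch has label 5/9; for lengths 3 and 4 it is below 1/2, and
  then the other end of the chain must carry two pendant edges.\<close>

lemma end_edge_classification:
  assumes f: "f \<in> E" "f = {a, b, c}" "distinct [a, b, c]"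
    and p: "pendant a p" "inc a = {f, hd p}" "hd p \<noteq> f"
    and q: "pendant b q" "inc b = {f, hd q}" "hd q \<noteq> f"
    and le: "length p \<le> length q" and c: "c \<in> nonleaf f"
  shows "listed3 (Hypergraph V E)"
proof -
  obtain g where g: "g \<in> E" "c \<in> g" "inc c = {f, g}" "g \<noteq> f" "B c g = 1 - B c f"
    by (rule deg2_nonleaf[OF f(1) c])
  show ?thesis
  proof (cases "\<exists>s. pendant c s \<and> hd s = g")
    case True
    then obtain s where s: "pendant c s" "hd s = g" by blast
    show ?thesis by (rule F_classification[OF r3 f p q s(1)]) (use s(2) g in simp_all)
  next
    case nonpendant: False
    then have ge: "B c g \<ge> 4/9" using flag_dichotomy[OF g(1,2)] by blast
    obtain es y where es: "chain c es y" "hd es = g" "\<not> plain y (last es)"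
      using ex_chain[OF g(1,2)] by blast
    define i j where "i = length p" and "j = length q"
    have i: "i \<ge> 1" "i \<le> j" using pendant_B(2)[OF p(1)] le by (simp_all add: i_def j_def)
    have Bab: "B a f = (real i + 2) / (2 * (real i + 1))" "B b f = (real j + 2) / (2 * (real j + 1))"
      using pendant_B_edge(1)[OF f(1) p] pendant_B_edge(1)[OF f(1) q] by (simp_all add: i_def j_def)
    have prod: "(real i + 2) / (2 * (real i + 1)) * ((real j + 2) / (2 * (real j + 1)) * B c f) = 1/4"
      using B_prod_edge3[OF r3 f] unfolding Bab .
    then have prod': "(real i + 2) * (real j + 2) * B c f = (real i + 1) * (real j + 1)"
      by (simp add: field_simps)
    have Bc: "B c f \<le> 5/9" using ge g(5) by simp
    have "(real i + 2) * (real j + 2) * B c f \<le> (real i + 2) * (real j + 2) * (5/9)"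
      by (intro mult_left_mono Bc) simp
    then have "9 * ((real i + 1) * (real j + 1)) \<le> 5 * ((real i + 2) * (real j + 2))" using prod' by simp
    then have "real (9 * ((i + 1) * (j + 1))) \<le> real (5 * ((i + 2) * (j + 2)))" by (simp add: algebra_simps)
    then have "9 * ((i + 1) * (j + 1)) \<le> 5 * ((i + 2) * (j + 2))" by (simp only: of_nat_le_iff)
    then have bnd: "4 * (i * j) \<le> i + j + 11" by (simp add: algebra_simps)
    have i1: "i = 1"
    proof (rule ccontr)
      assume "i \<noteq> 1"
      then have "2 \<le> i" using i by simp
      then have "2 * j \<le> i * j" by (intro mult_right_mono) auto
      moreover have "2 * j \<ge> 4" using \<open>2 \<le> i\<close> i by simp
      ultimately have "i + j + 11 \<ge> 8 * j" using bnd by linarith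
      then have "j \<le> 1" using i by linarith
      then show False using \<open>2 \<le> i\<close> i by simp
    qed
    then have "j \<le> 4" using bnd by simp
    then consider "j = 1" | "j = 2" | "j = 3 \<or> j = 4" using i i1 by linarith
    then show ?thesis
    proof cases
      case 1
      have "B a f = 3/4" "B b f = 3/4" using Bab i1 1 by simp_all
      then show ?thesis
        using G_classification[OF f] pendant_B_edge(3)[OF f(1) p] pendant_B_edge(3)[OF f(1) q] c by blast
    next
      case 2
      have "B c f = 1/2" using prod' i1 2 by simp
      then have half: "B c (hd es) = 1/2" using g(5) es(2) by simp
      from r3 es(1,3) half show ?thesis
      proof (cases rule: half_end)
        case (vertex_end a g h)
        then show ?thesis using no_branch_vertex[of "last es" g h a] by simp
      next
        case (edge_end u w h s)
        have "G3 (length p) (length q) (length es - 1) (length [h]) (length s) (Hypergraph V E)"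
          by (rule G3_build[OF r3 f es(1) _ _ edge_end(1,2) p q edge_end(6) _ _ edge_end(9,7,8)])
            (use g(3,4) es(2) edge_end(3,4) in simp_all)
        then have G: "G3 1 2 (length es - 1) 1 2 (Hypergraph V E)"
          using i1 2 edge_end(10) by (simp add: i_def j_def)
        have "length es \<ge> 1" using chain_ne[OF es(1)] by (cases es) auto
        then have "length es + 7 - 8 = length es - 1" "length es + 7 \<ge> 8" by simp_all
        then show ?thesis using G unfolding listed3_def B3_tilde_def by metis
      qed
    next
      case 3
      have lt: "B c g < 1/2"
      proof -
        have "B c f > 1/2" using 3 prod' i1 by auto
        then show ?thesis using g(5) by simp
      qed
      define h where "h = last es"
      have l: "y \<in> h" "h \<in> E" using chain_last[OF es(1)] by (simp_all add: h_def)
      \<comment> \<open>Contrapositive of \<open>chain_B_mono\<close> at the fixed point: a label of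
        at least 1/2 at the bottom would force one at the top.\<close>
      have Bh: "B y h < 1/2"
        using chain_B_mono[OF es(1), of "1/2"] lt es(2) by (force simp: h_def)
      have "\<not> plain y h" using es(3) by (simp add: h_def)
      with l(2) show ?thesis
      proof (cases rule: not_plain_cases)
        case leaf
        then have "pendant c es" using es(1) by (auto simp: pendant_def h_def)
        then show ?thesis using nonpendant es(2) by blast
      next
        case (vertex a g h)
        then show ?thesis using no_branch_vertex[OF vertex(4,5)] by simp
      next
        case (edge u w)
        have uw: "u \<in> h" "w \<in> h" using edge by (auto simp: nonleaf_def)
        have h: "h = {y, u, w}" using edge3[OF r3 l(2) l(1) uw edge(3)] .
        have prod: "B y h * (B u h * B w h) = 1/4" using B_prod_edge3[OF r3 l(2) h edge(3)] .
        have pos: "B u h > 0" "B w h > 0" using B_pos[OF l(2)] uw by auto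
        have "B y h * (B u h * B w h) < 1/2 * (B u h * B w h)" using Bh pos by (intro mult_strict_right_mono) auto
        then have gt: "B u h * B w h > 1/2" using prod by simp
        have le: "B u h \<le> 3/4" "B w h \<le> 3/4" using B_le_34[OF l(2)] edge(1,2) by auto
        \<comment> \<open>The product exceeds 1/2 = (3/4) (2/3), so neither factor can fall into the
          lower range of \<open>nonleaf_B_cases\<close>. The roles of the two ends are then
          exchanged.\<close>
        have eq: "B u h = 3/4" "B w h = 3/4"
        proof (rule_tac [!] ccontr)
          assume "B u h \<noteq> 3/4"
          then have "B u h \<le> 2/3" using nonleaf_B_cases[OF l(2) edge(1)] by blast
          then have "B u h * B w h \<le> 2/3 * (3/4)" using le pos by (intro mult_mono) auto
          then show False using gt by simp
        next
          assume "B w h \<noteq> 3/4"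
          then have "B w h \<le> 2/3" using nonleaf_B_cases[OF l(2) edge(2)] by blast
          then have "B u h * B w h \<le> 3/4 * (2/3)" using le pos by (intro mult_mono) auto
          then show False using gt by simp
        qed
        have yn: "y \<in> nonleaf h"
        proof (rule ccontr)
          assume "y \<notin> nonleaf h"
          then have "inc y = {h}" using l(1) by (simp add: nonleaf_def)
          then show False using B_eq_1[OF l(2,1)] Bh by simp
        qed
        have "h = {u, w, y}" "distinct [u, w, y]" using h edge(3) by auto
        then show ?thesis using G_classification[OF l(2) _ _ edge(1,2) yn eq] by blast
      qed
    qed
  qed
qed

text \<open>Either some nonleaf flag fails to start a pendant path and an end edge exists, or every
  branch is pendant. In the latter case all labels of an edge exceed 1/2, so two nonleaf vertices or
  fewer would give a product above 1/4; all three are nonleaf and the hypergraph is of type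
  F.\<close>

lemma deg2_classification: "listed3 (Hypergraph V E)"
proof -
  have *: "listed3 (Hypergraph V E)" if ne: "e \<in> E" "v \<in> nonleaf e" "\<nexists>p. pendant v p \<and> hd p = e" for e v
  proof -
    obtain f a b c p q where f: "f \<in> E" "f = {a, b, c}" "distinct [a, b, c]"
      and p: "pendant a p" "inc a = {f, hd p}" "hd p \<noteq> f"
      and q: "pendant b q" "inc b = {f, hd q}" "hd q \<noteq> f" and c: "c \<in> nonleaf f"
      using ex_end_edge[OF ne] by (elim exE conjE) (rule that)
    show ?thesis
    proof (cases "length p \<le> length q")
      case True
      then show ?thesis using end_edge_classification[OF f p q _ c] by blast
    next
      case False
      moreover have "f = {b, a, c}" "distinct [b, a, c]" using f(2,3) by auto
      ultimately show ?thesis using end_edge_classification[OF f(1) _ _ q p _ c] by simp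
    qed
  qed
  show ?thesis
  proof (cases "\<exists>e v. e \<in> E \<and> v \<in> nonleaf e \<and> (\<nexists>p. pendant v p \<and> hd p = e)")
    case True
    then show ?thesis using * by blast
  next
    case all: False
    obtain e where e: "e \<in> E" using E_ne by blast
    have "card e = 3" using card_edge[OF e] r3 by simp
    then obtain a b c where abc: "e = {a, b, c}" "distinct [a, b, c]" by (auto simp: card_3_iff)
    have pend: "\<exists>p. pendant u p \<and> inc u = {e, hd p} \<and> hd p \<noteq> e" if u: "u \<in> nonleaf e" for u
    proof -
      obtain g where g: "g \<in> E" "u \<in> g" "inc u = {e, g}" "g \<noteq> e" by (rule deg2_nonleaf[OF e u])
      then have "u \<in> nonleaf g" by (auto simp: nonleaf_def doubleton_eq_iff)
      then show ?thesis using all g by blast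
    qed
    have gt: "B u e > 1/2" if u: "u \<in> e" for u
    proof (cases "u \<in> nonleaf e")
      case True
      then obtain p where p: "pendant u p" "inc u = {e, hd p}" "hd p \<noteq> e" using pend by blast
      show ?thesis unfolding pendant_B_edge(1)[OF e p] by (simp add: field_simps)
    next
      case False
      then have "inc u = {e}" using u by (simp add: nonleaf_def)
      then show ?thesis using B_eq_1[OF e u] by simp
    qed
    have abc_in: "a \<in> e" "b \<in> e" "c \<in> e" using abc by auto
    show ?thesis
    proof (cases "{a, b, c} \<subseteq> nonleaf e")
      case True
      then have "a \<in> nonleaf e" "b \<in> nonleaf e" "c \<in> nonleaf e" by auto
      then obtain p q s where "pendant a p" "inc a = {e, hd p}" "hd p \<noteq> e"
        "pendant b q" "inc b = {e, hd q}" "hd q \<noteq> e" "pendant c s" "inc c = {e, hd s}" "hd s \<noteq> e"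
        using pend by meson
      then show ?thesis by (rule F_classification[OF r3 e abc])
    next
      case False
      have "nonleaf e \<subseteq> {a, b, c}" unfolding abc(1)[symmetric] nonleaf_def by blast
      then consider "nonleaf e \<subseteq> {b, c}" | "nonleaf e \<subseteq> {a, c}" | "nonleaf e \<subseteq> {a, b}"
        using False by blast
      then have "\<exists>u w. u \<in> e \<and> w \<in> e \<and> u \<noteq> w \<and> nonleaf e \<subseteq> {u, w}"
      proof cases
        case 1
        then have "b \<in> e \<and> c \<in> e \<and> b \<noteq> c \<and> nonleaf e \<subseteq> {b, c}" using abc_in abc(2) by simp
        then show ?thesis by (intro exI)
      next
        case 2
        then have "a \<in> e \<and> c \<in> e \<and> a \<noteq> c \<and> nonleaf e \<subseteq> {a, c}" using abc_in abc(2) by simp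
        then show ?thesis by (intro exI)
      next
        case 3
        then have "a \<in> e \<and> b \<in> e \<and> a \<noteq> b \<and> nonleaf e \<subseteq> {a, b}" using abc_in abc(2) by simp
        then show ?thesis by (intro exI)
      qed
      then obtain u w where u: "u \<in> e" "w \<in> e" "u \<noteq> w" "nonleaf e \<subseteq> {u, w}" by blast
      then have "B u e * B w e = 1/4" using B_prod_nonleaf[OF e u(4)] by simp
      moreover have "1/2 * (1/2) < B u e * B w e" using gt[OF u(1)] gt[OF u(2)] by (intro mult_strict_mono) auto
      ultimately show ?thesis by simp
    qed
  qed
qed

end

lemma tree_classification:
  assumes r3: "r = 3"
  shows "listed3 (Hypergraph V E)"
proof (cases "\<forall>v. card (inc v) \<le> 2")
  case True
  then show ?thesis using deg2_classification[OF r3] by blast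
next
  case False
  then obtain v where v: "\<not> card (inc v) \<le> 2" by blast
  show ?thesis
  proof (cases "card (inc v) = 3")
    case True
    then show ?thesis by (rule degree3_classification[OF r3])
  next
    case False
    then have "S3_4 (Hypergraph V E)" using v by (intro S3_4_build[OF r3, of v]) linarith
    then show ?thesis unfolding listed3_def by blast
  qed
qed

section \<open>The 4-uniform case\<close>

text \<open>At least two labels are 3/4, since (2/3)^3 (3/4) = 2/9 < 1/4. Three are impossible, as
  the fourth would be 16/27. With exactly two, the others are at most 2/3 and have product 4/9 =
  (2/3)^2, so both equal 2/3.\<close>

lemma H4_classification:
  assumes r4: "r = 4" and e: "e \<in> E" "card (nonleaf e) = 4"
  shows "H4 1 1 2 2 (Hypergraph V E)"
proof -
  have "nonleaf e = e"
    using card_subset_eq[OF finite_edge[OF e(1)], of "nonleaf e"] e card_edge[OF e(1)] r4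
    by (auto simp: nonleaf_def)
  then have nl: "x \<in> nonleaf e" if "x \<in> e" for x using that by simp
  obtain L where L: "set L = e" "distinct L" using finite_distinct_list[OF finite_edge[OF e(1)]] by blast
  then have "length L = 4" using distinct_card[OF L(2)] card_edge[OF e(1)] r4 by simp
  then obtain a b c d where "L = [a, b, c, d]"
    by (auto simp: eval_nat_numeral length_Suc_conv)
  then have abcd: "e = {a, b, c, d}" "distinct [a, b, c, d]" using L by auto
  then have mem: "a \<in> e" "b \<in> e" "c \<in> e" "d \<in> e" by auto
  have prod: "B a e * (B b e * (B c e * B d e)) = 1/4"
    using B_prod[OF e(1)] abcd by simp
  have cs: "B x e = 3/4 \<or> B x e \<le> 2/3" if "x \<in> e" for x using nonleaf_B_cases[OF e(1) nl[OF that]] .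
  have pos: "B x e > 0" if "x \<in> e" for x using B_pos[OF e(1) that] .
  \<comment> \<open>16/27 = (1/4) / (3/4)^3 exceeds 5/9, so it would belong to a pendant path of
    some length \<open>k\<close> with \<open>27 * (k + 2) = 32 * (k + 1)\<close>, that is 5 k =
    22.\<close>
  have no: "B x e \<noteq> 16/27" if xe: "x \<in> e" for x
  proof
    assume x: "B x e = 16/27"
    then have "B x e > 5/9" by simp
    then obtain p where "pendant x p" "inc x = {e, hd p}" "hd p \<noteq> e"
      and p: "B x e = (length p + 2) / (2 * (length p + 1))" "length p \<ge> 1"
      by (rule nonleaf_B_pendant[OF e(1) nl[OF xe]])
    have "real (length p + 2) / real (2 * (length p + 1)) = 16/27" using p(1) x by linarith
    then have "real (27 * (length p + 2)) = real (32 * (length p + 1))" by (simp add: field_simps)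
    then have "27 * (length p + 2) = 32 * (length p + 1)" by (simp only: of_nat_eq_iff)
    then show False by presburger
  qed
  have two: "B z e = 2/3 \<and> B w e = 2/3"
    if "B z e * B w e = 4/9" "B z e \<le> 2/3" "B w e \<le> 2/3" "z \<in> e" "w \<in> e" for z w
  proof -
    have "B z e * B w e \<le> B z e * (2/3)" "B z e * B w e \<le> 2/3 * B w e"
      using that pos[of z] pos[of w] by (auto intro: mult_left_mono mult_right_mono)
    then show ?thesis using that by linarith
  qed
  have build: "H4 1 1 2 2 (Hypergraph V E)"
    if x: "e = {x, y, z, w}" "distinct [x, y, z, w]" "B x e = 3/4" "B y e = 3/4" "B z e = 2/3" "B w e = 2/3" for x y z w
  proof -
    have xe: "x \<in> e" "y \<in> e" "z \<in> e" "w \<in> e" using x(1) by auto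
    obtain g where g: "inc x = {e, g}" "g \<noteq> e" "g \<in> E" "x \<in> g" "nonleaf g \<subseteq> {x}" "pendant x [g]"
      by (rule nonleaf_34[OF e(1) nl[OF xe(1)] x(3)])
    obtain h where h: "inc y = {e, h}" "h \<noteq> e" "h \<in> E" "y \<in> h" "nonleaf h \<subseteq> {y}" "pendant y [h]"
      by (rule nonleaf_34[OF e(1) nl[OF xe(2)] x(4)])
    obtain p where p: "pendant z p" "inc z = {e, hd p}" "hd p \<noteq> e" "length p = 2"
      by (rule nonleaf_23[OF e(1) nl[OF xe(3)] x(5)])
    obtain q where q: "pendant w q" "inc w = {e, hd q}" "hd q \<noteq> e" "length q = 2"
      by (rule nonleaf_23[OF e(1) nl[OF xe(4)] x(6)])
    have "H4 (length [g]) (length [h]) (length p) (length q) (Hypergraph V E)"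
      by (rule H4_build[OF r4 e(1) x(1,2) g(6) _ _ h(6) _ _ p(1-3) q(1-3)]) (use g h in simp_all)
    then show ?thesis using p(4) q(4) by simp
  qed
  have three: False if "3/4 * (3/4 * (3/4 * B x e)) = 1/4" "x \<in> e" for x
    using no[OF that(2)] that(1) by simp
  have small: False
    if "B x e \<le> 2/3" "B y e \<le> 2/3" "B z e \<le> 2/3" "B x e * (B y e * (B z e * B w e)) = 1/4"
      "x \<in> e" "y \<in> e" "z \<in> e" "w \<in> e" for x y z w
  proof -
    have "B x e * (B y e * (B z e * B w e)) \<le> 2/3 * (2/3 * (2/3 * (3/4)))"
      using that pos[of x] pos[of y] pos[of z] pos[of w] B_le_34[OF e(1) nl[of w]]
      by (intro mult_mono) auto
    then show False using that by simp
  qed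
  have pairs: "H4 1 1 2 2 (Hypergraph V E)"
    if x: "e = {x, y, z, w}" "distinct [x, y, z, w]" "B x e = 3/4" "B y e = 3/4"
      "B x e * (B y e * (B z e * B w e)) = 1/4" for x y z w
  proof -
    have zw: "z \<in> e" "w \<in> e" using x(1) by auto
    have prod: "3/4 * (3/4 * (B z e * B w e)) = 1/4" using x(5) unfolding x(3,4) .
    consider "B z e = 3/4" | "B w e = 3/4" | "B z e \<le> 2/3" "B w e \<le> 2/3" using cs zw by blast
    then show ?thesis
    proof cases
      case 1
      have "3/4 * (3/4 * (3/4 * B w e)) = 1/4" using prod unfolding 1 .
      then show ?thesis using three zw(2) by blast
    next
      case 2
      have "3/4 * (3/4 * (B z e * (3/4))) = 1/4" using prod unfolding 2 .
      then have "3/4 * (3/4 * (3/4 * B z e)) = 1/4" by simp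
      then show ?thesis using three zw(1) by blast
    next
      case 3
      have "B z e * B w e = 4/9" using prod by linarith
      then show ?thesis using build[OF x(1-4)] two[of z w] 3 zw by blast
    qed
  qed
  have P: "e = {a, c, b, d}"
    "e = {a, d, b, c}"
    "e = {b, c, a, d}"
    "e = {b, d, a, c}"
    "e = {c, d, a, b}"
    unfolding abcd(1) by (simp_all add: insert_commute)
  have D: "distinct [a, c, b, d]"
    "distinct [a, d, b, c]"
    "distinct [b, c, a, d]"
    "distinct [b, d, a, c]"
    "distinct [c, d, a, b]"
    using abcd(2) by auto
  have R: "B a e * (B c e * (B b e * B d e)) = 1/4"
    "B a e * (B d e * (B b e * B c e)) = 1/4"
    "B b e * (B c e * (B a e * B d e)) = 1/4"
    "B b e * (B d e * (B a e * B c e)) = 1/4"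
    "B c e * (B d e * (B a e * B b e)) = 1/4"
    using prod by (simp_all add: mult_ac)
  consider "B a e = 3/4" "B b e = 3/4" | "B a e = 3/4" "B c e = 3/4" | "B a e = 3/4" "B d e = 3/4"
    | "B b e = 3/4" "B c e = 3/4" | "B b e = 3/4" "B d e = 3/4" | "B c e = 3/4" "B d e = 3/4"
    | "B a e \<le> 2/3" "B b e \<le> 2/3" "B c e \<le> 2/3" | "B a e \<le> 2/3" "B b e \<le> 2/3" "B d e \<le> 2/3"
    | "B a e \<le> 2/3" "B c e \<le> 2/3" "B d e \<le> 2/3" | "B b e \<le> 2/3" "B c e \<le> 2/3" "B d e \<le> 2/3"
    using cs[OF mem(1)] cs[OF mem(2)] cs[OF mem(3)] cs[OF mem(4)] by argo
  then show ?thesis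
  proof cases
    case 1 show ?thesis by (rule pairs[OF abcd 1 prod])
  next
    case 2 show ?thesis by (rule pairs[OF P(1) D(1) 2 R(1)])
  next
    case 3 show ?thesis by (rule pairs[OF P(2) D(2) 3 R(2)])
  next
    case 4 show ?thesis by (rule pairs[OF P(3) D(3) 4 R(3)])
  next
    case 5 show ?thesis by (rule pairs[OF P(4) D(4) 5 R(4)])
  next
    case 6 show ?thesis by (rule pairs[OF P(5) D(5) 6 R(5)])
  next
    case 7 then show ?thesis using small[of a b c d] mem prod by blast
  next
    case 8 then show ?thesis using small[of a b d c] mem prod by (simp add: mult_ac)
  next
    case 9 then show ?thesis using small[of a c d b] mem prod by (simp add: mult_ac)
  next
    case 10 then show ?thesis using small[of b c d a] mem prod by (simp add: mult_ac)
  qed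
qed

end

section \<open>Return to uniformity r\<close>

text \<open>\<open>shrink\<close> exhibits \<open>H\<close> itself, not merely a copy of it, as an
  iterated extension, so the identity serves as the isomorphism.\<close>

lemma isomorphic_to_extended:
  assumes "X K" "(extends ^^ (r - s)) H K"
  shows "isomorphic_to H (extended s r X)"
proof -
  have "hypergraph_iso H H" unfolding hypergraph_iso_def by (intro exI[of _ id]) auto
  then show ?thesis using assms unfolding isomorphic_to_def extended_def by blast
qed

theorem theorem5:
  fixes r :: nat and H :: "'a hypergraph"
  assumes "r \<ge> 4"
    and "uniform_hypergraph r H"
    and "connected_hypergraph H"
    and "spectral_radius r H = fact (r - 1) * root r 4"
  shows
    "((\<exists>n\<ge>3. isomorphic_to H (extended 3 r (C3 n))) \<or>
      (\<exists>n\<ge>5. isomorphic_to H (extended 3 r (D3_tilde n))) \<or>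
      (\<exists>n\<ge>8. isomorphic_to H (extended 3 r (B3_tilde n))) \<or>
      (\<exists>n\<ge>6. isomorphic_to H (extended 3 r (BD3_tilde n))) \<or>
      isomorphic_to H (extended 3 r C3_2) \<or>
      isomorphic_to H (extended 3 r S3_4) \<or>
      isomorphic_to H (extended 3 r E3_tilde_6) \<or>
      isomorphic_to H (extended 3 r E3_tilde_7) \<or>
      isomorphic_to H (extended 3 r E3_tilde_8) \<or>
      isomorphic_to H (extended 3 r (F3 2 3 4)) \<or>
      isomorphic_to H (extended 3 r (F3 2 2 7)) \<or>
      isomorphic_to H (extended 3 r (F3 1 5 6)) \<or>
      isomorphic_to H (extended 3 r (F3 1 4 8)) \<or>
      isomorphic_to H (extended 3 r (F3 1 3 14)) \<or>
      isomorphic_to H (extended 3 r (G3 1 1 0 1 4)) \<or>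
      isomorphic_to H (extended 3 r (G3 1 1 6 1 3))) \<or>
     isomorphic_to H (extended 4 r (H4 1 1 2 2))"
proof -
  obtain B where B: "normal_labelling r (verts H) (edges H) B"
    using normal_labelling_exists[OF _ assms(2-4)] assms(1) by auto
  interpret H: normal_labelling r "verts H" "edges H" B by (rule B)
  show ?thesis
  \<comment> \<open>No edge has more than four nonleaf vertices, so uniformity 4 can always be
    reached; uniformity 3 can be reached exactly when no edge has four.\<close>
  proof (cases "\<exists>e\<in>edges H. card (H.nonleaf e) = 4")
    case True
    then obtain e where e: "e \<in> edges H" "card (H.nonleaf e) = 4" by blast
    have "3 \<le> (4::nat)" by simp
    from B this assms(1) H.card_nonleaf_le
    obtain V' E' B' where K: "normal_labelling 4 V' E' B'"
      and ext: "(extends ^^ (r - 4)) (Hypergraph (verts H) (edges H)) (Hypergraph V' E')"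
      and nl: "\<forall>e\<in>edges H. \<exists>e'\<in>E'. normal_labelling.nonleaf E' e' = H.nonleaf e"
      by (rule shrink)
    interpret K: normal_labelling 4 V' E' B' by (rule K)
    obtain e' where e': "e' \<in> E'" "card (K.nonleaf e') = 4" using nl e by force
    \<comment> \<open>On a cycle every edge has exactly two nonleaf vertices, but \<open>e'\<close>
      has four.\<close>
    have "wf K.child"
      using K.card_nonleaf_cycle[OF _ e'(1)] e'(2) by fastforce
    then interpret K: hypertree 4 V' E' B' by unfold_locales
    have "H4 1 1 2 2 (Hypergraph V' E')" by (rule K.H4_classification[OF refl e'])
    then have "isomorphic_to H (extended 4 r (H4 1 1 2 2))"
      using isomorphic_to_extended ext by (metis hypergraph.collapse)
    then show ?thesis by blast
  next
    case False
    then have le: "card (H.nonleaf e) \<le> 3" if "e \<in> edges H" for e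
    proof -
      have "card (H.nonleaf e) \<noteq> 4" using False that by blast
      then show ?thesis using H.card_nonleaf_le[OF that] by linarith
    qed
    have "3 \<le> r" using assms(1) by simp
    from B le_refl this le
    obtain V' E' B' where K: "normal_labelling 3 V' E' B'"
      and ext: "(extends ^^ (r - 3)) (Hypergraph (verts H) (edges H)) (Hypergraph V' E')"
      and "\<forall>e\<in>edges H. \<exists>e'\<in>E'. normal_labelling.nonleaf E' e' = H.nonleaf e"
      by (rule shrink)
    interpret K: normal_labelling 3 V' E' B' by (rule K)
    have "listed3 (Hypergraph V' E')"
    proof (cases "wf K.child")
      case True
      then interpret K: hypertree 3 V' E' B' by unfold_locales
      show ?thesis by (rule K.tree_classification[OF refl])
    next
      case False
      then show ?thesis using K.cycle_classification[OF False refl] unfolding listed3_def by blast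
    qed
    moreover have iso: "isomorphic_to H (extended 3 r X)" if "X (Hypergraph V' E')" for X
      by (rule isomorphic_to_extended[of X, OF that]) (use ext in simp)
    ultimately show ?thesis unfolding listed3_def
      by (elim disjE exE conjE) (blast intro: iso)+
  qed
qed

end
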